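(* Let $\mathcal M$ be a model of a complete, model complete o-minimal theory $T$ extending $\mathrm{RCF}$, with underlying set $M$. If $\delta$ is a derivation on $\mathcal M$, then $\delta$ is an $\mathrm{RCF}$-derivation on $\mathcal M$.
   Context: $\mathrm{RCF}$ is the theory of real closed ordered fields in the language of ordered rings; $T$ is in a language extending it. A derivation on $\mathcal M$ is a map $\delta:M\to M$ with $\delta(x+y)=\delta x+\delta y$ and $\delta(xy)=x\delta y+y\delta x$ for all $x,y\in M$. A map $\delta:M\to M$ is an $\mathrm{RCF}$-derivation on $\mathcal M$ if for every $n$, every open $U\subseteq M^n$ and every $\mathcal C^1$-function $f:U\to M$ which is definable without parameters in the underlying real closed ordered field of $\mathcal M$ (in the language of ordered rings), we have $\delta f(\bar u)=\mathbf J_f(\bar u)\,\delta\bar u$ for all $\bar u\in U$, where $\mathbf J_f$ is the Jacobian matrix and $\delta\bar u=(\delta u_1,\dots,\delta u_n)$. *)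

theory Defs
  imports "HOL-Algebra.Ring"
begin

section \<open>First-order languages, formulas and structures\<close>

text \<open>A language assigns an arity to each of its symbols; names mapped to \<^const>\<open>None\<close> do not
  belong to it.\<close>

record ('f, 'r) language =
  fun_arity :: "'f \<Rightarrow> nat option"
  rel_arity :: "'r \<Rightarrow> nat option"

definition extends_language :: "('f, 'r) language \<Rightarrow> ('f, 'r) language \<Rightarrow> bool" where
  "extends_language L0 L \<longleftrightarrow> fun_arity L0 \<subseteq>\<^sub>m fun_arity L \<and> rel_arity L0 \<subseteq>\<^sub>m rel_arity L"

datatype 'f trm = Var nat | App 'f "'f trm list"

text \<open>Variables are de Bruijn indices: \<open>Exists \<phi>\<close> binds index \<open>0\<close> in \<open>\<phi>\<close>.\<close>

datatype ('f, 'r) form =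
    Equal "'f trm" "'f trm"
  | Pred 'r "'f trm list"
  | Neg "('f, 'r) form"
  | Conj "('f, 'r) form" "('f, 'r) form"
  | Exists "('f, 'r) form"

abbreviation Disj :: "('f, 'r) form \<Rightarrow> ('f, 'r) form \<Rightarrow> ('f, 'r) form" where
  "Disj \<phi> \<psi> \<equiv> Neg (Conj (Neg \<phi>) (Neg \<psi>))"

abbreviation Impl :: "('f, 'r) form \<Rightarrow> ('f, 'r) form \<Rightarrow> ('f, 'r) form" where
  "Impl \<phi> \<psi> \<equiv> Neg (Conj \<phi> (Neg \<psi>))"

abbreviation Forall :: "('f, 'r) form \<Rightarrow> ('f, 'r) form" where
  "Forall \<phi> \<equiv> Neg (Exists (Neg \<phi>))"

fun trm_of :: "('f, 'r) language \<Rightarrow> 'f trm \<Rightarrow> bool" where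
  "trm_of L (Var i) \<longleftrightarrow> True"
| "trm_of L (App s ts) \<longleftrightarrow> fun_arity L s = Some (length ts) \<and> (\<forall>t\<in>set ts. trm_of L t)"

primrec form_of :: "('f, 'r) language \<Rightarrow> ('f, 'r) form \<Rightarrow> bool" where
  "form_of L (Equal s t) \<longleftrightarrow> trm_of L s \<and> trm_of L t"
| "form_of L (Pred r ts) \<longleftrightarrow> rel_arity L r = Some (length ts) \<and> (\<forall>t\<in>set ts. trm_of L t)"
| "form_of L (Neg \<phi>) \<longleftrightarrow> form_of L \<phi>"
| "form_of L (Conj \<phi> \<psi>) \<longleftrightarrow> form_of L \<phi> \<and> form_of L \<psi>"
| "form_of L (Exists \<phi>) \<longleftrightarrow> form_of L \<phi>"

fun trm_vars :: "'f trm \<Rightarrow> nat set" where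
  "trm_vars (Var i) = {i}"
| "trm_vars (App s ts) = (\<Union>t\<in>set ts. trm_vars t)"

primrec free_vars :: "('f, 'r) form \<Rightarrow> nat set" where
  "free_vars (Equal s t) = trm_vars s \<union> trm_vars t"
| "free_vars (Pred r ts) = (\<Union>t\<in>set ts. trm_vars t)"
| "free_vars (Neg \<phi>) = free_vars \<phi>"
| "free_vars (Conj \<phi> \<psi>) = free_vars \<phi> \<union> free_vars \<psi>"
| "free_vars (Exists \<phi>) = {i. Suc i \<in> free_vars \<phi>}"

definition sentences :: "('f, 'r) language \<Rightarrow> ('f, 'r) form set" where
  "sentences L = {\<phi>. form_of L \<phi> \<and> free_vars \<phi> = {}}"

record ('f, 'r, 'a) fo_struct =
  univ :: "'a set"
  fun_int :: "'f \<Rightarrow> 'a list \<Rightarrow> 'a"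
  rel_int :: "'r \<Rightarrow> 'a list \<Rightarrow> bool"

definition tuples :: "('f, 'r, 'a) fo_struct \<Rightarrow> nat \<Rightarrow> 'a list set" where
  "tuples M n = {xs. length xs = n \<and> set xs \<subseteq> univ M}"

definition structure_for :: "('f, 'r) language \<Rightarrow> ('f, 'r, 'a) fo_struct \<Rightarrow> bool" where
  "structure_for L M \<longleftrightarrow> univ M \<noteq> {} \<and>
     (\<forall>s n. fun_arity L s = Some n \<longrightarrow> fun_int M s \<in> tuples M n \<rightarrow> univ M)"

fun trm_val :: "('f, 'r, 'a) fo_struct \<Rightarrow> (nat \<Rightarrow> 'a) \<Rightarrow> 'f trm \<Rightarrow> 'a" where
  "trm_val M e (Var i) = e i"
| "trm_val M e (App s ts) = fun_int M s (map (trm_val M e) ts)"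

primrec sat :: "('f, 'r, 'a) fo_struct \<Rightarrow> (nat \<Rightarrow> 'a) \<Rightarrow> ('f, 'r) form \<Rightarrow> bool" where
  "sat M e (Equal s t) \<longleftrightarrow> trm_val M e s = trm_val M e t"
| "sat M e (Pred r ts) \<longleftrightarrow> rel_int M r (map (trm_val M e) ts)"
| "sat M e (Neg \<phi>) \<longleftrightarrow> \<not> sat M e \<phi>"
| "sat M e (Conj \<phi> \<psi>) \<longleftrightarrow> sat M e \<phi> \<and> sat M e \<psi>"
| "sat M e (Exists \<phi>) \<longleftrightarrow> (\<exists>x\<in>univ M. sat M (case_nat x e) \<phi>)"

definition holds :: "('f, 'r, 'a) fo_struct \<Rightarrow> ('f, 'r) form \<Rightarrow> bool" where
  "holds M \<sigma> \<longleftrightarrow> (\<forall>e. range e \<subseteq> univ M \<longrightarrow> sat M e \<sigma>)"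

definition is_model :: "('f, 'r) language \<Rightarrow> ('f, 'r) form set \<Rightarrow> ('f, 'r, 'a) fo_struct \<Rightarrow> bool" where
  "is_model L T M \<longleftrightarrow> structure_for L M \<and> (\<forall>\<sigma>\<in>T. holds M \<sigma>)"

section \<open>Theories\<close>

text \<open>HOL cannot quantify over the models of a theory on all types at once.  The notions below
  therefore take a type \<open>'u\<close> and quantify over the models whose universe is a subset of \<open>'u\<close>.
  By the Loewenheim--Skolem theorem they agree with the usual notions (quantifying over all
  models) as soon as \<open>'u\<close> is at least as large as the type of formulas, in particular for
  \<open>'u = 'a + ('f, 'r) form\<close>, which also has room for every structure on \<open>'a\<close>.\<close>

definition is_theory :: "('f, 'r) language \<Rightarrow> ('f, 'r) form set \<Rightarrow> bool" where
  "is_theory L T \<longleftrightarrow> T \<subseteq> sentences L"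

definition entails ::
  "'u itself \<Rightarrow> ('f, 'r) language \<Rightarrow> ('f, 'r) form set \<Rightarrow> ('f, 'r) form \<Rightarrow> bool" where
  "entails U L T \<sigma> \<longleftrightarrow> (\<forall>M :: ('f, 'r, 'u) fo_struct. is_model L T M \<longrightarrow> holds M \<sigma>)"

definition extends_theory ::
  "'u itself \<Rightarrow> ('f, 'r) language \<Rightarrow> ('f, 'r) form set \<Rightarrow> ('f, 'r) form set \<Rightarrow> bool" where
  "extends_theory U L T0 T \<longleftrightarrow> (\<forall>\<sigma>\<in>T0. entails U L T \<sigma>)"

definition complete_theory :: "'u itself \<Rightarrow> ('f, 'r) language \<Rightarrow> ('f, 'r) form set \<Rightarrow> bool" where
  "complete_theory U L T \<longleftrightarrow>
     (\<exists>M :: ('f, 'r, 'u) fo_struct. is_model L T M) \<and>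
     (\<forall>\<sigma>\<in>sentences L. entails U L T \<sigma> \<or> entails U L T (Neg \<sigma>))"

definition substructure ::
  "('f, 'r) language \<Rightarrow> ('f, 'r, 'a) fo_struct \<Rightarrow> ('f, 'r, 'a) fo_struct \<Rightarrow> bool" where
  "substructure L M N \<longleftrightarrow> univ M \<subseteq> univ N \<and>
     (\<forall>s n. fun_arity L s = Some n \<longrightarrow> (\<forall>xs\<in>tuples M n. fun_int M s xs = fun_int N s xs)) \<and>
     (\<forall>r n. rel_arity L r = Some n \<longrightarrow> (\<forall>xs\<in>tuples M n. rel_int M r xs = rel_int N r xs))"

definition elementary_substructure ::
  "('f, 'r) language \<Rightarrow> ('f, 'r, 'a) fo_struct \<Rightarrow> ('f, 'r, 'a) fo_struct \<Rightarrow> bool" where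
  "elementary_substructure L M N \<longleftrightarrow> substructure L M N \<and>
     (\<forall>\<phi> e. form_of L \<phi> \<longrightarrow> range e \<subseteq> univ M \<longrightarrow> sat M e \<phi> = sat N e \<phi>)"

definition model_complete :: "'u itself \<Rightarrow> ('f, 'r) language \<Rightarrow> ('f, 'r) form set \<Rightarrow> bool" where
  "model_complete U L T \<longleftrightarrow>
     (\<forall>(M :: ('f, 'r, 'u) fo_struct) N.
        is_model L T M \<longrightarrow> is_model L T N \<longrightarrow> substructure L M N \<longrightarrow> elementary_substructure L M N)"

definition definable ::
  "('f, 'r) language \<Rightarrow> ('f, 'r, 'a) fo_struct \<Rightarrow> nat \<Rightarrow> 'a list set \<Rightarrow> bool" where
  "definable L M n S \<longleftrightarrow>
     (\<exists>\<phi>. form_of L \<phi> \<and> free_vars \<phi> \<subseteq> {..<n} \<and> S = {xs \<in> tuples M n. sat M (nth xs) \<phi>})"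

text \<open>Definability with parameters of subsets of the universe: index \<open>0\<close> stands for the element,
  and the remaining indices are evaluated by the parameters.\<close>

definition definable_with_parameters ::
  "('f, 'r) language \<Rightarrow> ('f, 'r, 'a) fo_struct \<Rightarrow> 'a set \<Rightarrow> bool" where
  "definable_with_parameters L M S \<longleftrightarrow>
     (\<exists>\<phi> p. form_of L \<phi> \<and> range p \<subseteq> univ M \<and> S = {x \<in> univ M. sat M (case_nat x p) \<phi>})"

section \<open>Ordered rings and real closed ordered fields\<close>

text \<open>\<open>Extra_fun\<close> and \<open>Extra_rel\<close> supply names for the further symbols of a language extending
  the language of ordered rings.\<close>

datatype 'f ofun = Zero_sym | One_sym | Plus_sym | Minus_sym | Times_sym | Extra_fun 'f

datatype 'r orel = Less_sym | Extra_rel 'r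

definition oring_language :: "('f ofun, 'r orel) language" where
  "oring_language = \<lparr>
     fun_arity = (\<lambda>s. case s of Zero_sym \<Rightarrow> Some 0 | One_sym \<Rightarrow> Some 0 | Plus_sym \<Rightarrow> Some 2
                     | Minus_sym \<Rightarrow> Some 1 | Times_sym \<Rightarrow> Some 2 | Extra_fun _ \<Rightarrow> None),
     rel_arity = (\<lambda>r. case r of Less_sym \<Rightarrow> Some 2 | Extra_rel _ \<Rightarrow> None)\<rparr>"

abbreviation zero_trm :: "'f ofun trm" where
  "zero_trm \<equiv> App Zero_sym []"

abbreviation one_trm :: "'f ofun trm" where
  "one_trm \<equiv> App One_sym []"

abbreviation plus_trm :: "'f ofun trm \<Rightarrow> 'f ofun trm \<Rightarrow> 'f ofun trm" where
  "plus_trm s t \<equiv> App Plus_sym [s, t]"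

abbreviation minus_trm :: "'f ofun trm \<Rightarrow> 'f ofun trm" where
  "minus_trm t \<equiv> App Minus_sym [t]"

abbreviation times_trm :: "'f ofun trm \<Rightarrow> 'f ofun trm \<Rightarrow> 'f ofun trm" where
  "times_trm s t \<equiv> App Times_sym [s, t]"

abbreviation less_form :: "'f ofun trm \<Rightarrow> 'f ofun trm \<Rightarrow> ('f ofun, 'r orel) form" where
  "less_form s t \<equiv> Pred Less_sym [s, t]"

definition ordered_field_axioms :: "('f ofun, 'r orel) form set" where
  "ordered_field_axioms = (let x = Var 0; y = Var 1; z = Var 2 in {
     Forall (Forall (Forall (Equal (plus_trm (plus_trm x y) z) (plus_trm x (plus_trm y z))))),
     Forall (Forall (Equal (plus_trm x y) (plus_trm y x))),
     Forall (Equal (plus_trm x zero_trm) x),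
     Forall (Equal (plus_trm x (minus_trm x)) zero_trm),
     Forall (Forall (Forall (Equal (times_trm (times_trm x y) z) (times_trm x (times_trm y z))))),
     Forall (Forall (Equal (times_trm x y) (times_trm y x))),
     Forall (Equal (times_trm x one_trm) x),
     Forall (Forall (Forall (Equal (times_trm x (plus_trm y z))
                                   (plus_trm (times_trm x y) (times_trm x z))))),
     Neg (Equal zero_trm one_trm),
     Forall (Impl (Neg (Equal x zero_trm)) (Exists (Equal (times_trm y x) one_trm))),
     Forall (Neg (less_form x x)),
     Forall (Forall (Forall (Impl (Conj (less_form x y) (less_form y z)) (less_form x z)))),
     Forall (Forall (Disj (less_form x y) (Disj (Equal x y) (less_form y x)))),
     Forall (Forall (Forall (Impl (less_form x y) (less_form (plus_trm x z) (plus_trm y z))))),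
     Forall (Forall (Impl (Conj (less_form zero_trm x) (less_form zero_trm y))
                          (less_form zero_trm (times_trm x y))))})"

text \<open>The monic polynomial of degree \<open>n\<close> in the variable \<open>0\<close>, in Horner form, with the variables
  \<open>1, \<dots>, n\<close> as its coefficients below the leading one (the variable \<open>n\<close> is the constant
  coefficient).\<close>

primrec monic_trm :: "nat \<Rightarrow> 'f ofun trm" where
  "monic_trm 0 = one_trm"
| "monic_trm (Suc n) = plus_trm (times_trm (monic_trm n) (Var 0)) (Var (Suc n))"

definition RCF :: "('f ofun, 'r orel) form set" where
  "RCF = ordered_field_axioms
     \<union> {Forall (Impl (less_form zero_trm (Var 0))
                      (Exists (Equal (times_trm (Var 0) (Var 0)) (Var 1))))}
     \<union> {(Forall ^^ n) (Exists (Equal (monic_trm n) zero_trm)) | n. odd n}"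

abbreviation less_in :: "('f, 'r orel, 'a) fo_struct \<Rightarrow> 'a \<Rightarrow> 'a \<Rightarrow> bool" where
  "less_in M x y \<equiv> rel_int M Less_sym [x, y]"

text \<open>Endpoint \<^const>\<open>None\<close> stands for \<open>-\<infinity>\<close> on the left and for \<open>\<infinity>\<close> on the right.\<close>

definition open_interval :: "('f, 'r orel, 'a) fo_struct \<Rightarrow> 'a option \<Rightarrow> 'a option \<Rightarrow> 'a set" where
  "open_interval M l r =
     {x \<in> univ M. (\<forall>a\<in>set_option l. less_in M a x) \<and> (\<forall>b\<in>set_option r. less_in M x b)}"

definition point_or_interval :: "('f, 'r orel, 'a) fo_struct \<Rightarrow> 'a set \<Rightarrow> bool" where
  "point_or_interval M I \<longleftrightarrow> (\<exists>a\<in>univ M. I = {a}) \<or>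
     (\<exists>l r. set_option l \<subseteq> univ M \<and> set_option r \<subseteq> univ M \<and> I = open_interval M l r)"

definition o_minimal :: "('f, 'r orel) language \<Rightarrow> ('f, 'r orel, 'a) fo_struct \<Rightarrow> bool" where
  "o_minimal L M \<longleftrightarrow>
     irreflp_on (univ M) (less_in M) \<and> transp_on (univ M) (less_in M) \<and>
     totalp_on (univ M) (less_in M) \<and>
     (\<forall>S. definable_with_parameters L M S \<longrightarrow>
        (\<exists>F. finite F \<and> (\<forall>I\<in>F. point_or_interval M I) \<and> S = \<Union>F))"

definition o_minimal_theory ::
  "'u itself \<Rightarrow> ('f, 'r orel) language \<Rightarrow> ('f, 'r orel) form set \<Rightarrow> bool" where
  "o_minimal_theory U L T \<longleftrightarrow>
     (\<forall>M :: ('f, 'r orel, 'u) fo_struct. is_model L T M \<longrightarrow> o_minimal L M)"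

section \<open>Derivations and RCF-derivations\<close>

definition ring_of :: "('f ofun, 'r, 'a) fo_struct \<Rightarrow> 'a ring" where
  "ring_of M = \<lparr>carrier = univ M, mult = (\<lambda>x y. fun_int M Times_sym [x, y]),
     one = fun_int M One_sym [], zero = fun_int M Zero_sym [],
     add = (\<lambda>x y. fun_int M Plus_sym [x, y])\<rparr>"

definition derivation :: "('f ofun, 'r, 'a) fo_struct \<Rightarrow> ('a \<Rightarrow> 'a) \<Rightarrow> bool" where
  "derivation M \<delta> \<longleftrightarrow> (let R = ring_of M in
     \<delta> \<in> univ M \<rightarrow> univ M \<and>
     (\<forall>x\<in>univ M. \<forall>y\<in>univ M.
        \<delta> (x \<oplus>\<^bsub>R\<^esub> y) = \<delta> x \<oplus>\<^bsub>R\<^esub> \<delta> y \<and>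
        \<delta> (x \<otimes>\<^bsub>R\<^esub> y) = (x \<otimes>\<^bsub>R\<^esub> \<delta> y) \<oplus>\<^bsub>R\<^esub> (y \<otimes>\<^bsub>R\<^esub> \<delta> x)))"

definition positives :: "('f ofun, 'r orel, 'a) fo_struct \<Rightarrow> 'a set" where
  "positives M = {x \<in> univ M. less_in M \<zero>\<^bsub>ring_of M\<^esub> x}"

definition abs_in :: "('f ofun, 'r orel, 'a) fo_struct \<Rightarrow> 'a \<Rightarrow> 'a" where
  "abs_in M x = (if less_in M x \<zero>\<^bsub>ring_of M\<^esub> then \<ominus>\<^bsub>ring_of M\<^esub> x else x)"

definition near :: "('f ofun, 'r orel, 'a) fo_struct \<Rightarrow> 'a \<Rightarrow> 'a list \<Rightarrow> 'a list \<Rightarrow> bool" where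
  "near M \<epsilon> u v \<longleftrightarrow> (\<forall>i<length u. less_in M (abs_in M (v ! i \<ominus>\<^bsub>ring_of M\<^esub> u ! i)) \<epsilon>)"

text \<open>The topology on \<open>n\<close>-tuples is the product of the order topologies; the cubes
  \<open>{v \<in> tuples M n. near M \<epsilon> u v}\<close> form a neighbourhood base at \<open>u\<close>.\<close>

definition open_tuples :: "('f ofun, 'r orel, 'a) fo_struct \<Rightarrow> nat \<Rightarrow> 'a list set \<Rightarrow> bool" where
  "open_tuples M n U \<longleftrightarrow> U \<subseteq> tuples M n \<and>
     (\<forall>u\<in>U. \<exists>\<epsilon>\<in>positives M. \<forall>v\<in>tuples M n. near M \<epsilon> u v \<longrightarrow> v \<in> U)"

definition continuous_on_tuples ::
  "('f ofun, 'r orel, 'a) fo_struct \<Rightarrow> 'a list set \<Rightarrow> ('a list \<Rightarrow> 'a) \<Rightarrow> bool" where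
  "continuous_on_tuples M U g \<longleftrightarrow>
     (\<forall>u\<in>U. \<forall>\<epsilon>\<in>positives M. \<exists>\<eta>\<in>positives M. \<forall>v\<in>U. near M \<eta> u v \<longrightarrow>
        less_in M (abs_in M (g v \<ominus>\<^bsub>ring_of M\<^esub> g u)) \<epsilon>)"

text \<open>\<open>d\<close> is the \<open>i\<close>-th partial derivative of \<open>f : U \<rightarrow> M\<close> at \<open>u\<close>; the usual condition on the
  difference quotient \<open>(f(u + h e\<^sub>i) - f(u)) / h\<close> is multiplied out by \<open>\<bar>h\<bar>\<close>.\<close>

definition has_partial_deriv ::
  "('f ofun, 'r orel, 'a) fo_struct \<Rightarrow> 'a list set \<Rightarrow> ('a list \<Rightarrow> 'a) \<Rightarrow> nat \<Rightarrow> 'a list \<Rightarrow> 'a \<Rightarrow> bool" where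
  "has_partial_deriv M U f i u d \<longleftrightarrow> (let R = ring_of M in
     \<forall>\<epsilon>\<in>positives M. \<exists>\<eta>\<in>positives M. \<forall>h\<in>univ M.
       h \<noteq> \<zero>\<^bsub>R\<^esub> \<longrightarrow> less_in M (abs_in M h) \<eta> \<longrightarrow> u[i := u ! i \<oplus>\<^bsub>R\<^esub> h] \<in> U \<longrightarrow>
       less_in M (abs_in M ((f (u[i := u ! i \<oplus>\<^bsub>R\<^esub> h]) \<ominus>\<^bsub>R\<^esub> f u) \<ominus>\<^bsub>R\<^esub> (d \<otimes>\<^bsub>R\<^esub> h)))
                 (\<epsilon> \<otimes>\<^bsub>R\<^esub> abs_in M h))"

definition partial_deriv ::
  "('f ofun, 'r orel, 'a) fo_struct \<Rightarrow> 'a list set \<Rightarrow> ('a list \<Rightarrow> 'a) \<Rightarrow> nat \<Rightarrow> 'a list \<Rightarrow> 'a" where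
  "partial_deriv M U f i u = (THE d. d \<in> univ M \<and> has_partial_deriv M U f i u d)"

definition C1_on ::
  "('f ofun, 'r orel, 'a) fo_struct \<Rightarrow> nat \<Rightarrow> 'a list set \<Rightarrow> ('a list \<Rightarrow> 'a) \<Rightarrow> bool" where
  "C1_on M n U f \<longleftrightarrow> (\<forall>i<n. (\<forall>u\<in>U. \<exists>d\<in>univ M. has_partial_deriv M U f i u d) \<and>
     continuous_on_tuples M U (partial_deriv M U f i))"

definition definable_fun ::
  "('f, 'r) language \<Rightarrow> ('f, 'r, 'a) fo_struct \<Rightarrow> nat \<Rightarrow> 'a list set \<Rightarrow> ('a list \<Rightarrow> 'a) \<Rightarrow> bool" where
  "definable_fun L M n U f \<longleftrightarrow> definable L M (Suc n) ((\<lambda>u. u @ [f u]) ` U)"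

text \<open>For scalar-valued \<open>f\<close> the Jacobian matrix is the row of partial derivatives, so that its
  product with \<open>\<delta> u\<close> is the sum below.  Formulas of \<^const>\<open>oring_language\<close> only refer to
  the ordered field underlying \<open>M\<close>.\<close>

definition RCF_derivation :: "('f ofun, 'r orel, 'a) fo_struct \<Rightarrow> ('a \<Rightarrow> 'a) \<Rightarrow> bool" where
  "RCF_derivation M \<delta> \<longleftrightarrow> (let R = ring_of M in
     \<delta> \<in> univ M \<rightarrow> univ M \<and>
     (\<forall>n U f. open_tuples M n U \<longrightarrow> f \<in> U \<rightarrow> univ M \<longrightarrow>
        definable_fun oring_language M n U f \<longrightarrow> C1_on M n U f \<longrightarrow>
        (\<forall>u\<in>U. \<delta> (f u) = (\<Oplus>\<^bsub>R\<^esub>i\<in>{..<n}. partial_deriv M U f i u \<otimes>\<^bsub>R\<^esub> \<delta> (u ! i)))))"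

end

theory Submission
  imports Defs Complex_Main "HOL-Computational_Algebra.Polynomial"
begin

text \<open>By o-minimality, \<open>M\<close> is an ordered field whose polynomials have the intermediate value property.
  Hence it admits quantifier elimination (Cohen--Hoermander): the truth of a formula of the language
  of ordered rings at a point is determined by the signs of finitely many integer polynomials there.

  Let \<open>f\<close> be \<open>C\<^sup>1\<close> and definable without parameters.  Adjoining one coordinate after the
  other, one finds a curve \<open>\<Gamma>(t) = w + t \<delta>w + o(t)\<close> through \<open>w = (u, f u)\<close> on which every
  integer polynomial that vanishes at \<open>w\<close> vanishes for all small \<open>t > 0\<close>: a transcendental
  coordinate \<open>b\<close> is continued as \<open>b + t \<delta>b\<close>, an algebraic one by the root nearest to
  \<open>b + t \<delta>b\<close> of its minimal polynomial.  The signs of finitely many polynomials are constant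
  along \<open>\<Gamma>\<close> for small \<open>t\<close>, so \<open>\<Gamma>\<close> stays on the graph of \<open>f\<close>, that is,
  \<open>f(u + t \<delta>u + o(t)) = f u + t \<delta>(f u) + o(t)\<close>.  Since \<open>f\<close> is totally differentiable at
  \<open>u\<close>, the left-hand side is also \<open>f u + t J\<^sub>f(u) \<delta>u + o(t)\<close>.\<close>

section \<open>Polynomials over real closed fields\<close>

text \<open>The field may be non-archimedean and incomplete, so neither compactness nor attained
  maxima are at hand. Finiteness replaces them: a nonzero polynomial has finitely many roots, and a
  semialgebraic condition in one variable changes finitely often. Tangency alone does not keep a
  curve on the graph of \<open>f\<close>: a polynomial vanishing at \<open>w\<close> would only be
  o(t) along the curve and could take any sign there. Hence relations have to persist exactly, and
  an algebraic coordinate has to follow a root. Its slope is then forced: applying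
  \<open>\<delta>\<close> to a relation of least degree gives a linear equation for the slope,
  solved only by \<open>\<delta> b\<close> because \<open>b\<close> is a simple root. Quantifier
  elimination serves twice, which is why a set \<open>K\<close> of coefficients is carried along:
  with \<open>K = {}\<close> for the graph, since \<open>\<delta>\<close> need not vanish on
  parameters, and with \<open>K = UNIV\<close> for the mean value inequality behind total
  differentiability. No quantifier-free formula is ever written down; both uses only need that
  finitely many signs decide the truth value.\<close>

text \<open>The conclusion of the axiom weakens "\<open>s\<close> is the supremum of \<open>{x. x < b \<and> p x < 0}\<close>" so that
  it follows from o-minimality without using that the order is dense; \<open>foldr\<close> is Horner's scheme.\<close>

class real_closed = linordered_field +
  assumes poly_cut: "foldr (\<lambda>c y. c + x0 * y) cs 0 < 0 \<Longrightarrow> x0 < b \<Longrightarrow>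
    \<exists>s. (\<forall>x<b. foldr (\<lambda>c y. c + x * y) cs 0 < 0 \<longrightarrow> x \<le> s) \<and>
        (\<forall>y z. y < z \<longrightarrow> z < s \<longrightarrow> (\<exists>x<b. foldr (\<lambda>c y. c + x * y) cs 0 < 0 \<and> y < x))"

lemma poly_Poly_foldr:
  fixes x :: "'a::comm_ring_1"
  shows "poly (Poly cs) x = foldr (\<lambda>c y. c + x * y) cs 0"
  by (induction cs) auto

section \<open>Continuity, intermediate values and the mean value theorem for polynomials\<close>

lemma poly_bounded_near:
  fixes q :: "'a::linordered_field poly"
  shows "\<exists>K>0. \<forall>y. \<bar>y - s\<bar> \<le> 1 \<longrightarrow> \<bar>poly q y\<bar> \<le> K"
proof (induction q)
  case 0
  then show ?case by (auto intro: exI[of _ 1])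
next
  case (pCons a q)
  then obtain K where K: "K > 0" "\<And>y. \<bar>y - s\<bar> \<le> 1 \<Longrightarrow> \<bar>poly q y\<bar> \<le> K" by auto
  have "\<bar>poly (pCons a q) y\<bar> \<le> \<bar>a\<bar> + (\<bar>s\<bar> + 1) * K" if y: "\<bar>y - s\<bar> \<le> 1" for y
  proof -
    have "\<bar>y\<bar> \<le> \<bar>s\<bar> + 1" using y by linarith
    then have "\<bar>y\<bar> * \<bar>poly q y\<bar> \<le> (\<bar>s\<bar> + 1) * K" using K(2)[OF y] by (intro mult_mono) auto
    then show ?thesis using abs_triangle_ineq[of a "y * poly q y"] by (auto simp: abs_mult)
  qed
  moreover have "\<bar>a\<bar> + (\<bar>s\<bar> + 1) * K > 0" using K(1) by (simp add: add_nonneg_pos)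
  ultimately show ?case by blast
qed

text \<open>\<open>p - p(s)\<close> is divisible by \<open>X - s\<close>, and the cofactor is
  bounded near \<open>s\<close>. So \<open>p\<close> is Lipschitz at \<open>s\<close>, which is
  proved without any topology on \<open>'a\<close>.\<close>

lemma poly_continuous:
  fixes p :: "'a::linordered_field poly"
  assumes "\<epsilon> > 0"
  shows "\<exists>\<eta>>0. \<forall>y. \<bar>y - s\<bar> < \<eta> \<longrightarrow> \<bar>poly p y - poly p s\<bar> < \<epsilon>"
proof -
  have "poly (p - [:poly p s:]) s = 0" by simp
  then obtain q where q: "p - [:poly p s:] = [:-s, 1:] * q" unfolding poly_eq_0_iff_dvd by auto
  have eq: "poly p y - poly p s = (y - s) * poly q y" for y
    using arg_cong[OF q, of "\<lambda>r. poly r y"] by (simp add: algebra_simps)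
  obtain K where K: "K > 0" "\<And>y. \<bar>y - s\<bar> \<le> 1 \<Longrightarrow> \<bar>poly q y\<bar> \<le> K"
    using poly_bounded_near[of s q] by auto
  have "\<bar>poly p y - poly p s\<bar> < \<epsilon>" if y: "\<bar>y - s\<bar> < min 1 (\<epsilon> / K)" for y
  proof -
    have "\<bar>poly p y - poly p s\<bar> \<le> \<bar>y - s\<bar> * K"
      unfolding eq abs_mult using y K(2)[of y] by (intro mult_left_mono) auto
    also have "\<dots> < \<epsilon>" using y K(1) by (simp add: field_simps)
    finally show ?thesis .
  qed
  then show ?thesis using assms K(1) by (intro exI[of _ "min 1 (\<epsilon> / K)"]) auto
qed

lemma poly_sgn_near:
  fixes p :: "'a::linordered_field poly"
  assumes "poly p s \<noteq> 0"
  shows "\<exists>\<eta>>0. \<forall>y. \<bar>y - s\<bar> < \<eta> \<longrightarrow> sgn (poly p y) = sgn (poly p s)"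
proof -
  obtain \<eta> where \<eta>: "\<eta> > 0" "\<And>y. \<bar>y - s\<bar> < \<eta> \<Longrightarrow> \<bar>poly p y - poly p s\<bar> < \<bar>poly p s\<bar>"
    using poly_continuous[of "\<bar>poly p s\<bar>" s p] assms by auto
  have "sgn (poly p y) = sgn (poly p s)" if "\<bar>y - s\<bar> < \<eta>" for y
    using \<eta>(2)[OF that] by (auto simp: sgn_if abs_if split: if_splits)
  then show ?thesis using \<eta>(1) by blast
qed

text \<open>Bolzano's argument at the cut \<open>s\<close> of
  \<open>{x. x < b \<and> p x < 0}\<close>. A nonzero sign persists near \<open>s\<close>;
  \<open>p s > 0\<close> contradicts that negative values occur arbitrarily close below,
  \<open>p s < 0\<close> that \<open>s\<close> bounds the set from above.\<close>

lemma poly_ivt_neg_pos: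
  fixes p :: "'a::real_closed poly"
  assumes "a < b" "poly p a < 0" "poly p b > 0"
  shows "\<exists>x. a < x \<and> x < b \<and> poly p x = 0"
proof -
  have P: "poly p x = foldr (\<lambda>c y. c + x * y) (coeffs p) 0" for x
    using poly_Poly_foldr[of "coeffs p" x] by simp
  obtain s where s: "\<And>x. x < b \<Longrightarrow> poly p x < 0 \<Longrightarrow> x \<le> s"
      "\<And>y z. y < z \<Longrightarrow> z < s \<Longrightarrow> \<exists>x<b. poly p x < 0 \<and> y < x"
    using poly_cut[of a "coeffs p" b] assms unfolding P by blast
  have "a \<le> s" using s(1) assms by auto
  have "s \<le> b"
  proof (rule ccontr)
    assume "\<not> s \<le> b"
    then obtain z where "b < z" "z < s" using dense by (metis not_le)
    then show False using s(2)[of b z] by auto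
  qed
  have "\<not> poly p s > 0"
  proof
    assume pos: "poly p s > 0"
    then obtain \<eta> where \<eta>: "\<eta> > 0" "\<And>y. \<bar>y - s\<bar> < \<eta> \<Longrightarrow> sgn (poly p y) = sgn (poly p s)"
      using poly_sgn_near[of p s] by auto
    \<comment> \<open>\<open>s - \<eta> / 2\<close> is the intermediate point that the weakened
      supremum condition asks for.\<close>
    have "\<exists>x<b. poly p x < 0 \<and> s - \<eta> < x" using s(2)[of "s - \<eta>" "s - \<eta> / 2"] \<eta>(1) by auto
    then obtain x where x: "x < b" "poly p x < 0" "s - \<eta> < x" by auto
    then have "\<bar>x - s\<bar> < \<eta>" using s(1)[of x] by auto
    from \<eta>(2)[OF this] x pos show False by simp
  qed
  moreover have "\<not> poly p s < 0"
  proof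
    assume neg: "poly p s < 0"
    then obtain \<eta> where \<eta>: "\<eta> > 0" "\<And>y. \<bar>y - s\<bar> < \<eta> \<Longrightarrow> sgn (poly p y) = sgn (poly p s)"
      using poly_sgn_near[of p s] by auto
    have "s < b" using \<open>s \<le> b\<close> neg assms(3) by (cases "s = b") auto
    then obtain x where x: "s < x" "x < min b (s + \<eta>)" using \<eta>(1) dense[of s "min b (s + \<eta>)"] by auto
    then have "\<bar>x - s\<bar> < \<eta>" by auto
    then have "poly p x < 0" using \<eta>(2)[of x] neg by (simp add: sgn_if split: if_splits)
    then show False using s(1)[of x] x by auto
  qed
  ultimately have "poly p s = 0" by auto
  moreover from this have "s \<noteq> a" "s \<noteq> b" using assms by auto
  ultimately show ?thesis using \<open>a \<le> s\<close> \<open>s \<le> b\<close> by (intro exI[of _ s]) auto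
qed

lemma poly_ivt:
  fixes p :: "'a::real_closed poly"
  assumes "a < b" "poly p a * poly p b < 0"
  shows "\<exists>x. a < x \<and> x < b \<and> poly p x = 0"
proof (cases "poly p a < 0")
  case True
  then show ?thesis using poly_ivt_neg_pos[of a b p] assms by (auto simp: mult_less_0_iff)
next
  case False
  then show ?thesis using poly_ivt_neg_pos[of a b "- p"] assms by (auto simp: mult_less_0_iff)
qed

lemma poly_sgn_const:
  fixes p :: "'a::real_closed poly"
  assumes "\<And>x. min a b \<le> x \<Longrightarrow> x \<le> max a b \<Longrightarrow> poly p x \<noteq> 0"
  shows "sgn (poly p a) = sgn (poly p b)"
proof (rule ccontr)
  assume *: "sgn (poly p a) \<noteq> sgn (poly p b)"
  have "poly p a \<noteq> 0" "poly p b \<noteq> 0" using assms[of a] assms[of b] by auto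
  then have neg: "poly p a * poly p b < 0" using * by (auto simp: sgn_if mult_less_0_iff split: if_splits)
  consider "a < b" | "b < a" using * by fastforce
  then show False
  proof cases
    case 1
    then show ?thesis using poly_ivt[of a b p] neg assms by (auto simp: min_def max_def)
  next
    case 2
    then show ?thesis using poly_ivt[of b a p] neg assms by (auto simp: min_def max_def mult.commute)
  qed
qed

text \<open>Write \<open>p = (X - a)^m q\<close> with \<open>q a \<noteq> 0\<close>. Then
  \<open>p p' (X - a)\<close> is the square of \<open>(X - a)^m\<close> times a polynomial
  \<open>r\<close> with \<open>r a = m (q a)^2 > 0\<close>. So \<open>p p'\<close> is negative just
  left and positive just right of a root, whatever its multiplicity.\<close>

lemma poly_pderiv_near_root:
  fixes p :: "'a::linordered_field poly"
  assumes "poly p a = 0" "p \<noteq> 0"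
  shows "\<exists>\<eta>>0. \<forall>y. y \<noteq> a \<longrightarrow> \<bar>y - a\<bar> < \<eta> \<longrightarrow> poly p y * poly (pderiv p) y * (y - a) > 0"
proof -
  obtain q where q: "p = [:-a, 1:] ^ order a p * q" "\<not> [:-a, 1:] dvd q"
    using order_decomp[OF assms(2), of a] by auto
  define m where "m = order a p"
  have m: "m > 0" using assms by (simp add: m_def order_root)
  then obtain k where k: "m = Suc k" using gr0_implies_Suc by auto
  have qa: "poly q a \<noteq> 0" using q(2) by (simp add: poly_eq_0_iff_dvd)
  have p: "p = [:-a, 1:] ^ Suc k * q" using q(1) unfolding m_def[symmetric] k .
  define r where "r = q * (smult (of_nat m) q + [:-a, 1:] * pderiv q)"
  have dp: "poly (pderiv p) y = (of_nat m * poly q y + (y - a) * poly (pderiv q) y) * (y - a) ^ k" for y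
    unfolding p pderiv_mult pderiv_power_Suc k
    by (simp add: pderiv_pCons distrib_left distrib_right mult_ac del: mult_pCons_left power_Suc)
       (simp add: algebra_simps)
  have "poly p y = (y - a) ^ Suc k * poly q y" for y
    unfolding p poly_mult poly_power by simp
  then have eq: "poly p y * poly (pderiv p) y * (y - a) = ((y - a) ^ m)\<^sup>2 * poly r y" for y
    unfolding dp by (simp add: r_def k power2_eq_square left_diff_distrib[of y a "poly (pderiv q) y"])
  have ra: "poly r a = of_nat m * (poly q a)\<^sup>2" by (simp add: r_def power2_eq_square)
  then have "poly r a > 0" using qa m by simp
  then obtain \<eta> where \<eta>: "\<eta> > 0" "\<And>y. \<bar>y - a\<bar> < \<eta> \<Longrightarrow> sgn (poly r y) = sgn (poly r a)"
    using poly_sgn_near[of r a] by auto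
  have "poly r y > 0" if "\<bar>y - a\<bar> < \<eta>" for y
    using \<eta>(2)[OF that] \<open>poly r a > 0\<close> by (simp add: sgn_if split: if_splits)
  then show ?thesis unfolding eq using \<eta>(1) by (intro exI[of _ \<eta>]) (auto intro!: mult_pos_pos)
qed

text \<open>An algebraic proof without extreme values: \<open>p p'\<close> is positive just after
  \<open>a\<close> and negative just before \<open>b\<close>, while \<open>p\<close> keeps its sign
  in between. So \<open>p'\<close> changes sign, and the intermediate value property applies to
  it.\<close>

lemma poly_rolle_consecutive:
  fixes p :: "'a::real_closed poly"
  assumes "a < b" "poly p a = 0" "poly p b = 0" "\<And>x. a < x \<Longrightarrow> x < b \<Longrightarrow> poly p x \<noteq> 0"
  shows "\<exists>x. a < x \<and> x < b \<and> poly (pderiv p) x = 0"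
proof -
  obtain c where c: "a < c" "c < b" using dense[OF assms(1)] by auto
  then have "p \<noteq> 0" using assms(4) by auto
  obtain \<eta> where \<eta>: "\<eta> > 0" "\<And>y. y \<noteq> a \<Longrightarrow> \<bar>y - a\<bar> < \<eta> \<Longrightarrow> poly p y * poly (pderiv p) y * (y - a) > 0"
    using poly_pderiv_near_root[OF assms(2) \<open>p \<noteq> 0\<close>] by blast
  obtain \<theta> where \<theta>: "\<theta> > 0" "\<And>y. y \<noteq> b \<Longrightarrow> \<bar>y - b\<bar> < \<theta> \<Longrightarrow> poly p y * poly (pderiv p) y * (y - b) > 0"
    using poly_pderiv_near_root[OF assms(3) \<open>p \<noteq> 0\<close>] by blast
  obtain y where y: "a < y" "y < min c (a + \<eta>)" using dense[of a "min c (a + \<eta>)"] c \<eta>(1) by auto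
  obtain z where z: "max c (b - \<theta>) < z" "z < b" using dense[of "max c (b - \<theta>)" b] c \<theta>(1) by auto
  have yy: "poly p y * poly (pderiv p) y > 0"
    using \<eta>(2)[of y] y by (auto simp: zero_less_mult_iff)
  have zz: "poly p z * poly (pderiv p) z < 0"
    using \<theta>(2)[of z] z by (auto simp: zero_less_mult_iff mult_less_0_iff)
  have "sgn (poly p y) = sgn (poly p z)"
    by (rule poly_sgn_const) (use y z c assms(4) in \<open>auto simp: min_def max_def split: if_splits\<close>)
  with yy zz have "poly (pderiv p) y * poly (pderiv p) z < 0"
    by (auto simp: zero_less_mult_iff mult_less_0_iff sgn_if split: if_splits)
  then show ?thesis using poly_ivt[of y z "pderiv p"] y z by (metis less_trans max_less_iff_conj min_less_iff_conj)
qed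

lemma poly_rolle:
  fixes p :: "'a::real_closed poly"
  assumes "a < b" "poly p a = 0" "poly p b = 0"
  shows "\<exists>x. a < x \<and> x < b \<and> poly (pderiv p) x = 0"
proof (cases "p = 0")
  case True
  then show ?thesis using dense[OF assms(1)] by auto
next
  case False
  \<comment> \<open>The root set is finite, so there is a first root after \<open>a\<close>; this
    reduces the claim to consecutive roots.\<close>
  define B where "B = {x. poly p x = 0 \<and> a < x}"
  have B: "finite B" "b \<in> B" using poly_roots_finite[OF False] assms by (auto simp: B_def)
  then have M: "Min B \<in> B" "Min B \<le> b" by (auto intro: Min_in)
  have "poly p x \<noteq> 0" if "a < x" "x < Min B" for x
    using that Min_le[OF B(1), of x] by (fastforce simp: B_def)
  then show ?thesis using poly_rolle_consecutive[of a "Min B" p] M assms by (fastforce simp: B_def)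
qed

lemma poly_mean_value:
  fixes p :: "'a::real_closed poly"
  assumes "a < b"
  shows "\<exists>x. a < x \<and> x < b \<and> poly p b - poly p a = poly (pderiv p) x * (b - a)"
proof -
  define c where "c = (poly p b - poly p a) / (b - a)"
  define q where "q = p - [:poly p a - c * a, c:]"
  have c: "c * (b - a) = poly p b - poly p a" using assms by (simp add: c_def)
  have "poly q a = 0" by (simp add: q_def algebra_simps)
  moreover have "poly q b = 0" using c by (simp add: q_def algebra_simps)
  ultimately obtain x where "a < x" "x < b" "poly (pderiv q) x = 0"
    using poly_rolle[OF assms] by blast
  moreover from this have "poly (pderiv p) x = c" by (simp add: q_def pderiv_diff pderiv_pCons)
  ultimately show ?thesis using c by auto
qed

text \<open>A positive lower bound instead of mere positivity makes the induction along Horner's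
  scheme work: \<open>y * \<kappa>\<close> eventually outgrows the constant coefficient.\<close>

lemma poly_eventually_ge:
  fixes p :: "'a::linordered_field poly"
  assumes "lead_coeff p > 0"
  shows "\<exists>\<kappa>>0. \<exists>B. \<forall>y\<ge>B. poly p y \<ge> \<kappa>"
  using assms
proof (induction p)
  case 0
  then show ?case by simp
next
  case (pCons a q)
  show ?case
  proof (cases "q = 0")
    case True
    then show ?thesis using pCons.prems by (auto intro!: exI[of _ a])
  next
    case False
    then obtain \<kappa> B where \<kappa>: "\<kappa> > 0" "\<And>y. y \<ge> B \<Longrightarrow> poly q y \<ge> \<kappa>" using pCons by auto
    have "poly (pCons a q) y \<ge> \<kappa>" if y: "y \<ge> max (max B 0) ((\<kappa> - a) / \<kappa>)" for y
    proof -
      have "\<kappa> - a \<le> y * \<kappa>" using y \<kappa>(1) by (simp add: pos_divide_le_eq)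
      also have "\<dots> \<le> y * poly q y" using y \<kappa>(2) by (intro mult_left_mono) auto
      finally show ?thesis by simp
    qed
    then show ?thesis using \<kappa>(1) by blast
  qed
qed

lemma poly_sgn_at_top:
  fixes p :: "'a::linordered_field poly"
  shows "\<exists>B. \<forall>y\<ge>B. sgn (poly p y) = sgn (lead_coeff p)"
proof -
  consider "lead_coeff p > 0" | "lead_coeff (- p) > 0" | "p = 0"
    by (metis lead_coeff_minus leading_coeff_0_iff neg_0_less_iff_less neqE)
  then show ?thesis
  proof cases
    case 1
    with poly_eventually_ge[OF 1] show ?thesis by (metis dual_order.strict_trans1 sgn_1_pos)
  next
    case 2
    from poly_eventually_ge[OF this] obtain \<kappa> B where "\<kappa> > 0" "\<forall>y\<ge>B. poly (-p) y \<ge> \<kappa>" by auto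
    then have "\<forall>y\<ge>B. sgn (poly p y) = -1" by (fastforce simp: sgn_if)
    moreover have "sgn (lead_coeff p) = -1" using 2 by simp
    ultimately show ?thesis by auto
  qed auto
qed

lemma poly_sgn_at_bot:
  fixes p :: "'a::linordered_field poly"
  shows "\<exists>B. \<forall>y\<le>B. sgn (poly p y) = (- 1) ^ degree p * sgn (lead_coeff p)"
proof -
  obtain B where B: "\<And>y. y \<ge> B \<Longrightarrow> sgn (poly (pcompose p [:0, -1:]) y) = sgn (lead_coeff (pcompose p [:0, -1:]))"
    using poly_sgn_at_top by blast
  have "lead_coeff (pcompose p [:0, -1:]) = lead_coeff p * (- 1) ^ degree p"
    by (subst lead_coeff_comp) auto
  then have "sgn (poly p y) = (- 1) ^ degree p * sgn (lead_coeff p)" if "y \<le> - B" for y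
    using B[of "- y"] that by (simp add: poly_pcompose sgn_mult mult.commute)
  then show ?thesis by blast
qed

section \<open>Sign patterns of univariate polynomials\<close>

text \<open>Stands in for the sign tables of the Cohen-Hoermander method: two sign patterns on the
  line count as equal if an order automorphism carries one to the other, so roots need not be listed
  or numbered.\<close>

definition order_aut :: "('a::linorder \<Rightarrow> 'a) \<Rightarrow> bool" where
  "order_aut h \<longleftrightarrow> strict_mono h \<and> surj h"

lemma order_aut_less: "order_aut h \<Longrightarrow> h x < h y \<longleftrightarrow> x < y"
  by (simp add: order_aut_def strict_mono_less)

lemma order_aut_le: "order_aut h \<Longrightarrow> h x \<le> h y \<longleftrightarrow> x \<le> y"
  by (simp add: order_aut_def strict_mono_less_eq)

lemma order_aut_surj: "order_aut h \<Longrightarrow> \<exists>x. h x = y"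
  unfolding order_aut_def surj_def by metis

lemma order_aut_id: "order_aut (\<lambda>x. x)"
  by (auto simp: order_aut_def strict_mono_def)

lemma order_aut_comp: "order_aut h \<Longrightarrow> order_aut k \<Longrightarrow> order_aut (\<lambda>x. h (k x))"
  using comp_surj[of k h] by (auto simp: order_aut_def strict_mono_def o_def)

text \<open>Used to move one root inside a gap while everything outside the gap stays in
  place.\<close>

lemma order_aut_move:
  fixes a b c c' :: "'a::linordered_field"
  assumes "a < c" "c < b" "a < c'" "c' < b"
  shows "\<exists>k. order_aut k \<and> k c = c' \<and> (\<forall>y. y \<le> a \<or> b \<le> y \<longrightarrow> k y = y)"
proof -
  \<comment> \<open>The piecewise linear map through \<open>(a, a)\<close>, \<open>(c, c')\<close>
    and \<open>(b, b)\<close>, extended by the identity. The points \<open>c\<close> and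
    \<open>c'\<close> are arguments because exchanging them yields the inverse, hence
    surjectivity.\<close>
  define K where "K = (\<lambda>c c' y. if y \<le> a then y else if y \<le> c then a + (y - a) * ((c' - a) / (c - a))
    else if y \<le> b then c' + (y - c) * ((b - c') / (b - c)) else y)"
  have scale: "t * (e' / e) \<le> e' \<longleftrightarrow> t \<le> e" "0 < t * (e' / e) \<longleftrightarrow> 0 < t"
    if "0 < e" "0 < e'" for t e e' :: 'a
  proof -
    have "t * (e' / e) \<le> e * (e' / e) \<longleftrightarrow> t \<le> e" using that by (intro mult_le_cancel_right_pos) simp
    then show "t * (e' / e) \<le> e' \<longleftrightarrow> t \<le> e" using that by simp
    show "0 < t * (e' / e) \<longleftrightarrow> 0 < t" using that by (simp add: zero_less_mult_iff zero_less_divide_iff)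
  qed
  have lower: "a + (y - a) * ((d' - a) / (d - a)) \<le> d' \<longleftrightarrow> y \<le> d"
      "a + (y - a) * ((d' - a) / (d - a)) \<le> a \<longleftrightarrow> y \<le> a" if "a < d" "a < d'" for d d' y
    using scale[of "d - a" "d' - a" "y - a"] that by auto
  have upper: "d' + (y - d) * ((b - d') / (b - d)) \<le> b \<longleftrightarrow> y \<le> b"
      "d' + (y - d) * ((b - d') / (b - d)) \<le> d' \<longleftrightarrow> y \<le> d" if "d < b" "d' < b" for d d' y
    using scale[of "b - d" "b - d'" "y - d"] that by auto
  have inv: "K d d' (K d' d y) = y" if "a < d" "d < b" "a < d'" "d' < b" for d d' y
  proof -
    consider "y \<le> a" | "a < y" "y \<le> d'" | "d' < y" "y \<le> b" | "b < y" by (meson not_le)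
    then show ?thesis
    proof cases
      case 2
      then have "K d' d y = a + (y - a) * ((d - a) / (d' - a))" by (simp add: K_def)
      moreover have "\<not> K d' d y \<le> a" "K d' d y \<le> d" unfolding \<open>K d' d y = _\<close> using lower[of d' d y] 2 that by auto
      ultimately show ?thesis using that by (simp add: K_def)
    next
      case 3
      then have "K d' d y = d + (y - d') * ((b - d) / (b - d'))" using that by (simp add: K_def)
      moreover have "\<not> K d' d y \<le> d" "K d' d y \<le> b" unfolding \<open>K d' d y = _\<close> using upper[of d' b] upper[of d' d y] 3 that by auto
      ultimately show ?thesis using that by (simp add: K_def)
    qed (use that in \<open>auto simp: K_def\<close>)
  qed
  have "strict_mono (K c c')"
  proof (rule strict_monoI)
    fix y z :: 'a
    assume yz: "y < z"
    have 1: "(y - a) * ((c' - a) / (c - a)) < (z - a) * ((c' - a) / (c - a))"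
      using assms yz by (intro mult_strict_right_mono) auto
    have 2: "(y - c) * ((b - c') / (b - c)) < (z - c) * ((b - c') / (b - c))"
      using assms yz by (intro mult_strict_right_mono) auto
    have region: "x \<le> a \<or> a < x \<and> x \<le> c \<or> c < x \<and> x \<le> b \<or> b < x" for x by linarith
    show "K c c' y < K c c' z"
      using region[of y] region[of z] assms yz
    proof (elim disjE, goal_cases)
    qed (use 1 2 lower[of c c' y] lower[of c c' z] upper[of c c' y] upper[of c c' z] in \<open>simp_all add: K_def\<close>)
  qed
  moreover have "surj (K c c')" using inv[of c c'] assms by (metis surj_def)
  moreover have "K c c' c = c'" using assms by (simp add: K_def)
  moreover have "K c c' y = y" if "y \<le> a \<or> b \<le> y" for y
    using that assms by (auto simp: K_def)
  ultimately show ?thesis by (auto simp: order_aut_def)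
qed

lemma finite_set_gap:
  fixes y :: "'a::linorder"
  assumes "finite Y" "c \<in> Y" "c < y" "b \<in> Y" "y < b" "y \<notin> Y"
  shows "\<exists>l\<in>Y. \<exists>r\<in>Y. l < y \<and> y < r \<and> (\<forall>x. l < x \<longrightarrow> x < r \<longrightarrow> x \<notin> Y)"
proof -
  define A where "A = {x \<in> Y. x < y}"
  define B where "B = {x \<in> Y. y < x}"
  have A: "finite A" "A \<noteq> {}" and B: "finite B" "B \<noteq> {}" using assms by (auto simp: A_def B_def)
  have "Max A \<in> A" "Min B \<in> B" using A B by (auto intro: Max_in Min_in)
  moreover have "x \<notin> Y" if "Max A < x" "x < Min B" for x
  proof
    assume "x \<in> Y"
    then have "x \<in> A \<or> x \<in> B" using assms(6) by (cases x y rule: linorder_cases) (simp_all add: A_def B_def)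
    then show False using that Max_ge[OF A(1), of x] Min_le[OF B(1), of x] by (meson not_le)
  qed
  moreover have "m \<in> Y \<and> m < y" if "m \<in> A" for m using that by (simp add: A_def)
  moreover have "m \<in> Y \<and> y < m" if "m \<in> B" for m using that by (simp add: B_def)
  ultimately show ?thesis by meson
qed

text \<open>The mean value theorem evaluates the derivative only at interior points, so
  \<open>u\<close> and \<open>v\<close> may be endpoints of the interval on which its sign is
  known.\<close>

lemma poly_increasing_where_pderiv:
  fixes p :: "'a::real_closed poly"
  assumes "\<And>x. l < x \<Longrightarrow> x < r \<Longrightarrow> sgn (poly (pderiv p) x) = d" "l \<le> u" "u < v" "v \<le> r"
  shows "sgn (poly p v - poly p u) = d"
proof -
  obtain x where "u < x" "x < v" "poly p v - poly p u = poly (pderiv p) x * (v - u)"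
    using poly_mean_value[OF assms(3)] by blast
  then show ?thesis using assms by (simp add: sgn_mult)
qed

text \<open>Between consecutive points of \<open>X\<close> both \<open>p\<close> and
  \<open>q \<circ> h\<close> are strictly monotone in the same direction and have equal signs at the
  ends. So each has at most one root there, and one has a root exactly if the other has;
  \<open>k\<close> only has to carry the roots of \<open>p\<close> to those of
  \<open>q \<circ> h\<close>.\<close>

lemma sign_matching:
  fixes p q :: "'a::real_closed poly"
  assumes h: "order_aut h" and X: "finite X"
    and der: "\<And>y. sgn (poly (pderiv p) y) = sgn (poly (pderiv q) (h y))"
    and crit: "\<And>y. poly (pderiv p) y = 0 \<Longrightarrow> y \<in> X"
    and agree: "\<And>x. x \<in> X \<Longrightarrow> sgn (poly p x) = sgn (poly q (h x))"
    and deg: "degree p = degree q" and lc: "sgn (lead_coeff p) = sgn (lead_coeff q)" "p \<noteq> 0"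
  shows "\<exists>k. order_aut k \<and> (\<forall>x\<in>X. k x = x) \<and> (\<forall>y. sgn (poly p y) = sgn (poly q (h (k y))))"
proof -
  define \<phi> where "\<phi> = poly p"
  define \<psi> where "\<psi> = (\<lambda>y. poly q (h y))"
  obtain B1 where B1: "\<And>y. y \<ge> B1 \<Longrightarrow> sgn (poly p y) = sgn (lead_coeff p)"
    using poly_sgn_at_top[of p] by auto
  obtain B2' where B2': "\<And>y. y \<ge> B2' \<Longrightarrow> sgn (poly q y) = sgn (lead_coeff q)"
    using poly_sgn_at_top[of q] by auto
  obtain B2 where B2: "h B2 = B2'" using order_aut_surj[OF h] by blast
  obtain C1 where C1: "\<And>y. y \<le> C1 \<Longrightarrow> sgn (poly p y) = (- 1) ^ degree p * sgn (lead_coeff p)"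
    using poly_sgn_at_bot[of p] by auto
  obtain C2' where C2': "\<And>y. y \<le> C2' \<Longrightarrow> sgn (poly q y) = (- 1) ^ degree q * sgn (lead_coeff q)"
    using poly_sgn_at_bot[of q] by auto
  obtain C2 where C2: "h C2 = C2'" using order_aut_surj[OF h] by blast
  \<comment> \<open>From \<open>B\<close> upwards and from \<open>C\<close> downwards both functions
    have the nonzero sign dictated by degree and leading coefficient. Adding these two points to
    \<open>X\<close> leaves no unbounded interval with roots: every root of \<open>\<phi>\<close>
    outside \<open>Y\<close> lies between two points of \<open>Y\<close>.\<close>
  define B where "B = max B1 B2"
  define C where "C = min B (min C1 C2)"
  define sB where "sB = sgn (lead_coeff p)"
  define sC where "sC = (- 1) ^ degree p * sgn (lead_coeff p)"
  have BC: "C \<le> B" "B1 \<le> B" "B2 \<le> B" "C \<le> C1" "C \<le> C2"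
    by (simp_all add: B_def C_def min_le_iff_disj)
  have top: "sgn (\<phi> y) = sB" "sgn (\<psi> y) = sB" if "y \<ge> B" for y
    using that B1[of y] B2'[of "h y"] order_aut_le[OF h, of B2 y] BC lc
    by (auto simp: \<phi>_def \<psi>_def sB_def B2)
  have bot: "sgn (\<phi> y) = sC" "sgn (\<psi> y) = sC" if "y \<le> C" for y
    using that C1[of y] C2'[of "h y"] order_aut_le[OF h, of y C2] BC lc deg
    by (auto simp: \<phi>_def \<psi>_def sC_def C2)
  have nz: "sB \<noteq> 0" "sC \<noteq> 0" using lc(2) by (simp_all add: sB_def sC_def sgn_eq_0_iff)
  define Y where "Y = insert B (insert C X)"
  have Y: "finite Y" "B \<in> Y" "C \<in> Y" "X \<subseteq> Y" using X by (auto simp: Y_def)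
  have agreeY: "sgn (\<phi> x) = sgn (\<psi> x)" if "x \<in> Y" for x
    using that agree top[of B] bot[of C] by (auto simp: Y_def \<phi>_def \<psi>_def)
  define gap where "gap = (\<lambda>l r. l \<in> Y \<and> r \<in> Y \<and> l < r \<and> (\<forall>x. l < x \<longrightarrow> x < r \<longrightarrow> x \<notin> Y))"
  have gap_ex: "\<exists>l r. gap l r \<and> l < y \<and> y < r" if y: "C < y" "y < B" "y \<notin> Y" for y
  proof -
    obtain l r where "l \<in> Y" "r \<in> Y" "l < y" "y < r" "\<forall>x. l < x \<longrightarrow> x < r \<longrightarrow> x \<notin> Y"
      using finite_set_gap[OF Y(1,3) y(1) Y(2) y(2,3)] by blast
    moreover from this have "l < r" by simp
    ultimately show ?thesis unfolding gap_def by blast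
  qed
  have ivt\<phi>: "\<exists>x. u < x \<and> x < v \<and> \<phi> x = 0" if "u < v" "\<phi> u * \<phi> v < 0" for u v
    using poly_ivt[of u v p] that by (auto simp: \<phi>_def)
  have ivt\<psi>: "\<exists>x. u < x \<and> x < v \<and> \<psi> x = 0" if uv: "u < v" "\<psi> u * \<psi> v < 0" for u v
  proof -
    obtain z where "h u < z" "z < h v" "poly q z = 0"
      using poly_ivt[of "h u" "h v" q] uv by (auto simp: \<psi>_def order_aut_less[OF h])
    moreover obtain x where "h x = z" using order_aut_surj[OF h] by blast
    ultimately show ?thesis by (auto simp: \<psi>_def order_aut_less[OF h])
  qed
  \<comment> \<open>\<open>d\<close> is the common sign of both derivatives on the gap; multiplying
    by \<open>d\<close> treats increasing and decreasing gaps alike.\<close>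
  have mono: "\<exists>d. d \<noteq> 0 \<and> (\<forall>u v. l \<le> u \<longrightarrow> u < v \<longrightarrow> v \<le> r \<longrightarrow> d * \<phi> u < d * \<phi> v \<and> d * \<psi> u < d * \<psi> v)"
    if g: "gap l r" for l r
  proof -
    have lr: "l < r" and noroot: "\<And>x. l < x \<Longrightarrow> x < r \<Longrightarrow> poly (pderiv p) x \<noteq> 0"
      using g crit Y(4) by (auto simp: gap_def)
    obtain m where m: "l < m" "m < r" using dense[OF lr] by auto
    define d where "d = sgn (poly (pderiv p) m)"
    have d: "d \<noteq> 0" using noroot m by (simp add: d_def sgn_eq_0_iff)
    have dp: "sgn (poly (pderiv p) x) = d" if "l < x" "x < r" for x
      unfolding d_def by (rule poly_sgn_const) (use that m noroot in \<open>auto simp: min_def max_def split: if_splits\<close>)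
    have dq: "sgn (poly (pderiv q) z) = d" if z: "h l < z" "z < h r" for z
    proof -
      obtain x where "h x = z" using order_aut_surj[OF h] by blast
      then show ?thesis using dp[of x] der[of x] z order_aut_less[OF h] by auto
    qed
    have "d * \<phi> u < d * \<phi> v \<and> d * \<psi> u < d * \<psi> v" if uv: "l \<le> u" "u < v" "v \<le> r" for u v
    proof -
      have 1: "sgn (\<phi> v - \<phi> u) = d" unfolding \<phi>_def
        by (rule poly_increasing_where_pderiv[OF _ uv]) (use dp in auto)
      have 2: "sgn (\<psi> v - \<psi> u) = d" unfolding \<psi>_def
        by (rule poly_increasing_where_pderiv[where l = "h l" and r = "h r"])
          (use dq uv order_aut_less[OF h] order_aut_le[OF h] in auto)
      show ?thesis using 1 2 d by (auto simp: sgn_if split: if_splits)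
    qed
    then show ?thesis using d by blast
  qed
  \<comment> \<open>The roots are treated one at a time. The new root \<open>\<rho>\<close> sits
    alone in its gap by monotonicity, and \<open>m\<close> moves points of that gap only, so the
    roots already matched and the points of \<open>Y\<close> are undisturbed.\<close>
  have match: "\<exists>k. order_aut k \<and> (\<forall>x\<in>Y. k x = x) \<and> (\<forall>\<rho>\<in>Z. \<psi> (k \<rho>) = 0)"
    if "finite Z" "Z \<subseteq> {\<rho>. \<phi> \<rho> = 0 \<and> \<rho> \<notin> Y}" for Z
    using that
  proof (induction Z rule: finite_induct)
    case empty
    then show ?case using order_aut_id by blast
  next
    case (insert \<rho> Z)
    then obtain k where k: "order_aut k" "\<And>x. x \<in> Y \<Longrightarrow> k x = x" "\<And>\<rho>. \<rho> \<in> Z \<Longrightarrow> \<psi> (k \<rho>) = 0" by auto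
    have \<rho>: "\<phi> \<rho> = 0" "\<rho> \<notin> Y" using insert by auto
    then have "C < \<rho>" "\<rho> < B" using top(1)[of \<rho>] bot(1)[of \<rho>] nz by (auto simp: not_le[symmetric])
    then obtain l r where lr: "gap l r" "l < \<rho>" "\<rho> < r" using gap_ex \<rho> by blast
    then have lrY: "l \<in> Y" "r \<in> Y" by (auto simp: gap_def)
    obtain d where d: "d \<noteq> 0" "\<And>u v. l \<le> u \<Longrightarrow> u < v \<Longrightarrow> v \<le> r \<Longrightarrow> d * \<phi> u < d * \<phi> v \<and> d * \<psi> u < d * \<psi> v"
      using mono[OF lr(1)] by blast
    have "d * \<phi> l < 0" "d * \<phi> r > 0" using d(2)[of l \<rho>] d(2)[of \<rho> r] lr \<rho> by auto
    then have "\<phi> l * \<phi> r < 0" by (auto simp: mult_less_0_iff zero_less_mult_iff)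
    then have "\<psi> l * \<psi> r < 0" using agreeY[of l] agreeY[of r] lrY
      by (auto simp: mult_less_0_iff sgn_if split: if_splits)
    then obtain \<rho>' where \<rho>': "l < \<rho>'" "\<rho>' < r" "\<psi> \<rho>' = 0" using ivt\<psi>[of l r] lr by auto
    have kl: "l < k \<rho>" "k \<rho> < r"
      using order_aut_less[OF k(1), of l \<rho>] order_aut_less[OF k(1), of \<rho> r] k(2) lr lrY by auto
    then obtain m where m: "order_aut m" "m (k \<rho>) = \<rho>'" "\<And>y. y \<le> l \<or> r \<le> y \<Longrightarrow> m y = y"
      using order_aut_move[of l "k \<rho>" r \<rho>'] \<rho>' by blast
    have "m (k x) = x" if "x \<in> Y" for x
    proof -
      have "x \<le> l \<or> r \<le> x" using lr(1) that unfolding gap_def by (meson not_le)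
      then show ?thesis using m(3)[of x] k(2)[OF that] by simp
    qed
    moreover have "\<psi> (m (k z)) = 0" if "z \<in> Z" for z
    proof (cases "l < z \<and> z < r")
      case True
      have "z \<noteq> \<rho>" "\<phi> z = 0" using insert that by auto
      then show ?thesis using d(2)[of z \<rho>] d(2)[of \<rho> z] True lr \<rho> by (auto simp: neq_iff)
    next
      case False
      then have "k z \<le> l \<or> r \<le> k z"
        using order_aut_le[OF k(1), of z l] order_aut_le[OF k(1), of r z] k(2) lrY by auto
      then show ?thesis using m(3) k(3) that by auto
    qed
    ultimately show ?case using order_aut_comp[OF m(1) k(1)] m(2) \<rho>' by (intro exI[of _ "\<lambda>x. m (k x)"]) auto
  qed
  have "finite {\<rho>. \<phi> \<rho> = 0 \<and> \<rho> \<notin> Y}"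
    using poly_roots_finite[OF lc(2)] by (auto simp: \<phi>_def elim: rev_finite_subset)
  from match[OF this subset_refl] obtain k where
    k: "order_aut k" "\<And>x. x \<in> Y \<Longrightarrow> k x = x" "\<And>\<rho>. \<phi> \<rho> = 0 \<Longrightarrow> \<rho> \<notin> Y \<Longrightarrow> \<psi> (k \<rho>) = 0" by auto
  have "sgn (\<phi> y) = sgn (\<psi> (k y))" for y
  proof -
    consider "y \<le> C" | "y \<ge> B" | "y \<in> Y" | "C < y" "y < B" "y \<notin> Y" by (meson not_le)
    then show ?thesis
    proof cases
      case 1
      then show ?thesis using order_aut_le[OF k(1), of y C] k(2) Y bot by auto
    next
      case 2
      then show ?thesis using order_aut_le[OF k(1), of B y] k(2) Y top by auto
    next
      case 3
      then show ?thesis using k agreeY by simp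
    next
      case 4
      then obtain l r where lr: "gap l r" "l < y" "y < r" using gap_ex by blast
      then have lrY: "l \<in> Y" "r \<in> Y" by (auto simp: gap_def)
      obtain d where d: "d \<noteq> 0" "\<And>u v. l \<le> u \<Longrightarrow> u < v \<Longrightarrow> v \<le> r \<Longrightarrow> d * \<phi> u < d * \<phi> v \<and> d * \<psi> u < d * \<psi> v"
        using mono[OF lr(1)] by blast
      have ky: "l < k y" "k y < r"
        using order_aut_less[OF k(1), of l y] order_aut_less[OF k(1), of y r] k(2) lr lrY by auto
      have kroot: "\<psi> (k \<rho>) = 0" if "l < \<rho>" "\<rho> < r" "\<phi> \<rho> = 0" for \<rho>
        using k(3)[of \<rho>] that lr(1) by (auto simp: gap_def)
      have sl: "d * \<phi> l < 0 \<longleftrightarrow> d * \<psi> l < 0" and sr: "d * \<phi> r > 0 \<longleftrightarrow> d * \<psi> r > 0"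
        using agreeY[OF lrY(1)] agreeY[OF lrY(2)]
        by (auto simp: sgn_if mult_less_0_iff zero_less_mult_iff split: if_splits)
      \<comment> \<open>A wrong sign of \<open>\<psi> (k y)\<close> would force a sign change of
        \<open>\<phi>\<close> between \<open>y\<close> and one end of the gap. Its root
        \<open>\<rho>\<close> is matched, so \<open>\<psi> (k \<rho>) = 0\<close>, and monotonicity
        of \<open>d * \<psi>\<close> between \<open>k \<rho>\<close> and \<open>k y\<close> gives a
        contradiction.\<close>
      consider "\<phi> y = 0" | "d * \<phi> y > 0" | "d * \<phi> y < 0" using d(1) by (metis linorder_neqE_linordered_idom mult_eq_0_iff)
      then show ?thesis
      proof cases
        case 1
        then show ?thesis using kroot lr by auto
      next
        case 2
        have "d * \<psi> (k y) > 0"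
        proof (rule ccontr)
          assume "\<not> d * \<psi> (k y) > 0"
          then have "d * \<psi> l < 0" using d(2)[of l "k y"] ky by auto
          then have "d * \<phi> l < 0" using sl by simp
          then have "\<phi> l * \<phi> y < 0" using 2 by (auto simp: mult_less_0_iff zero_less_mult_iff)
          then obtain \<rho> where \<rho>: "l < \<rho>" "\<rho> < y" "\<phi> \<rho> = 0" using ivt\<phi>[of l y] lr by auto
          then have "\<psi> (k \<rho>) = 0" using kroot lr by auto
          moreover have "l < k \<rho>" "k \<rho> < k y"
            using order_aut_less[OF k(1), of l \<rho>] order_aut_less[OF k(1), of \<rho> y] k(2) \<rho> lrY by auto
          ultimately show False using d(2)[of "k \<rho>" "k y"] ky \<open>\<not> d * \<psi> (k y) > 0\<close> by auto
        qed
        then show ?thesis using 2 by (auto simp: sgn_if zero_less_mult_iff split: if_splits)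
      next
        case 3
        have "d * \<psi> (k y) < 0"
        proof (rule ccontr)
          assume "\<not> d * \<psi> (k y) < 0"
          then have "d * \<psi> r > 0" using d(2)[of "k y" r] ky by auto
          then have "d * \<phi> r > 0" using sr by simp
          then have "\<phi> y * \<phi> r < 0" using 3 by (auto simp: mult_less_0_iff zero_less_mult_iff)
          then obtain \<rho> where \<rho>: "y < \<rho>" "\<rho> < r" "\<phi> \<rho> = 0" using ivt\<phi>[of y r] lr by auto
          then have "\<psi> (k \<rho>) = 0" using kroot lr by auto
          moreover have "k y < k \<rho>" "k \<rho> < r"
            using order_aut_less[OF k(1), of \<rho> r] order_aut_less[OF k(1), of y \<rho>] k(2) \<rho> lrY by auto
          ultimately show False using d(2)[of "k y" "k \<rho>"] ky \<open>\<not> d * \<psi> (k y) < 0\<close> by auto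
        qed
        then show ?thesis using 3 by (auto simp: sgn_if mult_less_0_iff split: if_splits)
      qed
    qed
  qed
  then show ?thesis using k Y(4) by (intro exI[of _ k]) (auto simp: \<phi>_def \<psi>_def)
qed

text \<open>\<open>X\<close> contains all roots of the nonzero \<open>f i\<close>, so
  \<open>k\<close> fixes them. Hence no such root separates \<open>y\<close> from
  \<open>k y\<close>, and passing from \<open>h\<close> to \<open>h \<circ> k\<close> preserves the
  signs of the \<open>f i\<close> already matched. Positive degree makes \<open>pderiv p\<close>
  nonzero, hence \<open>X\<close> finite.\<close>

lemma sign_matching_family:
  fixes f g :: "'i \<Rightarrow> 'a::real_closed poly" and p q :: "'a poly"
  assumes h: "order_aut h" and I: "finite I"
    and fg: "\<And>i y. i \<in> I \<Longrightarrow> sgn (poly (f i) y) = sgn (poly (g i) (h y))"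
    and der: "\<And>y. sgn (poly (pderiv p) y) = sgn (poly (pderiv q) (h y))"
    and fg_roots: "\<And>i x. i \<in> I \<Longrightarrow> f i \<noteq> 0 \<Longrightarrow> poly (f i) x = 0 \<Longrightarrow> sgn (poly p x) = sgn (poly q (h x))"
    and der_roots: "\<And>x. poly (pderiv p) x = 0 \<Longrightarrow> sgn (poly p x) = sgn (poly q (h x))"
    and deg: "degree p = degree q" "degree p > 0" and lc: "sgn (lead_coeff p) = sgn (lead_coeff q)"
  shows "\<exists>h'. order_aut h' \<and> (\<forall>i\<in>I. \<forall>y. sgn (poly (f i) y) = sgn (poly (g i) (h' y))) \<and>
    (\<forall>y. sgn (poly p y) = sgn (poly q (h' y)))"
proof -
  define X where "X = {x. poly (pderiv p) x = 0} \<union> (\<Union>i\<in>{i\<in>I. f i \<noteq> 0}. {x. poly (f i) x = 0})"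
  have p0: "p \<noteq> 0" "pderiv p \<noteq> 0" using deg(2) by (auto simp: pderiv_eq_0_iff)
  have fin: "finite X" using I p0(2) by (auto simp: X_def intro!: poly_roots_finite)
  have crit: "y \<in> X" if "poly (pderiv p) y = 0" for y using that by (simp add: X_def)
  have agree: "sgn (poly p x) = sgn (poly q (h x))" if "x \<in> X" for x
    using that fg_roots der_roots by (auto simp: X_def)
  obtain k where k: "order_aut k" "\<And>x. x \<in> X \<Longrightarrow> k x = x" "\<And>y. sgn (poly p y) = sgn (poly q (h (k y)))"
    using sign_matching[OF h fin der crit agree deg(1) lc p0(1)] by metis
  have "sgn (poly (f i) y) = sgn (poly (g i) (h (k y)))" if i: "i \<in> I" for i y
  proof (cases "f i = 0")
    case True
    have "sgn (poly (g i) (h (k y))) = sgn (poly (f i) (k y))" using fg[OF i] by simp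
    then show ?thesis using True by simp
  next
    case False
    have "sgn (poly (f i) y) = sgn (poly (f i) (k y))"
    proof (cases "y = k y")
      case ne: False
      show ?thesis
      proof (rule poly_sgn_const)
        fix x assume x: "min y (k y) \<le> x" "x \<le> max y (k y)"
        show "poly (f i) x \<noteq> 0"
        proof
          assume "poly (f i) x = 0"
          then have "k x = x" using k(2) i False by (auto simp: X_def)
          then show False
            using x ne order_aut_le[OF k(1), of x y] order_aut_le[OF k(1), of y x]
            by (auto simp: min_def max_def split: if_splits)
        qed
      qed
    qed simp
    then show ?thesis using fg[OF i] by simp
  qed
  then show ?thesis using order_aut_comp[OF h k(1)] k(3) by (intro exI[of _ "\<lambda>y. h (k y)"]) auto
qed

section \<open>Quantifier elimination\<close>

text \<open>Polynomial functions of the environment with coefficients in the ring generated by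
  \<open>K\<close>. For \<open>K = {}\<close> these are the integer polynomials, for
  \<open>K = UNIV\<close> all polynomials over the field.\<close>

inductive_set polyfun :: "'a::comm_ring_1 set \<Rightarrow> ((nat \<Rightarrow> 'a) \<Rightarrow> 'a) set" for K where
  polyfun_const: "c \<in> K \<Longrightarrow> (\<lambda>e. c) \<in> polyfun K"
| polyfun_zero: "(\<lambda>e. 0) \<in> polyfun K"
| polyfun_one: "(\<lambda>e. 1) \<in> polyfun K"
| polyfun_var: "(\<lambda>e. e i) \<in> polyfun K"
| polyfun_add: "p \<in> polyfun K \<Longrightarrow> q \<in> polyfun K \<Longrightarrow> (\<lambda>e. p e + q e) \<in> polyfun K"
| polyfun_mult: "p \<in> polyfun K \<Longrightarrow> q \<in> polyfun K \<Longrightarrow> (\<lambda>e. p e * q e) \<in> polyfun K"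
| polyfun_uminus: "p \<in> polyfun K \<Longrightarrow> (\<lambda>e. - p e) \<in> polyfun K"

lemma polyfun_diff: "p \<in> polyfun K \<Longrightarrow> q \<in> polyfun K \<Longrightarrow> (\<lambda>e. p e - q e) \<in> polyfun K"
  using polyfun_add[OF _ polyfun_uminus, of p K q] by simp

lemma polyfun_of_nat: "(\<lambda>e. of_nat n) \<in> polyfun K"
  by (induction n) (auto intro: polyfun_zero polyfun_one polyfun_add)

lemma polyfun_sum: "(\<And>i. i \<in> I \<Longrightarrow> p i \<in> polyfun K) \<Longrightarrow> (\<lambda>e. \<Sum>i\<in>I. p i e) \<in> polyfun K"
  by (induction I rule: infinite_finite_induct) (auto intro: polyfun_zero polyfun_add)

lemma polyfun_If: "p \<in> polyfun K \<Longrightarrow> q \<in> polyfun K \<Longrightarrow> (\<lambda>e. if b then p e else q e) \<in> polyfun K"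
  by (cases b) simp_all

lemma polyfun_mono:
  assumes "K \<subseteq> K'"
  shows "polyfun K \<subseteq> polyfun K'"
proof
  fix p assume "p \<in> polyfun K"
  then show "p \<in> polyfun K'" by induction (use assms in \<open>auto intro: polyfun.intros\<close>)
qed

lemma polyfun_subst:
  assumes "p \<in> polyfun K" "\<And>i. (\<lambda>e. \<sigma> e i) \<in> polyfun K"
  shows "(\<lambda>e. p (\<sigma> e)) \<in> polyfun K"
  using assms(1) by induction (use assms(2) in \<open>auto intro: polyfun.intros\<close>)

text \<open>Polynomials in one distinguished variable whose coefficients are polynomial functions of
  the remaining ones. The strict degree bound \<open>n\<close> is formal and uniform in the
  environment; the actual degree may drop at particular \<open>e\<close>.\<close>

definition ppoly :: "'a::comm_ring_1 set \<Rightarrow> nat \<Rightarrow> ((nat \<Rightarrow> 'a) \<Rightarrow> 'a poly) set" where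
  "ppoly K n = {\<pi>. (\<forall>i. (\<lambda>e. coeff (\<pi> e) i) \<in> polyfun K) \<and> (\<forall>e i. n \<le> i \<longrightarrow> coeff (\<pi> e) i = 0)}"

lemma ppoly_coeff: "\<pi> \<in> ppoly K n \<Longrightarrow> (\<lambda>e. coeff (\<pi> e) i) \<in> polyfun K"
  by (simp add: ppoly_def)

lemma ppoly_mono: "n \<le> m \<Longrightarrow> \<pi> \<in> ppoly K n \<Longrightarrow> \<pi> \<in> ppoly K m"
  by (auto simp: ppoly_def)

lemma ppoly_0: "\<pi> \<in> ppoly K 0 \<Longrightarrow> \<pi> e = 0"
  by (auto simp: ppoly_def intro: poly_eqI)

lemma ppoly_degree: "\<pi> \<in> ppoly K (Suc m) \<Longrightarrow> degree (\<pi> e) \<le> m"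
  by (auto simp: ppoly_def intro!: degree_le)

lemma ppoly_add: "\<pi> \<in> ppoly K n \<Longrightarrow> \<tau> \<in> ppoly K n \<Longrightarrow> (\<lambda>e. \<pi> e + \<tau> e) \<in> ppoly K n"
  by (auto simp: ppoly_def intro: polyfun_add)

lemma ppoly_uminus: "\<pi> \<in> ppoly K n \<Longrightarrow> (\<lambda>e. - \<pi> e) \<in> ppoly K n"
  by (auto simp: ppoly_def intro: polyfun_uminus)

lemma ppoly_mult:
  assumes "\<pi> \<in> ppoly K n" "\<tau> \<in> ppoly K m"
  shows "(\<lambda>e. \<pi> e * \<tau> e) \<in> ppoly K (n + m)"
proof -
  have "coeff (\<pi> e) i * coeff (\<tau> e) (k - i) = 0" if "n + m \<le> k" for e i k
    using assms that by (cases "n \<le> i") (auto simp: ppoly_def)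
  then show ?thesis using assms
    by (auto simp: ppoly_def coeff_mult intro!: polyfun_sum polyfun_mult sum.neutral)
qed

lemma ppoly_monom: "c \<in> polyfun K \<Longrightarrow> (\<lambda>e. monom (c e) i) \<in> ppoly K (Suc i)"
  by (auto simp: ppoly_def intro!: polyfun_If polyfun_zero)

lemma ppoly_pderiv: "\<pi> \<in> ppoly K (Suc n) \<Longrightarrow> (\<lambda>e. pderiv (\<pi> e)) \<in> ppoly K n"
  by (auto simp: ppoly_def coeff_pderiv simp del: of_nat_Suc intro!: polyfun_mult polyfun_of_nat)

lemma ppoly_cutoff: "\<pi> \<in> ppoly K n \<Longrightarrow> (\<lambda>e. poly_cutoff m (\<pi> e)) \<in> ppoly K m"
  by (auto simp: ppoly_def coeff_poly_cutoff intro!: polyfun_If polyfun_zero)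

lemma polyfun_as_ppoly:
  assumes "p \<in> polyfun K"
  shows "\<exists>n. \<exists>\<pi>\<in>ppoly K n. \<forall>e y. p (case_nat y e) = poly (\<pi> e) y"
  using assms
proof induction
  case (polyfun_const c)
  then show ?case
    by (intro exI[of _ 1] bexI[of _ "\<lambda>e. monom c 0"])
       (auto simp: ppoly_def monom_0 coeff_pCons intro: polyfun.intros split: nat.split)
next
  case polyfun_zero
  then show ?case
    by (intro exI[of _ 1] bexI[of _ "\<lambda>e. 0"]) (auto simp: ppoly_def intro: polyfun.intros)
next
  case polyfun_one
  then show ?case
    using ppoly_monom[OF polyfun.polyfun_one, where i = 0]
    by (intro exI[of _ "Suc 0"] bexI[of _ "\<lambda>e. monom 1 0"]) (auto simp: monom_0)
next
  case (polyfun_var i)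
  show ?case
  proof (cases i)
    case 0
    then show ?thesis using ppoly_monom[OF polyfun.polyfun_one, where i = 1]
      by (intro exI[of _ "Suc 1"] bexI[of _ "\<lambda>e. monom 1 1"]) (auto simp: poly_monom)
  next
    case (Suc j)
    then show ?thesis using ppoly_monom[OF polyfun.polyfun_var[of j], where i = 0]
      by (intro exI[of _ "Suc 0"] bexI[of _ "\<lambda>e. monom (e j) 0"]) (auto simp: poly_monom)
  qed
next
  case (polyfun_add p q)
  then obtain n m \<pi> \<tau> where "\<pi> \<in> ppoly K n" "\<tau> \<in> ppoly K m"
    "\<forall>e y. p (case_nat y e) = poly (\<pi> e) y" "\<forall>e y. q (case_nat y e) = poly (\<tau> e) y" by metis
  then show ?case using ppoly_add[of \<pi> K "max n m" \<tau>] ppoly_mono[of n "max n m" \<pi> K] ppoly_mono[of m "max n m" \<tau> K]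
    by (intro exI[of _ "max n m"] bexI[of _ "\<lambda>e. \<pi> e + \<tau> e"]) auto
next
  case (polyfun_mult p q)
  then obtain n m \<pi> \<tau> where "\<pi> \<in> ppoly K n" "\<tau> \<in> ppoly K m"
    "\<forall>e y. p (case_nat y e) = poly (\<pi> e) y" "\<forall>e y. q (case_nat y e) = poly (\<tau> e) y" by metis
  then show ?case using ppoly_mult[of \<pi> K n \<tau> m]
    by (intro exI[of _ "n + m"] bexI[of _ "\<lambda>e. \<pi> e * \<tau> e"]) auto
next
  case (polyfun_uminus p)
  then obtain n \<pi> where "\<pi> \<in> ppoly K n" "\<forall>e y. p (case_nat y e) = poly (\<pi> e) y" by metis
  then show ?case using ppoly_uminus[of \<pi> K n]
    by (intro exI[of _ n] bexI[of _ "\<lambda>e. - \<pi> e"]) auto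
qed

text \<open>The exponent is even so that, wherever the leading coefficient of \<open>\<tau>\<close> does not vanish, \<open>\<pi>\<close>
  has the sign of the remainder at the roots of \<open>\<tau>\<close>.\<close>

lemma ppoly_pseudo_remainder:
  assumes "\<pi> \<in> ppoly K n" "\<tau> \<in> ppoly K (Suc d)"
  shows "\<exists>\<rho>\<in>ppoly K d. \<exists>k. \<forall>e. \<exists>q. smult (coeff (\<tau> e) d ^ (2 * k)) (\<pi> e) = \<tau> e * q + \<rho> e"
  using assms(1)
proof (induction n arbitrary: \<pi>)
  case 0
  then have "\<pi> \<in> ppoly K d" by (rule ppoly_mono[rotated]) simp
  then show ?case by (intro bexI[of _ \<pi>] exI[of _ 0] allI exI[of _ 0]) auto
next
  case (Suc n)
  show ?case
  proof (cases "Suc n \<le> d")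
    case True
    then have "\<pi> \<in> ppoly K d" using Suc.prems ppoly_mono by blast
    then show ?thesis by (intro bexI[of _ \<pi>] exI[of _ 0] allI exI[of _ 0]) auto
  next
    case False
    then have dn: "d \<le> n" by simp
    define c where "c = (\<lambda>e. coeff (\<tau> e) d)"
    \<comment> \<open>\<open>a\<close> is chosen so that the coefficient of \<open>\<pi>'\<close> at
      \<open>n\<close> cancels; scaling by \<open>c * c\<close> instead of \<open>c\<close> keeps
      the total exponent even.\<close>
    define a where "a = (\<lambda>e. coeff (\<pi> e) n * c e)"
    define \<pi>' where "\<pi>' = (\<lambda>e. smult (c e * c e) (\<pi> e) - monom (a e) (n - d) * \<tau> e)"
    have c: "c \<in> polyfun K" and a: "a \<in> polyfun K"
      using assms(2) Suc.prems by (auto simp: c_def a_def intro!: polyfun_mult ppoly_coeff)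
    have "(\<lambda>e. monom (a e) (n - d) * \<tau> e) \<in> ppoly K (Suc (n - d) + Suc d)"
      by (intro ppoly_mult ppoly_monom a assms(2))
    then have mono: "(\<lambda>e. coeff (monom (a e) (n - d) * \<tau> e) i) \<in> polyfun K" for i
      by (rule ppoly_coeff)
    have "coeff (\<pi>' e) i = 0" if "n \<le> i" for e i
    proof (cases "i = n")
      case True
      then show ?thesis using dn by (simp add: \<pi>'_def coeff_monom_mult a_def c_def)
    next
      case False
      then have "Suc n \<le> i" "Suc d \<le> i - (n - d)" using that dn by auto
      then show ?thesis using Suc.prems assms(2) by (simp add: \<pi>'_def coeff_monom_mult ppoly_def)
    qed
    moreover have "(\<lambda>e. coeff (\<pi>' e) i) \<in> polyfun K" for i
      unfolding \<pi>'_def coeff_diff coeff_smult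
      by (intro polyfun_diff polyfun_mult c mono ppoly_coeff[OF Suc.prems])
    ultimately have "\<pi>' \<in> ppoly K n" by (simp add: ppoly_def)
    from Suc.IH[OF this] obtain \<rho> k where \<rho>: "\<rho> \<in> ppoly K d"
      and k: "\<And>e. \<exists>q. smult (c e ^ (2 * k)) (\<pi>' e) = \<tau> e * q + \<rho> e"
      unfolding c_def by blast
    have "\<exists>q. smult (c e ^ (2 * Suc k)) (\<pi> e) = \<tau> e * q + \<rho> e" for e
    proof -
      obtain q where q: "smult (c e ^ (2 * k)) (\<pi>' e) = \<tau> e * q + \<rho> e" using k by blast
      have "smult (c e ^ (2 * Suc k)) (\<pi> e) = smult (c e ^ (2 * k)) (smult (c e * c e) (\<pi> e))"
        by (simp add: mult_ac)
      also have "smult (c e * c e) (\<pi> e) = \<pi>' e + monom (a e) (n - d) * \<tau> e" by (simp add: \<pi>'_def)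
      also have "smult (c e ^ (2 * k)) (\<pi>' e + monom (a e) (n - d) * \<tau> e)
          = \<tau> e * (q + smult (c e ^ (2 * k)) (monom (a e) (n - d))) + \<rho> e"
        unfolding smult_add_right q by (simp add: algebra_simps)
      finally show ?thesis by blast
    qed
    then show ?thesis using \<rho> unfolding c_def by blast
  qed
qed

section \<open>Sign patterns of a family as a function of its coefficients\<close>

definition same_signs ::
  "((nat \<Rightarrow> 'a) \<Rightarrow> 'a::real_closed poly) set \<Rightarrow> (nat \<Rightarrow> 'a) \<Rightarrow> (nat \<Rightarrow> 'a) \<Rightarrow> bool" where
  "same_signs \<Psi> e e' \<longleftrightarrow>
     (\<exists>h. order_aut h \<and> (\<forall>\<pi>\<in>\<Psi>. \<forall>y. sgn (poly (\<pi> e) y) = sgn (poly (\<pi> e') (h y))))"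

definition agree :: "((nat \<Rightarrow> 'a) \<Rightarrow> 'a::linordered_idom) set \<Rightarrow> (nat \<Rightarrow> 'a) \<Rightarrow> (nat \<Rightarrow> 'a) \<Rightarrow> bool" where
  "agree P e e' \<longleftrightarrow> (\<forall>p\<in>P. sgn (p e) = sgn (p e'))"

lemma agree_Un [simp]: "agree (P \<union> Q) e e' \<longleftrightarrow> agree P e e' \<and> agree Q e e'"
  by (auto simp: agree_def)

text \<open>Formulated for relations between two environments because the existence of a matching
  automorphism is a property of the pair, not of one environment.\<close>

definition determined ::
  "'a::real_closed set \<Rightarrow> ((nat \<Rightarrow> 'a) \<Rightarrow> (nat \<Rightarrow> 'a) \<Rightarrow> bool) \<Rightarrow> bool" where
  "determined K R \<longleftrightarrow> (\<exists>P\<subseteq>polyfun K. finite P \<and> (\<forall>e e'. agree P e e' \<longrightarrow> R e e'))"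

lemma sgn_at_root:
  fixes p q :: "'a::linordered_field poly"
  assumes "smult (c ^ (2 * k)) p = t * q + r" "poly t x = 0" "c \<noteq> 0"
  shows "sgn (poly p x) = sgn (poly r x)"
proof -
  have "c ^ (2 * k) * poly p x = poly r x"
    using arg_cong[OF assms(1), of "\<lambda>p. poly p x"] assms(2) by simp
  then have "sgn (poly r x) = sgn (c ^ (2 * k)) * sgn (poly p x)" by (metis sgn_mult)
  moreover have "sgn (c ^ (2 * k)) = 1" using assms(3) by (simp only: sgn_1_pos) (simp add: zero_less_power_eq)
  ultimately show ?thesis by (simp only: mult_1_left)
qed

text \<open>At a root of \<open>\<tau>\<close> the sign of \<open>\<pi>\<close> is that of its
  pseudo-remainder modulo \<open>\<tau>\<close>, so a matching of the remainders transports the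
  signs that \<open>sign_matching_family\<close> asks for. The actual degree of
  \<open>\<tau>\<close> is unknown in advance; therefore \<open>rem\<close> supplies a remainder for
  each truncation, and \<open>coeffs\<close> selects the right one.\<close>

lemma same_signs_insert:
  assumes fin: "finite \<Psi>" and sub: "\<Psi> \<subseteq> ppoly K (Suc m)" and \<pi>: "\<pi> \<in> ppoly K (Suc m)"
    and rem: "\<And>\<tau> j. \<tau> \<in> insert (\<lambda>e. pderiv (\<pi> e)) \<Psi> \<Longrightarrow> j \<le> m \<Longrightarrow>
      \<rho> \<tau> j \<in> R \<and> (\<exists>k. \<forall>e. \<exists>q. smult (coeff (\<tau> e) j ^ (2 * k)) (\<pi> e) = poly_cutoff (Suc j) (\<tau> e) * q + \<rho> \<tau> j e)"
    and sim: "same_signs (insert (\<lambda>e. pderiv (\<pi> e)) \<Psi> \<union> R) e e'"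
    and coeffs: "\<And>\<tau> j. \<tau> \<in> insert \<pi> (insert (\<lambda>e. pderiv (\<pi> e)) \<Psi>) \<Longrightarrow> j \<le> m \<Longrightarrow> sgn (coeff (\<tau> e) j) = sgn (coeff (\<tau> e') j)"
    and lc: "coeff (\<pi> e) m \<noteq> 0" "m > 0"
  shows "same_signs (insert \<pi> \<Psi>) e e'"
proof -
  obtain h where h: "order_aut h"
    and all: "\<forall>\<tau>\<in>insert (\<lambda>e. pderiv (\<pi> e)) \<Psi> \<union> R. \<forall>y. sgn (poly (\<tau> e) y) = sgn (poly (\<tau> e') (h y))"
    using sim unfolding same_signs_def by (elim exE conjE)
  have sgn: "sgn (poly (\<tau> e) y) = sgn (poly (\<tau> e') (h y))" if "\<tau> \<in> insert (\<lambda>e. pderiv (\<pi> e)) \<Psi> \<union> R" for \<tau> y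
    by (rule spec[OF bspec[OF all that]])
  have lc': "coeff (\<pi> e') m \<noteq> 0" using coeffs[of \<pi> m] lc by (auto simp: sgn_eq_0_iff)
  have deg: "degree (\<pi> e) = m" "degree (\<pi> e') = m"
    using ppoly_degree[OF \<pi>] lc lc' by (auto intro!: antisym le_degree)
  have pd: "(\<lambda>e. pderiv (\<pi> e)) \<in> ppoly K (Suc m)" using ppoly_mono[OF _ ppoly_pderiv[OF \<pi>]] by simp
  have root: "sgn (poly (\<pi> e) x) = sgn (poly (\<pi> e') (h x))"
    if \<tau>: "\<tau> \<in> insert (\<lambda>e. pderiv (\<pi> e)) \<Psi>" "\<tau> e \<noteq> 0" "poly (\<tau> e) x = 0" for \<tau> x
  proof -
    \<comment> \<open>The actual degree of \<open>\<tau> e\<close>. As the coefficient signs agree,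
      it is also that of \<open>\<tau> e'\<close>, so truncating above \<open>j\<close> changes
      neither polynomial.\<close>
    define j where "j = degree (\<tau> e)"
    have "\<tau> \<in> ppoly K (Suc m)" using \<tau>(1) sub pd by auto
    then have j: "j \<le> m" and big: "\<And>e i. m < i \<Longrightarrow> coeff (\<tau> e) i = 0"
      using ppoly_degree by (auto simp: j_def ppoly_def)
    have cj: "coeff (\<tau> e) j \<noteq> 0" using \<tau>(2) by (simp add: j_def)
    have zero: "coeff (\<tau> e) i = 0" if "j < i" for i using that by (simp add: j_def coeff_eq_0)
    have cj': "coeff (\<tau> e') j \<noteq> 0" using coeffs[of \<tau> j] j cj \<tau>(1) by (auto simp: sgn_eq_0_iff)
    have zero': "coeff (\<tau> e') i = 0" if "j < i" for i
    proof (cases "i \<le> m")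
      case True
      then have "sgn (coeff (\<tau> e') i) = 0" using coeffs[of \<tau> i] \<tau>(1) zero[OF that] by simp
      then show ?thesis by (simp only: sgn_eq_0_iff)
    qed (simp add: big)
    have cut: "poly_cutoff (Suc j) (\<tau> e) = \<tau> e" "poly_cutoff (Suc j) (\<tau> e') = \<tau> e'"
      using zero zero' by (auto intro!: poly_eqI simp: coeff_poly_cutoff)
    obtain k where R: "\<rho> \<tau> j \<in> R" and
      k: "\<And>e. \<exists>q. smult (coeff (\<tau> e) j ^ (2 * k)) (\<pi> e) = poly_cutoff (Suc j) (\<tau> e) * q + \<rho> \<tau> j e"
      using rem[OF \<tau>(1) j] by blast
    have "sgn (poly (\<tau> e') (h x)) = 0" using sgn[of \<tau> x] \<tau> by auto
    then have r': "poly (\<tau> e') (h x) = 0" by (simp only: sgn_eq_0_iff)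
    have "sgn (poly (\<pi> e) x) = sgn (poly (\<rho> \<tau> j e) x)"
      using k[of e] sgn_at_root[OF _ \<tau>(3) cj] unfolding cut by blast
    also have "\<dots> = sgn (poly (\<rho> \<tau> j e') (h x))" using sgn R by auto
    also have "\<dots> = sgn (poly (\<pi> e') (h x))"
      using k[of e'] sgn_at_root[OF _ r' cj'] unfolding cut by metis
    finally show ?thesis .
  qed
  have "pderiv (\<pi> e) \<noteq> 0" using deg lc by (auto simp: pderiv_eq_0_iff)
  then have der_roots: "sgn (poly (\<pi> e) x) = sgn (poly (\<pi> e') (h x))" if "poly (pderiv (\<pi> e)) x = 0" for x
    using root[of "\<lambda>e. pderiv (\<pi> e)" x] that by simp
  have "\<exists>h'. order_aut h' \<and> (\<forall>\<tau>\<in>\<Psi>. \<forall>y. sgn (poly (\<tau> e) y) = sgn (poly (\<tau> e') (h' y))) \<and>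
    (\<forall>y. sgn (poly (\<pi> e) y) = sgn (poly (\<pi> e') (h' y)))"
  proof (rule sign_matching_family[OF h fin])
    show "sgn (poly (\<tau> e) y) = sgn (poly (\<tau> e') (h y))" if "\<tau> \<in> \<Psi>" for \<tau> y using sgn that by simp
    show "sgn (poly (pderiv (\<pi> e)) y) = sgn (poly (pderiv (\<pi> e')) (h y))" for y
      using sgn[of "\<lambda>e. pderiv (\<pi> e)"] by simp
    show "sgn (poly (\<pi> e) x) = sgn (poly (\<pi> e') (h x))" if "\<tau> \<in> \<Psi>" "\<tau> e \<noteq> 0" "poly (\<tau> e) x = 0" for \<tau> x
      using root that by blast
    show "sgn (lead_coeff (\<pi> e)) = sgn (lead_coeff (\<pi> e'))" using coeffs[of \<pi> m] deg by simp
  qed (use der_roots deg lc in auto)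
  then show ?thesis unfolding same_signs_def by blast
qed

lemma same_signs_subset: "same_signs \<Psi> e e' \<Longrightarrow> \<Psi>' \<subseteq> \<Psi> \<Longrightarrow> same_signs \<Psi>' e e'"
  unfolding same_signs_def by blast

text \<open>If the coefficient of \<open>\<pi>\<close> at \<open>m\<close> vanishes,
  \<open>poly_cutoff m\<close> can replace it; if \<open>m = 0\<close>, it is constant; otherwise
  its derivative and pseudo-remainders decide its signs. All auxiliary polynomials lie in
  \<open>ppoly K m\<close>, so the hypothesis applies with a larger \<open>A\<close> and the same
  \<open>B\<close>. The coefficients in \<open>C\<close> tell which case occurs.\<close>

lemma same_signs_determined_insert:
  assumes IH: "\<And>A. finite A \<Longrightarrow> A \<subseteq> ppoly K m \<Longrightarrow> determined K (same_signs (A \<union> B))"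
    and fin: "finite A" "finite B" and A: "A \<subseteq> ppoly K m" and B: "B \<subseteq> ppoly K (Suc m)"
    and \<pi>: "\<pi> \<in> ppoly K (Suc m)"
  shows "determined K (same_signs (insert \<pi> (A \<union> B)))"
proof -
  define D where "D = (\<lambda>e. pderiv (\<pi> e))"
  define \<Psi> where "\<Psi> = A \<union> B"
  have D: "D \<in> ppoly K m" using ppoly_pderiv[OF \<pi>] by (simp add: D_def)
  have \<Psi>: "finite \<Psi>" "\<Psi> \<subseteq> ppoly K (Suc m)"
    using fin A B ppoly_mono[of m "Suc m" _ K] by (auto simp: \<Psi>_def)
  have D\<Psi>: "insert D \<Psi> \<subseteq> ppoly K (Suc m)" using \<Psi> ppoly_mono[OF _ D, of "Suc m"] by auto
  have "\<exists>\<rho>. \<tau> \<in> insert D \<Psi> \<longrightarrow> \<rho> \<in> ppoly K j \<and>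
      (\<exists>k. \<forall>e. \<exists>q. smult (coeff (\<tau> e) j ^ (2 * k)) (\<pi> e) = poly_cutoff (Suc j) (\<tau> e) * q + \<rho> e)" for \<tau> j
  proof (cases "\<tau> \<in> insert D \<Psi>")
    case True
    then have "\<tau> \<in> ppoly K (Suc m)" using D\<Psi> by blast
    from ppoly_pseudo_remainder[OF \<pi> ppoly_cutoff[OF this, of "Suc j"]] show ?thesis
      by (auto simp: coeff_poly_cutoff)
  qed simp
  then obtain \<rho> where \<rho>: "\<And>\<tau> j. \<tau> \<in> insert D \<Psi> \<Longrightarrow> \<rho> \<tau> j \<in> ppoly K j"
    "\<And>\<tau> j. \<tau> \<in> insert D \<Psi> \<Longrightarrow>
      \<exists>k. \<forall>e. \<exists>q. smult (coeff (\<tau> e) j ^ (2 * k)) (\<pi> e) = poly_cutoff (Suc j) (\<tau> e) * q + \<rho> \<tau> j e"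
    by metis
  define R where "R = (\<lambda>(\<tau>, j). \<rho> \<tau> j) ` (insert D \<Psi> \<times> {..m})"
  define C where "C = (\<lambda>(\<tau>, j) e. coeff (\<tau> e) j) ` (insert \<pi> (insert D \<Psi>) \<times> {..m})"
  have "\<rho> \<tau> j \<in> ppoly K m" if "\<tau> \<in> insert D \<Psi>" "j \<le> m" for \<tau> j
    using ppoly_mono[OF that(2) \<rho>(1)[OF that(1)]] .
  then have R: "finite R" "R \<subseteq> ppoly K m" using \<Psi>(1) by (auto simp: R_def)
  have C: "finite C" "C \<subseteq> polyfun K" using \<Psi>(1) D\<Psi> \<pi> by (auto simp: C_def intro: ppoly_coeff)
  have "determined K (same_signs (insert (\<lambda>e. poly_cutoff m (\<pi> e)) A \<union> B))"
    by (rule IH) (use fin A ppoly_cutoff[OF \<pi>, of m] in auto)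
  then obtain P1 where P1: "P1 \<subseteq> polyfun K" "finite P1"
    "\<And>e e'. agree P1 e e' \<Longrightarrow> same_signs (insert (\<lambda>e. poly_cutoff m (\<pi> e)) A \<union> B) e e'"
    unfolding determined_def by blast
  have "determined K (same_signs ((insert D A \<union> R) \<union> B))"
    by (rule IH) (use fin A D R in auto)
  then obtain P2 where P2: "P2 \<subseteq> polyfun K" "finite P2"
    "\<And>e e'. agree P2 e e' \<Longrightarrow> same_signs ((insert D A \<union> R) \<union> B) e e'"
    unfolding determined_def by blast
  have "same_signs (insert \<pi> \<Psi>) e e'" if ag: "agree (P1 \<union> P2 \<union> C) e e'" for e e'
  proof -
    have coeffs: "sgn (coeff (\<tau> e) j) = sgn (coeff (\<tau> e') j)" if "\<tau> \<in> insert \<pi> (insert D \<Psi>)" "j \<le> m" for \<tau> j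
    proof -
      have "(\<lambda>e. coeff (\<tau> e) j) \<in> C" unfolding C_def by (rule image_eqI[of _ _ "(\<tau>, j)"]) (use that in auto)
      then show ?thesis using bspec[OF ag[unfolded agree_def], of "\<lambda>e. coeff (\<tau> e) j"] by simp
    qed
    have zero_iff: "coeff (\<pi> e) j = 0 \<longleftrightarrow> coeff (\<pi> e') j = 0" if "j \<le> m" for j
      using coeffs[of \<pi> j] that by (metis insertI1 sgn_0_0 sgn_0)
    have big: "coeff (\<pi> e) i = 0" if "m < i" for e i using \<pi> that by (simp add: ppoly_def)
    obtain h where h: "order_aut h"
      "\<And>\<tau> y. \<tau> \<in> insert (\<lambda>e. poly_cutoff m (\<pi> e)) A \<union> B \<Longrightarrow> sgn (poly (\<tau> e) y) = sgn (poly (\<tau> e') (h y))"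
      using P1(3)[of e e'] ag unfolding same_signs_def by auto
    consider "coeff (\<pi> e) m = 0" | "coeff (\<pi> e) m \<noteq> 0" "m = 0" | "coeff (\<pi> e) m \<noteq> 0" "m > 0" by blast
    then show ?thesis
    proof cases
      case 1
      have "poly_cutoff m (\<pi> e'') = \<pi> e''" if "coeff (\<pi> e'') m = 0" for e''
        using that big[of _ e''] by (intro poly_eqI) (auto simp: coeff_poly_cutoff not_less le_less)
      then have "poly_cutoff m (\<pi> e) = \<pi> e" "poly_cutoff m (\<pi> e') = \<pi> e'" using 1 zero_iff[of m] by auto
      then have "sgn (poly (\<tau> e) y) = sgn (poly (\<tau> e') (h y))" if "\<tau> \<in> insert \<pi> \<Psi>" for \<tau> y
        using h(2)[of "\<lambda>e. poly_cutoff m (\<pi> e)" y] h(2)[of \<tau> y] that by (auto simp: \<Psi>_def)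
      then show ?thesis using h(1) unfolding same_signs_def by blast
    next
      case 2
      have "poly (\<pi> e'') y = coeff (\<pi> e'') 0" for e'' y
      proof -
        have "degree (\<pi> e'') = 0" using ppoly_degree[OF \<pi>, of e''] 2 by simp
        then obtain a where "\<pi> e'' = [:a:]" by (rule degree_eq_zeroE)
        then show ?thesis by simp
      qed
      then have "sgn (poly (\<tau> e) y) = sgn (poly (\<tau> e') (h y))" if "\<tau> \<in> insert \<pi> \<Psi>" for \<tau> y
        using coeffs[of \<pi> 0] h(2)[of \<tau> y] that by (auto simp: \<Psi>_def)
      then show ?thesis using h(1) unfolding same_signs_def by blast
    next
      case 3
      show ?thesis
      proof (rule same_signs_insert[OF \<Psi> \<pi> _ _ _ 3, folded D_def])
        show "\<rho> \<tau> j \<in> R \<and> (\<exists>k. \<forall>e. \<exists>q. smult (coeff (\<tau> e) j ^ (2 * k)) (\<pi> e) =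
            poly_cutoff (Suc j) (\<tau> e) * q + \<rho> \<tau> j e)" if "\<tau> \<in> insert D \<Psi>" "j \<le> m" for \<tau> j
          using that \<rho>(2) by (auto simp: R_def)
        have "same_signs ((insert D A \<union> R) \<union> B) e e'" using P2(3) ag by simp
        then show "same_signs (insert D \<Psi> \<union> R) e e'" by (rule same_signs_subset) (auto simp: \<Psi>_def)
      qed (use coeffs in auto)
    qed
  qed
  then show ?thesis using P1 P2 C unfolding determined_def \<Psi>_def
    by (intro exI[of _ "P1 \<union> P2 \<union> C"]) simp
qed

text \<open>A double induction: on \<open>m\<close>, and inside on the set \<open>B\<close> of
  polynomials of top formal degree. \<open>A\<close> stays arbitrary because disposing of one member
  of \<open>B\<close> enlarges \<open>A\<close>; once \<open>B\<close> is empty, the degree bound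
  drops.\<close>

lemma same_signs_determined:
  assumes "finite A" "finite B" "A \<subseteq> ppoly K m" "B \<subseteq> ppoly K (Suc m)"
  shows "determined K (same_signs (A \<union> B))"
  using assms
proof (induction m arbitrary: A B)
  case 0
  from 0(2,1,3,4) show ?case
  proof (induction B arbitrary: A rule: finite_induct)
    case empty
    then have "same_signs A e e'" for e e'
      using order_aut_id ppoly_0 unfolding same_signs_def by (metis subsetD)
    then show ?case by (auto simp: determined_def intro: exI[of _ "{}"])
  next
    case (insert \<pi> B)
    then show ?case using same_signs_determined_insert[of K 0 B A \<pi>] by simp
  qed
next
  case (Suc m)
  from Suc(3,2,4,5) show ?case
  proof (induction B arbitrary: A rule: finite_induct)
    case empty
    then show ?case using Suc.IH[of "{}" A] by simp
  next
    case (insert \<pi> B)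
    then show ?case using same_signs_determined_insert[of K "Suc m" B A \<pi>] by simp
  qed
qed

text \<open>Semialgebraic conditions without their Boolean description: the truth value factors
  through the signs of finitely many polynomials, and how it does so is irrelevant here.\<close>

definition semialg :: "'a::linordered_idom set \<Rightarrow> ((nat \<Rightarrow> 'a) \<Rightarrow> bool) \<Rightarrow> bool" where
  "semialg K F \<longleftrightarrow> (\<exists>P\<subseteq>polyfun K. finite P \<and> (\<forall>e e'. agree P e e' \<longrightarrow> F e = F e'))"

lemma semialg_pos:
  assumes "p \<in> polyfun K"
  shows "semialg K (\<lambda>e. 0 < p e)"
proof -
  have "0 < p e \<longleftrightarrow> 0 < p e'" if "agree {p} e e'" for e e'
    using that by (simp add: agree_def) (metis sgn_greater)
  then show ?thesis using assms unfolding semialg_def by (intro exI[of _ "{p}"]) auto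
qed

lemma semialg_not:
  assumes "semialg K F"
  shows "semialg K (\<lambda>e. \<not> F e)"
  using assms unfolding semialg_def by meson

lemma semialg_conj:
  assumes "semialg K F" "semialg K G"
  shows "semialg K (\<lambda>e. F e \<and> G e)"
proof -
  obtain P Q where P: "P \<subseteq> polyfun K" "finite P" "\<And>e e'. agree P e e' \<Longrightarrow> F e = F e'"
    and Q: "Q \<subseteq> polyfun K" "finite Q" "\<And>e e'. agree Q e e' \<Longrightarrow> G e = G e'"
    using assms unfolding semialg_def by meson
  have "(F e \<and> G e) = (F e' \<and> G e')" if "agree (P \<union> Q) e e'" for e e'
    using that P(3)[of e e'] Q(3)[of e e'] by simp
  then show ?thesis using P Q unfolding semialg_def by (intro exI[of _ "P \<union> Q"]) auto
qed

lemma semialg_less: "p \<in> polyfun K \<Longrightarrow> q \<in> polyfun K \<Longrightarrow> semialg K (\<lambda>e. p e < q e)"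
  using semialg_pos[OF polyfun_diff, of q K p] by simp

lemma semialg_eq:
  assumes "p \<in> polyfun K" "q \<in> polyfun K"
  shows "semialg K (\<lambda>e. p e = q e)"
proof -
  have "semialg K (\<lambda>e. \<not> p e < q e \<and> \<not> q e < p e)"
    by (intro semialg_conj semialg_not semialg_less assms)
  then show ?thesis by (simp add: not_less eq_iff conj_commute)
qed

lemma semialg_mono:
  assumes "semialg K F" "K \<subseteq> K'"
  shows "semialg K' F"
proof -
  obtain P where "P \<subseteq> polyfun K" "finite P" "\<forall>e e'. agree P e e' \<longrightarrow> F e = F e'"
    using assms(1) unfolding semialg_def by meson
  then show ?thesis using polyfun_mono[OF assms(2)] unfolding semialg_def by (intro exI[of _ P]) auto
qed

lemma semialg_subst:
  assumes "semialg K F" "\<And>i. (\<lambda>e. \<sigma> e i) \<in> polyfun K"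
  shows "semialg K (\<lambda>e. F (\<sigma> e))"
proof -
  obtain P where P: "P \<subseteq> polyfun K" "finite P" "\<And>e e'. agree P e e' \<Longrightarrow> F e = F e'"
    using assms(1) unfolding semialg_def by meson
  have "F (\<sigma> e) = F (\<sigma> e')" if "agree ((\<lambda>p e. p (\<sigma> e)) ` P) e e'" for e e'
    using that by (intro P(3)) (simp add: agree_def)
  moreover have "(\<lambda>p e. p (\<sigma> e)) ` P \<subseteq> polyfun K"
    using P(1) polyfun_subst[of _ K \<sigma>] assms(2) by auto
  ultimately show ?thesis using P(2) unfolding semialg_def
    by (intro exI[of _ "(\<lambda>p e. p (\<sigma> e)) ` P"]) auto
qed

lemma finite_polyfun_as_ppoly:
  assumes "finite P" "P \<subseteq> polyfun K"
  shows "\<exists>m. \<exists>\<pi>. \<forall>p\<in>P. \<pi> p \<in> ppoly K m \<and> (\<forall>e y. p (case_nat y e) = poly (\<pi> p e) y)"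
proof -
  have "\<forall>p\<in>P. \<exists>n \<pi>. \<pi> \<in> ppoly K n \<and> (\<forall>e y. p (case_nat y e) = poly (\<pi> e) y)"
    using polyfun_as_ppoly assms(2) by blast
  then obtain n \<pi> where n: "\<And>p. p \<in> P \<Longrightarrow> \<pi> p \<in> ppoly K (n p)"
    "\<And>p e y. p \<in> P \<Longrightarrow> p (case_nat y e) = poly (\<pi> p e) y"
    by metis
  have *: "\<pi> p \<in> ppoly K (Max (n ` P))" if "p \<in> P" for p
    using ppoly_mono[OF _ n(1)[OF that]] that assms(1) by simp
  show ?thesis
    by (rule exI[of _ "Max (n ` P)"], rule exI[of _ \<pi>]) (simp add: * n(2))
qed

text \<open>Quantifier elimination. If the polynomials in \<open>Q\<close> have equal signs at
  \<open>e\<close> and \<open>e'\<close>, an order automorphism \<open>h\<close> matches the sign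
  patterns of \<open>F\<close>'s polynomials in the quantified variable, and a witness
  \<open>y\<close> at \<open>e\<close> becomes the witness \<open>h y\<close> at
  \<open>e'\<close>.\<close>

lemma semialg_ex:
  fixes F :: "(nat \<Rightarrow> 'a::real_closed) \<Rightarrow> bool"
  assumes "semialg K F"
  shows "semialg K (\<lambda>e. \<exists>y. F (case_nat y e))"
proof -
  obtain P where P: "P \<subseteq> polyfun K" "finite P" "\<And>e e'. agree P e e' \<Longrightarrow> F e = F e'"
    using assms unfolding semialg_def by meson
  obtain m \<pi> where \<pi>: "\<And>p. p \<in> P \<Longrightarrow> \<pi> p \<in> ppoly K m"
    "\<And>p e y. p \<in> P \<Longrightarrow> p (case_nat y e) = poly (\<pi> p e) y"
    using finite_polyfun_as_ppoly[OF P(2,1)] by metis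
  have "determined K (same_signs (\<pi> ` P))"
    using same_signs_determined[of "\<pi> ` P" "{}" K m] P(2) \<pi>(1) by auto
  then obtain Q where Q: "Q \<subseteq> polyfun K" "finite Q" "\<And>e e'. agree Q e e' \<Longrightarrow> same_signs (\<pi> ` P) e e'"
    unfolding determined_def by meson
  have imp: "\<exists>y. F (case_nat y e')" if ag: "agree Q e e'" and F: "F (case_nat y e)" for e e' y
  proof -
    obtain h where h: "\<And>p. p \<in> P \<Longrightarrow> sgn (poly (\<pi> p e) y) = sgn (poly (\<pi> p e') (h y))"
      using Q(3)[OF ag] unfolding same_signs_def by blast
    then have "agree P (case_nat y e) (case_nat (h y) e')" by (simp add: agree_def \<pi>(2))
    then show ?thesis using P(3) F by blast
  qed
  have "(\<exists>y. F (case_nat y e)) = (\<exists>y. F (case_nat y e'))" if ag: "agree Q e e'" for e e'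
  proof -
    have "agree Q e' e" using ag by (simp add: agree_def)
    with ag show ?thesis using imp by blast
  qed
  then show ?thesis using Q unfolding semialg_def by blast
qed

text \<open>With the other variables fixed, the truth value can change only at roots of the
  polynomials that decide it. Those that vanish identically at \<open>e\<close> have constant sign
  and are left out, so \<open>Z\<close> is finite.\<close>

lemma semialg_locally_constant:
  fixes F :: "(nat \<Rightarrow> 'a::real_closed) \<Rightarrow> bool"
  assumes "semialg K F"
  shows "\<exists>Z. finite Z \<and> (\<forall>a b. a \<le> b \<longrightarrow> (\<forall>z\<in>Z. \<not> (a \<le> z \<and> z \<le> b)) \<longrightarrow> F (case_nat a e) = F (case_nat b e))"
proof -
  obtain P where P: "P \<subseteq> polyfun K" "finite P" "\<And>e e'. agree P e e' \<Longrightarrow> F e = F e'"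
    using assms unfolding semialg_def by meson
  obtain m \<pi> where \<pi>: "\<And>p e y. p \<in> P \<Longrightarrow> p (case_nat y e) = poly (\<pi> p e) y"
    using finite_polyfun_as_ppoly[OF P(2,1)] by metis
  define Z where "Z = (\<Union>p\<in>{p\<in>P. \<pi> p e \<noteq> 0}. {x. poly (\<pi> p e) x = 0})"
  have "finite Z" using P(2) by (auto simp: Z_def intro!: poly_roots_finite)
  moreover have "F (case_nat a e) = F (case_nat b e)"
    if ab: "a \<le> b" "\<forall>z\<in>Z. \<not> (a \<le> z \<and> z \<le> b)" for a b
  proof (rule P(3), unfold agree_def, rule ballI)
    fix p assume p: "p \<in> P"
    have "sgn (poly (\<pi> p e) a) = sgn (poly (\<pi> p e) b)"
    proof (cases "\<pi> p e = 0")
      case False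
      show ?thesis
      proof (rule poly_sgn_const)
        fix x assume "min a b \<le> x" "x \<le> max a b"
        then have "x \<notin> Z" using ab by (auto simp: min_def max_def)
        then show "poly (\<pi> p e) x \<noteq> 0" using p False by (auto simp: Z_def)
      qed
    qed simp
    then show "sgn (p (case_nat a e)) = sgn (p (case_nat b e))" using \<pi> p by simp
  qed
  ultimately show ?thesis by blast
qed

section \<open>Curves tangent to a derivation\<close>

text \<open>Right neighbourhoods of \<open>0\<close> in the order, given by a filter base since
  \<open>'a\<close> carries no topology.\<close>

definition germ0 :: "'a::linordered_field filter" where
  "germ0 = (INF \<eta>\<in>{0<..}. principal {0<..<\<eta>})"

lemma eventually_germ0:
  "eventually P (germ0 :: 'a::linordered_field filter) \<longleftrightarrow> (\<exists>\<eta>>0. \<forall>t. 0 < t \<longrightarrow> t < \<eta> \<longrightarrow> P t)"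
proof -
  have "eventually P germ0 \<longleftrightarrow> (\<exists>\<eta>\<in>{0::'a<..}. eventually P (principal {0<..<\<eta>}))"
    unfolding germ0_def
  proof (rule eventually_INF_base)
    show "{0::'a<..} \<noteq> {}" using zero_less_one by blast
    show "\<exists>x\<in>{0<..}. principal {0<..<x} \<le> inf (principal {0<..<a}) (principal {0<..<b})"
      if "a \<in> {0<..}" "b \<in> {0<..}" for a b :: 'a
      using that by (intro bexI[of _ "min a b"]) auto
  qed
  then show ?thesis by (simp add: eventually_principal Bex_def Ball_def imp_conjL)
qed

lemma eventually_germ0_less: "0 < \<eta> \<Longrightarrow> eventually (\<lambda>t. 0 < t \<and> t < \<eta>) (germ0 :: 'a::linordered_field filter)"
  by (auto simp: eventually_germ0)

lemma germ0_neq_bot: "germ0 \<noteq> (bot :: 'a::linordered_field filter)"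
  unfolding trivial_limit_def eventually_germ0 using dense by blast

text \<open>The Landau condition that \<open>\<alpha> t\<close> is o(t) as \<open>t\<close> tends to
  \<open>0\<close> from the right.\<close>

definition small :: "('a::linordered_field \<Rightarrow> 'a) \<Rightarrow> bool" where
  "small \<alpha> \<longleftrightarrow> (\<forall>\<epsilon>>0. eventually (\<lambda>t. \<bar>\<alpha> t\<bar> \<le> \<epsilon> * t) germ0)"

lemma smallD: "small \<alpha> \<Longrightarrow> \<epsilon> > 0 \<Longrightarrow> eventually (\<lambda>t. \<bar>\<alpha> t\<bar> \<le> \<epsilon> * t) germ0"
  by (simp add: small_def)

lemma small_zero: "small (\<lambda>t. 0)"
proof -
  have "eventually (\<lambda>t. \<bar>0\<bar> \<le> \<epsilon> * t) germ0" if "\<epsilon> > 0" for \<epsilon> :: 'a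
    by (rule eventually_mono[OF eventually_germ0_less[OF that]]) (use that in auto)
  then show ?thesis by (simp add: small_def)
qed

lemma small_add:
  assumes "small \<alpha>" "small \<beta>"
  shows "small (\<lambda>t. \<alpha> t + \<beta> t)"
  unfolding small_def
proof (intro allI impI)
  fix \<epsilon> :: 'a assume "\<epsilon> > 0"
  then have e: "\<epsilon> / 2 > 0" by simp
  have "eventually (\<lambda>t. \<bar>\<alpha> t\<bar> \<le> \<epsilon> / 2 * t) germ0" "eventually (\<lambda>t. \<bar>\<beta> t\<bar> \<le> \<epsilon> / 2 * t) germ0"
    by (rule smallD[OF assms(1) e], rule smallD[OF assms(2) e])
  then show "eventually (\<lambda>t. \<bar>\<alpha> t + \<beta> t\<bar> \<le> \<epsilon> * t) germ0"
  proof eventually_elim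
    case (elim t)
    then have "\<bar>\<alpha> t + \<beta> t\<bar> \<le> \<epsilon> / 2 * t + \<epsilon> / 2 * t" using abs_triangle_ineq[of "\<alpha> t" "\<beta> t"] by linarith
    then show ?case by (simp add: field_simps)
  qed
qed

lemma small_mult_bounded:
  assumes "small \<alpha>" "eventually (\<lambda>t. \<bar>\<beta> t\<bar> \<le> B) germ0"
  shows "small (\<lambda>t. \<beta> t * \<alpha> t)"
  unfolding small_def
proof (intro allI impI)
  fix \<epsilon> :: 'a assume \<epsilon>: "\<epsilon> > 0"
  define C where "C = \<bar>B\<bar> + 1"
  have C: "C > 0" "B \<le> C" by (auto simp: C_def)
  have "eventually (\<lambda>t. \<bar>\<alpha> t\<bar> \<le> \<epsilon> / C * t) germ0"
    by (rule smallD[OF assms(1)]) (use \<epsilon> C in simp)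
  with assms(2) show "eventually (\<lambda>t. \<bar>\<beta> t * \<alpha> t\<bar> \<le> \<epsilon> * t) germ0"
  proof eventually_elim
    case (elim t)
    have "\<bar>\<beta> t * \<alpha> t\<bar> \<le> C * (\<epsilon> / C * t)"
      unfolding abs_mult using elim C by (intro mult_mono) auto
    then show ?case using C by simp
  qed
qed

lemma small_cmult: "small \<alpha> \<Longrightarrow> small (\<lambda>t. c * \<alpha> t)"
  by (rule small_mult_bounded[where B = "\<bar>c\<bar>"]) auto

lemma small_minus: "small \<alpha> \<Longrightarrow> small (\<lambda>t. - \<alpha> t)"
  using small_cmult[of \<alpha> "-1"] by simp

lemma small_diff: "small \<alpha> \<Longrightarrow> small \<beta> \<Longrightarrow> small (\<lambda>t. \<alpha> t - \<beta> t)"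
  using small_add[OF _ small_minus, of \<alpha> \<beta>] by simp

lemma small_sum: "(\<And>i. i \<in> I \<Longrightarrow> small (\<alpha> i)) \<Longrightarrow> small (\<lambda>t. \<Sum>i\<in>I. \<alpha> i t)"
  by (induction I rule: infinite_finite_induct) (auto intro: small_zero small_add)

lemma small_square: "small (\<lambda>t. t * t * c)"
  unfolding small_def
proof (intro allI impI)
  fix \<epsilon> :: 'a assume "\<epsilon> > 0"
  then have "\<epsilon> / (\<bar>c\<bar> + 1) > 0" by (simp add: add_nonneg_pos)
  from eventually_germ0_less[OF this] show "eventually (\<lambda>t. \<bar>t * t * c\<bar> \<le> \<epsilon> * t) germ0"
  proof eventually_elim
    case (elim t)
    then have "t * (\<bar>c\<bar> + 1) \<le> \<epsilon>" by (simp add: pos_less_divide_eq add_nonneg_pos)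
    moreover have "t * \<bar>c\<bar> \<le> t * (\<bar>c\<bar> + 1)" using elim by simp
    ultimately have "t * \<bar>c\<bar> \<le> \<epsilon>" by (rule order_trans[rotated])
    then have "t * \<bar>c\<bar> * t \<le> \<epsilon> * t" using elim by (intro mult_right_mono) simp_all
    then show ?case using elim by (simp add: abs_mult mult_ac)
  qed
qed

text \<open>Uniqueness of first-order expansions; through it the comparison of two expansions along
  a curve becomes an identity. It rests on \<open>germ0\<close> being a proper filter, that is, on
  density of the order.\<close>

lemma small_linear_iff:
  fixes c :: "'a::linordered_field"
  shows "small (\<lambda>t. t * c) \<longleftrightarrow> c = 0"
proof
  assume s: "small (\<lambda>t. t * c)"
  show "c = 0"
  proof (rule ccontr)
    assume c: "c \<noteq> 0"
    then have "eventually (\<lambda>t. \<bar>t * c\<bar> \<le> \<bar>c\<bar> / 2 * t) germ0" by (intro smallD[OF s]) simp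
    moreover have "eventually (\<lambda>t. 0 < t \<and> t < 1) (germ0 :: 'a filter)" by (rule eventually_germ0_less) simp
    ultimately have "eventually (\<lambda>t. False) (germ0 :: 'a filter)"
    proof eventually_elim
      case (elim t)
      then have "t * \<bar>c\<bar> \<le> t * (\<bar>c\<bar> / 2)" by (simp add: abs_mult mult_ac)
      then have "\<bar>c\<bar> \<le> \<bar>c\<bar> / 2" using elim mult_le_cancel_left_pos[of t "\<bar>c\<bar>" "\<bar>c\<bar> / 2"] by blast
      then show ?case using c by simp
    qed
    then have "germ0 = (bot :: 'a filter)" by (simp only: eventually_False)
    with germ0_neq_bot show False by (rule notE)
  qed
qed (simp add: small_zero)

definition tangent :: "('a::linordered_field \<Rightarrow> 'a) \<Rightarrow> 'a \<Rightarrow> 'a \<Rightarrow> bool" where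
  "tangent a b d \<longleftrightarrow> small (\<lambda>t. a t - b - t * d)"

lemma tangent_linear: "tangent (\<lambda>t. b + t * d) b d"
  by (simp add: tangent_def small_zero)

lemma tangent_const: "tangent (\<lambda>t. b) b 0"
  by (simp add: tangent_def small_zero)

lemma tangent_lipschitz:
  fixes d :: "'a::linordered_field"
  assumes "tangent a b d"
  shows "eventually (\<lambda>t. \<bar>a t - b\<bar> \<le> t * (\<bar>d\<bar> + 1)) germ0"
proof -
  have "eventually (\<lambda>t. \<bar>a t - b - t * d\<bar> \<le> 1 * t) germ0"
    using assms unfolding tangent_def small_def by (metis zero_less_one)
  moreover have "eventually (\<lambda>t. 0 < t \<and> t < 1) (germ0 :: 'a filter)" by (rule eventually_germ0_less) simp
  ultimately show ?thesis
  proof eventually_elim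
    case (elim t)
    have "\<bar>a t - b\<bar> \<le> \<bar>a t - b - t * d\<bar> + \<bar>t * d\<bar>" by linarith
    also have "\<dots> \<le> t + t * \<bar>d\<bar>" using elim by (simp add: abs_mult)
    finally show ?case by (simp add: distrib_left)
  qed
qed

lemma tangent_continuous:
  assumes "tangent a b d" "\<epsilon> > 0"
  shows "eventually (\<lambda>t. \<bar>a t - b\<bar> < \<epsilon>) germ0"
proof -
  have d: "\<bar>d\<bar> + 1 > 0" by (simp add: add_nonneg_pos)
  then have "\<epsilon> / (\<bar>d\<bar> + 1) > 0" using assms(2) by simp
  from eventually_germ0_less[OF this] tangent_lipschitz[OF assms(1)] show ?thesis
  proof eventually_elim
    case (elim t)
    then have "t * (\<bar>d\<bar> + 1) < \<epsilon>" using d by (simp add: pos_less_divide_eq)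
    then show ?case using elim by linarith
  qed
qed

lemma tangent_bounded:
  assumes "tangent a b d"
  shows "eventually (\<lambda>t. \<bar>a t\<bar> \<le> \<bar>b\<bar> + 1) germ0"
  using tangent_continuous[OF assms zero_less_one] by eventually_elim linarith

lemma tangent_sgn:
  assumes "tangent a b d" "b \<noteq> 0"
  shows "eventually (\<lambda>t. sgn (a t) = sgn b) germ0"
proof -
  have "eventually (\<lambda>t. \<bar>a t - b\<bar> < \<bar>b\<bar>) germ0" using tangent_continuous[OF assms(1)] assms(2) by simp
  then show ?thesis
    by eventually_elim (auto simp: sgn_if abs_if split: if_splits)
qed

lemma tangent_add: "tangent a b d \<Longrightarrow> tangent a' b' d' \<Longrightarrow> tangent (\<lambda>t. a t + a' t) (b + b') (d + d')"
  unfolding tangent_def by (drule (1) small_add) (simp add: algebra_simps)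

lemma tangent_minus: "tangent a b d \<Longrightarrow> tangent (\<lambda>t. - a t) (- b) (- d)"
  unfolding tangent_def by (drule small_minus) (simp add: algebra_simps)

lemma tangent_mult:
  assumes "tangent a b d" "tangent a' b' d'"
  shows "tangent (\<lambda>t. a t * a' t) (b * b') (b * d' + b' * d)"
proof -
  have 1: "small (\<lambda>t. a' t * (a t - b - t * d))"
    using assms tangent_bounded[OF assms(2)] unfolding tangent_def by (intro small_mult_bounded)
  have 2: "small (\<lambda>t. (b + t * d) * (a' t - b' - t * d'))"
    using assms tangent_bounded[OF tangent_linear] unfolding tangent_def by (intro small_mult_bounded)
  have "a t * a' t - b * b' - t * (b * d' + b' * d)
      = a' t * (a t - b - t * d) + (b + t * d) * (a' t - b' - t * d') + t * t * (d * d')" for t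
    by (simp add: algebra_simps)
  then show ?thesis
    unfolding tangent_def using small_add[OF small_add[OF 1 2] small_square[of "d * d'"]] by presburger
qed

lemma tangent_power:
  assumes "tangent a b d"
  shows "tangent (\<lambda>t. a t ^ n) (b ^ n) (of_nat n * b ^ (n - 1) * d)"
proof (induction n)
  case (Suc n)
  have "b * (of_nat n * b ^ (n - 1) * d) + b ^ n * d = of_nat (Suc n) * b ^ n * d"
    by (cases n) (simp_all add: algebra_simps)
  then show ?case using tangent_mult[OF assms Suc] by simp
qed (simp add: tangent_const)

section \<open>Derivations and the curves that follow them\<close>

definition is_derivation :: "('a::comm_ring_1 \<Rightarrow> 'a) \<Rightarrow> bool" where
  "is_derivation \<delta> \<longleftrightarrow> (\<forall>x y. \<delta> (x + y) = \<delta> x + \<delta> y) \<and> (\<forall>x y. \<delta> (x * y) = x * \<delta> y + y * \<delta> x)"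

lemma is_derivation_simps:
  assumes "is_derivation \<delta>"
  shows "\<delta> (x + y) = \<delta> x + \<delta> y" "\<delta> (x * y) = x * \<delta> y + y * \<delta> x"
    and "\<delta> 0 = 0" "\<delta> 1 = 0" "\<delta> (- x) = - \<delta> x"
proof -
  show add: "\<delta> (x + y) = \<delta> x + \<delta> y" and mult: "\<delta> (x * y) = x * \<delta> y + y * \<delta> x" for x y
    using assms unfolding is_derivation_def by blast+
  show 0: "\<delta> 0 = 0" using add[of 0 0] by simp
  show "\<delta> 1 = 0" using mult[of 1 1] by simp
  show "\<delta> (- x) = - \<delta> x" using add[of x "- x"] 0 by (simp add: eq_neg_iff_add_eq_0 add.commute)
qed

lemma is_derivation_power:
  assumes "is_derivation \<delta>"
  shows "\<delta> (b ^ n) = of_nat n * b ^ (n - 1) * \<delta> b"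
proof (induction n)
  case (Suc n)
  then show ?case
    by (cases n) (simp_all add: is_derivation_simps[OF assms] algebra_simps)
qed (simp add: is_derivation_simps[OF assms])

text \<open>The second clause cannot be derived from the first: where \<open>p u = 0\<close>,
  tangency only makes \<open>p\<close> along the curve o(t) and leaves its sign open. How small
  \<open>t\<close> must be may depend on \<open>p\<close>.\<close>

definition lifts ::
  "('a::linordered_field \<Rightarrow> 'a) \<Rightarrow> (nat \<Rightarrow> 'a) \<Rightarrow> ('a \<Rightarrow> nat \<Rightarrow> 'a) \<Rightarrow> bool" where
  "lifts \<delta> u \<Gamma> \<longleftrightarrow> (\<forall>i. tangent (\<lambda>t. \<Gamma> t i) (u i) (\<delta> (u i))) \<and>
     (\<forall>p\<in>polyfun {}. p u = 0 \<longrightarrow> eventually (\<lambda>t. p (\<Gamma> t) = 0) germ0)"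

text \<open>The expansion rules for sums and products are exactly the rules of a derivation. Having
  \<open>K = {}\<close> is essential: a parameter \<open>c\<close> stays constant along the curve,
  whereas \<open>\<delta> c\<close> may be nonzero.\<close>

lemma tangent_polyfun:
  assumes \<delta>: "is_derivation \<delta>" and "lifts \<delta> u \<Gamma>" and "p \<in> polyfun {}"
  shows "tangent (\<lambda>t. p (\<Gamma> t)) (p u) (\<delta> (p u))"
  using assms(3)
proof induction
  case (polyfun_var i)
  then show ?case using assms(2) by (simp add: lifts_def)
next
  case (polyfun_add p q)
  then show ?case using tangent_add by (simp add: is_derivation_simps[OF \<delta>])
next
  case (polyfun_mult p q)
  then show ?case using tangent_mult by (simp add: is_derivation_simps[OF \<delta>])
next
  case (polyfun_uminus p)
  then show ?case using tangent_minus by (simp add: is_derivation_simps[OF \<delta>])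
qed (simp_all add: is_derivation_simps[OF \<delta>] tangent_const)

text \<open>Nonzero signs persist by continuity, zeros by the second clause of \<open>lifts\<close>;
  finitely many polynomials decide \<open>F\<close>.\<close>

lemma semialg_lifts:
  assumes "is_derivation \<delta>" "lifts \<delta> u \<Gamma>" "semialg {} F"
  shows "eventually (\<lambda>t. F (\<Gamma> t) = F u) germ0"
proof -
  obtain P where P: "P \<subseteq> polyfun {}" "finite P" "\<And>e e'. agree P e e' \<Longrightarrow> F e = F e'"
    using assms(3) unfolding semialg_def by meson
  have "eventually (\<lambda>t. sgn (p (\<Gamma> t)) = sgn (p u)) germ0" if "p \<in> P" for p
  proof (cases "p u = 0")
    case True
    then have "eventually (\<lambda>t. p (\<Gamma> t) = 0) germ0" using assms(2) P(1) that by (auto simp: lifts_def)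
    then show ?thesis by eventually_elim (simp add: True)
  next
    case False
    then show ?thesis using tangent_sgn[OF tangent_polyfun[OF assms(1,2)]] P(1) that by blast
  qed
  then have "eventually (\<lambda>t. \<forall>p\<in>P. sgn (p (\<Gamma> t)) = sgn (p u)) germ0"
    by (simp add: eventually_ball_finite P(2))
  then show ?thesis by eventually_elim (intro P(3), simp add: agree_def)
qed

lemma poly_ppoly_Suc:
  assumes "\<pi> \<in> ppoly K (Suc n)"
  shows "poly (\<pi> e) y = poly (poly_cutoff n (\<pi> e)) y + coeff (\<pi> e) n * y ^ n"
    and "poly (pderiv (\<pi> e)) y = poly (pderiv (poly_cutoff n (\<pi> e))) y + of_nat n * coeff (\<pi> e) n * y ^ (n - 1)"
proof -
  have "\<pi> e = poly_cutoff n (\<pi> e) + monom (coeff (\<pi> e) n) n"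
    using assms by (intro poly_eqI) (auto simp: coeff_poly_cutoff ppoly_def Suc_le_eq)
  then have "poly (\<pi> e) y = poly (poly_cutoff n (\<pi> e) + monom (coeff (\<pi> e) n) n) y"
    and "poly (pderiv (\<pi> e)) y = poly (pderiv (poly_cutoff n (\<pi> e) + monom (coeff (\<pi> e) n) n)) y" by simp_all
  then show "poly (\<pi> e) y = poly (poly_cutoff n (\<pi> e)) y + coeff (\<pi> e) n * y ^ n"
    and "poly (pderiv (\<pi> e)) y = poly (pderiv (poly_cutoff n (\<pi> e))) y + of_nat n * coeff (\<pi> e) n * y ^ (n - 1)"
    by (simp_all add: pderiv_add pderiv_monom poly_monom)
qed

text \<open>For slope \<open>s = \<delta> b\<close> the expansion has slope \<open>\<delta>\<close>
  of the value; any other slope adds the derivative in the distinguished variable times the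
  deviation \<open>s - \<delta> b\<close>. General \<open>s\<close> is needed to test points on both
  sides of the expected root.\<close>

lemma tangent_ppoly:
  assumes \<delta>: "is_derivation \<delta>" and \<Gamma>: "lifts \<delta> u \<Gamma>" and y: "tangent y b s" and "\<pi> \<in> ppoly {} n"
  shows "tangent (\<lambda>t. poly (\<pi> (\<Gamma> t)) (y t)) (poly (\<pi> u) b)
    (\<delta> (poly (\<pi> u) b) + poly (pderiv (\<pi> u)) b * (s - \<delta> b))"
  using assms(4)
proof (induction n arbitrary: \<pi>)
  case 0
  then show ?case by (simp add: ppoly_0 is_derivation_simps[OF \<delta>] tangent_const)
next
  case (Suc n)
  define c where "c = (\<lambda>e. coeff (\<pi> e) n)"
  note split = poly_ppoly_Suc[OF Suc.prems]
  have "tangent (\<lambda>t. c (\<Gamma> t)) (c u) (\<delta> (c u))"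
    using tangent_polyfun[OF \<delta> \<Gamma>] ppoly_coeff[OF Suc.prems] unfolding c_def by blast
  from tangent_mult[OF this tangent_power[OF y, of n]]
  have "tangent (\<lambda>t. c (\<Gamma> t) * y t ^ n) (c u * b ^ n)
      (\<delta> (c u * b ^ n) + of_nat n * c u * b ^ (n - 1) * (s - \<delta> b))"
    by (simp add: is_derivation_simps[OF \<delta>] is_derivation_power[OF \<delta>] algebra_simps)
  from tangent_add[OF Suc.IH[OF ppoly_cutoff[OF Suc.prems, of n]] this[unfolded c_def]]
  show ?case unfolding split is_derivation_simps(1)[OF \<delta>] by (simp add: algebra_simps)
qed

text \<open>The hypothesis says that \<open>b\<close> has degree at least \<open>n\<close> over the ring generated by \<open>u\<close>.\<close>

lemma ppoly_vanishes_along_lift: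
  assumes \<Gamma>: "lifts \<delta> u \<Gamma>" and \<rho>: "\<rho> \<in> ppoly {} n" "poly (\<rho> u) b = 0"
    and min: "\<And>m \<pi>. m < n \<Longrightarrow> \<pi> \<in> ppoly {} (Suc m) \<Longrightarrow> poly (\<pi> u) b = 0 \<Longrightarrow> coeff (\<pi> u) m = 0"
  shows "eventually (\<lambda>t. \<rho> (\<Gamma> t) = 0) germ0"
proof -
  \<comment> \<open>The bound \<open>n\<close> is only formal. If \<open>\<rho> u\<close> were
    nonzero, cutting \<open>\<rho>\<close> off above its actual degree at \<open>u\<close> would
    give a relation for \<open>b\<close> of degree below \<open>n\<close> with nonzero leading
    coefficient.\<close>
  have \<rho>u: "\<rho> u = 0"
  proof (rule ccontr)
    assume nz: "\<rho> u \<noteq> 0"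
    define m where "m = degree (\<rho> u)"
    have lc: "coeff (\<rho> u) m \<noteq> 0" using nz by (simp add: m_def)
    then have "m < n" using \<rho>(1) by (auto simp: ppoly_def not_le[symmetric])
    moreover have "poly_cutoff (Suc m) (\<rho> u) = \<rho> u"
      by (intro poly_eqI) (auto simp: coeff_poly_cutoff m_def coeff_eq_0)
    ultimately show False using min[OF _ ppoly_cutoff[OF \<rho>(1)], of m] \<rho>(2) lc by simp
  qed
  have "eventually (\<lambda>t. coeff (\<rho> (\<Gamma> t)) i = 0) germ0" for i
    using \<Gamma> bspec[OF conjunct2[OF \<Gamma>[unfolded lifts_def]] ppoly_coeff[OF \<rho>(1)], of i] \<rho>u by simp
  then have "eventually (\<lambda>t. \<forall>i\<in>{..<n}. coeff (\<rho> (\<Gamma> t)) i = 0) germ0"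
    by (intro eventually_ball_finite) auto
  then show ?thesis
  proof eventually_elim
    case (elim t)
    show ?case
    proof (rule poly_eqI)
      fix i show "coeff (\<rho> (\<Gamma> t)) i = coeff 0 i"
        using elim \<rho>(1) by (cases "i < n") (auto simp: ppoly_def)
    qed
  qed
qed

lemma nearest_root:
  fixes p :: "'a::linordered_field poly"
  assumes "p \<noteq> 0" "poly p r = 0"
  shows "\<exists>x. poly p x = 0 \<and> (\<forall>y. poly p y = 0 \<longrightarrow> \<bar>x - c\<bar> \<le> \<bar>y - c\<bar>)"
proof -
  define S where "S = {x. poly p x = 0}"
  have S: "finite S" "r \<in> S" using poly_roots_finite[OF assms(1)] assms(2) by (auto simp: S_def)
  then have "Min ((\<lambda>x. \<bar>x - c\<bar>) ` S) \<in> (\<lambda>x. \<bar>x - c\<bar>) ` S" by (intro Min_in) auto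
  then obtain x where x: "x \<in> S" "\<bar>x - c\<bar> = Min ((\<lambda>x. \<bar>x - c\<bar>) ` S)" by auto
  have "\<bar>x - c\<bar> \<le> \<bar>y - c\<bar>" if "y \<in> S" for y
    unfolding x(2) using S(1) that by (intro Min_le) auto
  then show ?thesis using x(1) by (auto simp: S_def)
qed

text \<open>In place of an implicit function theorem: at
  \<open>b + t * (\<delta> b + \<epsilon>)\<close> and
  \<open>b + t * (\<delta> b - \<epsilon>)\<close> the polynomial is
  \<open>t * D * \<epsilon>\<close> and its negative up to o(t), with \<open>D\<close> the nonzero
  derivative at \<open>b\<close>. The opposite signs enclose a root.\<close>

lemma root_along_lift:
  fixes u :: "nat \<Rightarrow> 'a::real_closed"
  assumes \<delta>: "is_derivation \<delta>" and \<Gamma>: "lifts \<delta> u \<Gamma>" and \<pi>: "\<pi> \<in> ppoly {} n"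
    and root: "poly (\<pi> u) b = 0" "poly (pderiv (\<pi> u)) b \<noteq> 0" and \<epsilon>: "\<epsilon> > 0"
  shows "eventually (\<lambda>t. \<exists>x. poly (\<pi> (\<Gamma> t)) x = 0 \<and> \<bar>x - (b + t * \<delta> b)\<bar> \<le> \<epsilon> * t) germ0"
proof -
  define D where "D = poly (pderiv (\<pi> u)) b"
  have D: "D \<noteq> 0" using root by (simp add: D_def)
  define \<alpha> where "\<alpha> = (\<lambda>s t. poly (\<pi> (\<Gamma> t)) (b + t * s))"
  have small: "small (\<lambda>t. \<alpha> s t - t * (D * (s - \<delta> b)))" for s
    using tangent_ppoly[OF \<delta> \<Gamma> tangent_linear \<pi>, of b s] root
    by (simp add: \<alpha>_def D_def tangent_def is_derivation_simps[OF \<delta>])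
  have shift: "\<delta> b + \<epsilon> - \<delta> b = \<epsilon>" "\<delta> b - \<epsilon> - \<delta> b = - \<epsilon>" by simp_all
  \<comment> \<open>The error is allowed half the size of the main term, which leaves its sign
    intact.\<close>
  have pos: "\<bar>D\<bar> * \<epsilon> / 2 > 0" using D \<epsilon> by simp
  have "eventually (\<lambda>t. \<bar>\<alpha> (\<delta> b + \<epsilon>) t - t * (D * \<epsilon>)\<bar> \<le> \<bar>D\<bar> * \<epsilon> / 2 * t) germ0"
    "eventually (\<lambda>t. \<bar>\<alpha> (\<delta> b - \<epsilon>) t - t * (D * (- \<epsilon>))\<bar> \<le> \<bar>D\<bar> * \<epsilon> / 2 * t) germ0"
    using smallD[OF small[of "\<delta> b + \<epsilon>"] pos] smallD[OF small[of "\<delta> b - \<epsilon>"] pos]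
    unfolding shift .
  then show ?thesis using eventually_germ0_less[OF zero_less_one]
  proof eventually_elim
    case (elim t)
    define w where "w = t * (D * \<epsilon>)"
    have "\<bar>w\<bar> > 0" using elim D \<epsilon> by (simp add: w_def)
    moreover have "\<bar>D\<bar> * \<epsilon> / 2 * t = \<bar>w\<bar> / 2" using elim \<epsilon> by (simp add: w_def abs_mult mult_ac)
    ultimately have "\<alpha> (\<delta> b - \<epsilon>) t * \<alpha> (\<delta> b + \<epsilon>) t < 0"
      using elim(1,2) unfolding w_def[symmetric] mult_minus_right
      by (cases "w > 0") (auto simp: mult_less_0_iff abs_if split: if_splits)
    moreover have "b + t * (\<delta> b - \<epsilon>) < b + t * (\<delta> b + \<epsilon>)" using elim \<epsilon> by simp
    ultimately obtain x where "b + t * (\<delta> b - \<epsilon>) < x" "x < b + t * (\<delta> b + \<epsilon>)" "poly (\<pi> (\<Gamma> t)) x = 0"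
      unfolding \<alpha>_def using poly_ivt by blast
    then show ?case by (intro exI[of _ x]) (simp add: abs_le_iff algebra_simps)
  qed
qed

lemma lifts_adjoinI:
  assumes "lifts \<delta> u \<Gamma>" "tangent a b (\<delta> b)"
    and "\<And>n \<tau>. \<tau> \<in> ppoly {} n \<Longrightarrow> poly (\<tau> u) b = 0 \<Longrightarrow> eventually (\<lambda>t. poly (\<tau> (\<Gamma> t)) (a t) = 0) germ0"
  shows "lifts \<delta> (case_nat b u) (\<lambda>t. case_nat (a t) (\<Gamma> t))"
  unfolding lifts_def
proof (intro conjI allI ballI impI)
  show "tangent (\<lambda>t. case_nat (a t) (\<Gamma> t) i) (case_nat b u i) (\<delta> (case_nat b u i))" for i
    using assms(1,2) by (cases i) (auto simp: lifts_def)
  show "eventually (\<lambda>t. p (case_nat (a t) (\<Gamma> t)) = 0) germ0" if "p \<in> polyfun {}" "p (case_nat b u) = 0" for p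
    using polyfun_as_ppoly[OF that(1)] that(2) assms(3) by auto
qed

text \<open>If no relation with leading coefficient nonzero at \<open>u\<close> holds for
  \<open>b\<close>, every relation for \<open>b\<close> is trivial at \<open>u\<close> and stays
  trivial along the curve, so the slope is free and the straight line serves. Otherwise a relation
  of least degree prescribes the continuation, and all other relations follow from it by
  pseudo-division.\<close>

lemma lifts_adjoin:
  fixes u :: "nat \<Rightarrow> 'a::real_closed"
  assumes \<delta>: "is_derivation \<delta>" and \<Gamma>: "lifts \<delta> u \<Gamma>"
  shows "\<exists>a. lifts \<delta> (case_nat b u) (\<lambda>t. case_nat (a t) (\<Gamma> t))"
proof (cases "\<exists>n. \<exists>\<pi>\<in>ppoly {} (Suc n). poly (\<pi> u) b = 0 \<and> coeff (\<pi> u) n \<noteq> 0")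
  case False
  have vanish: "eventually (\<lambda>t. poly (\<tau> (\<Gamma> t)) (b + t * \<delta> b) = 0) germ0"
    if "\<tau> \<in> ppoly {} n" "poly (\<tau> u) b = 0" for n \<tau>
  proof -
    have "eventually (\<lambda>t. \<tau> (\<Gamma> t) = 0) germ0"
      by (rule ppoly_vanishes_along_lift[OF \<Gamma> that]) (use False in blast)
    then show ?thesis by eventually_elim simp
  qed
  show ?thesis
    by (rule exI, rule lifts_adjoinI[OF \<Gamma> tangent_linear], rule vanish)
next
  case True
  define n where "n = (LEAST n. \<exists>\<pi>\<in>ppoly {} (Suc n). poly (\<pi> u) b = 0 \<and> coeff (\<pi> u) n \<noteq> 0)"
  obtain \<pi> where \<pi>: "\<pi> \<in> ppoly {} (Suc n)" "poly (\<pi> u) b = 0" "coeff (\<pi> u) n \<noteq> 0"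
    using LeastI_ex[OF True] unfolding n_def by blast
  have min: "coeff (\<tau> u) m = 0" if "m < n" "\<tau> \<in> ppoly {} (Suc m)" "poly (\<tau> u) b = 0" for m \<tau>
    using not_less_Least[OF that(1)[unfolded n_def]] that(2,3) by blast
  have "n \<noteq> 0"
  proof
    assume "n = 0"
    then have "poly (\<pi> u) b = coeff (\<pi> u) 0"
      using poly_ppoly_Suc(1)[of \<pi> "{}" 0 u b] \<pi>(1) ppoly_0[OF ppoly_cutoff[OF \<pi>(1), of 0]] by simp
    then show False using \<pi> \<open>n = 0\<close> by simp
  qed
  then obtain m where m: "n = Suc m" using not0_implies_Suc by blast
  \<comment> \<open>By minimality: the derivative has formal degree \<open>m < n\<close> and its
    leading coefficient is \<open>n\<close> times that of \<open>\<pi>\<close>, hence nonzero at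
    \<open>u\<close>; so it cannot vanish at \<open>b\<close>.\<close>
  have der: "poly (pderiv (\<pi> u)) b \<noteq> 0"
    using min[of m "\<lambda>e. pderiv (\<pi> e)"] ppoly_pderiv[OF \<pi>(1)] \<pi>(3) m
    by (auto simp: coeff_pderiv simp del: of_nat_Suc)
  \<comment> \<open>\<open>root_along_lift\<close> may give a different root for each
    \<open>\<epsilon>\<close>, but one curve has to serve all of them. The nearest root does not
    depend on \<open>\<epsilon>\<close> and is at least as close as any of these.\<close>
  define near where "near = (\<lambda>t x. poly (\<pi> (\<Gamma> t)) x = 0 \<and>
    (\<forall>y. poly (\<pi> (\<Gamma> t)) y = 0 \<longrightarrow> \<bar>x - (b + t * \<delta> b)\<bar> \<le> \<bar>y - (b + t * \<delta> b)\<bar>))"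
  define a where "a = (\<lambda>t. SOME x. near t x)"
  have "eventually (\<lambda>t. sgn (coeff (\<pi> (\<Gamma> t)) n) = sgn (coeff (\<pi> u) n)) germ0"
    using tangent_sgn[OF tangent_polyfun[OF \<delta> \<Gamma> ppoly_coeff[OF \<pi>(1)]]] \<pi>(3) by blast
  then have lc: "eventually (\<lambda>t. coeff (\<pi> (\<Gamma> t)) n \<noteq> 0) germ0"
    by eventually_elim (use \<pi>(3) in \<open>auto simp: sgn_eq_0_iff\<close>)
  have a: "eventually (\<lambda>t. poly (\<pi> (\<Gamma> t)) (a t) = 0 \<and> \<bar>a t - (b + t * \<delta> b)\<bar> \<le> \<epsilon> * t) germ0"
    if "\<epsilon> > 0" for \<epsilon>
    using root_along_lift[OF \<delta> \<Gamma> \<pi>(1,2) der that] lc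
  proof eventually_elim
    case (elim t)
    then obtain x where x: "poly (\<pi> (\<Gamma> t)) x = 0" "\<bar>x - (b + t * \<delta> b)\<bar> \<le> \<epsilon> * t" by blast
    have "\<pi> (\<Gamma> t) \<noteq> 0" using elim by auto
    from nearest_root[OF this x(1), of "b + t * \<delta> b"] have "\<exists>x. near t x" unfolding near_def .
    then have "near t (a t)" unfolding a_def by (rule someI_ex)
    then have "poly (\<pi> (\<Gamma> t)) (a t) = 0" "\<bar>a t - (b + t * \<delta> b)\<bar> \<le> \<bar>x - (b + t * \<delta> b)\<bar>"
      using x(1) unfolding near_def by blast+
    then show ?case using x(2) by simp
  qed
  have tan: "tangent a b (\<delta> b)"
    unfolding tangent_def small_def
  proof (intro allI impI)
    fix \<epsilon> :: 'a assume "\<epsilon> > 0"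
    from a[OF this] show "eventually (\<lambda>t. \<bar>a t - b - t * \<delta> b\<bar> \<le> \<epsilon> * t) germ0"
      by eventually_elim (simp add: algebra_simps)
  qed
  \<comment> \<open>The pseudo-remainder \<open>\<rho>\<close> vanishes at \<open>b\<close>, has
    degree below \<open>n\<close>, and so vanishes identically along the curve. At the root
    \<open>a t\<close> of \<open>\<pi>\<close> only a power of the leading coefficient times
    \<open>\<tau>\<close> remains, and that coefficient stays nonzero.\<close>
  have vanish: "eventually (\<lambda>t. poly (\<tau> (\<Gamma> t)) (a t) = 0) germ0"
    if \<tau>: "\<tau> \<in> ppoly {} k" "poly (\<tau> u) b = 0" for k \<tau>
  proof -
    obtain \<rho> l where \<rho>: "\<rho> \<in> ppoly {} n"
      and l: "\<And>e. \<exists>q. smult (coeff (\<pi> e) n ^ (2 * l)) (\<tau> e) = \<pi> e * q + \<rho> e"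
      using ppoly_pseudo_remainder[OF \<tau>(1) \<pi>(1)] by blast
    obtain q where "smult (coeff (\<pi> u) n ^ (2 * l)) (\<tau> u) = \<pi> u * q + \<rho> u" using l by blast
    from arg_cong[OF this, of "\<lambda>p. poly p b"] have "poly (\<rho> u) b = 0" using \<tau>(2) \<pi>(2) by simp
    then have "eventually (\<lambda>t. \<rho> (\<Gamma> t) = 0) germ0"
      by (rule ppoly_vanishes_along_lift[OF \<Gamma> \<rho>]) (use min in blast)
    then show ?thesis using a[OF zero_less_one] lc
    proof eventually_elim
      case (elim t)
      obtain q where "smult (coeff (\<pi> (\<Gamma> t)) n ^ (2 * l)) (\<tau> (\<Gamma> t)) = \<pi> (\<Gamma> t) * q + \<rho> (\<Gamma> t)" using l by blast
      from arg_cong[OF this, of "\<lambda>p. poly p (a t)"] show ?case using elim by simp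
    qed
  qed
  show ?thesis
    by (rule exI, rule lifts_adjoinI[OF \<Gamma> tan], rule vanish)
qed

text \<open>The padding value must be a constant of every derivation, so that padded coordinates
  lift to constant curves; \<open>0\<close> is one.\<close>

definition env_of :: "'a::zero list \<Rightarrow> nat \<Rightarrow> 'a" where
  "env_of xs i = (if i < length xs then xs ! i else 0)"

lemma env_of_Cons: "env_of (x # xs) = case_nat x (env_of xs)"
  by (auto simp: env_of_def fun_eq_iff split: nat.split)

lemma lifts_list:
  fixes xs :: "'a::real_closed list"
  assumes "is_derivation \<delta>"
  shows "\<exists>\<Gamma>. (\<forall>t. length (\<Gamma> t) = length xs) \<and> lifts \<delta> (env_of xs) (\<lambda>t. env_of (\<Gamma> t))"
proof (induction xs)
  case Nil
  have "lifts \<delta> (env_of []) (\<lambda>t. env_of [])"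
    by (auto simp: lifts_def env_of_def is_derivation_simps[OF assms] tangent_const)
  then show ?case by (intro exI[of _ "\<lambda>t. []"]) simp
next
  case (Cons x xs)
  then obtain \<Gamma> where \<Gamma>: "\<And>t. length (\<Gamma> t) = length xs" "lifts \<delta> (env_of xs) (\<lambda>t. env_of (\<Gamma> t))" by blast
  obtain a where "lifts \<delta> (env_of (x # xs)) (\<lambda>t. env_of (a t # \<Gamma> t))"
    using lifts_adjoin[OF assms \<Gamma>(2)] unfolding env_of_Cons by blast
  then show ?case using \<Gamma>(1) by (intro exI[of _ "\<lambda>t. a t # \<Gamma> t"]) simp
qed

section \<open>Total differentiability\<close>

text \<open>The finite set \<open>Z\<close> of points where membership in \<open>T\<close> may change replaces completeness.\<close>

lemma mean_value_inequality:
  fixes \<psi> :: "'a::linordered_field \<Rightarrow> 'a"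
  assumes Z: "finite Z"
    and T: "\<And>y. a \<le> y \<Longrightarrow> y \<le> b \<Longrightarrow> y \<in> T \<longleftrightarrow> \<bar>\<psi> y - \<psi> a\<bar> \<le> \<epsilon> * (y - a)"
    and const: "\<And>c d. c \<le> d \<Longrightarrow> (\<And>z. z \<in> Z \<Longrightarrow> \<not> (c \<le> z \<and> z \<le> d)) \<Longrightarrow> c \<in> T \<longleftrightarrow> d \<in> T"
    and loc: "\<And>x. a \<le> x \<Longrightarrow> x \<le> b \<Longrightarrow>
      \<exists>\<eta>>0. \<forall>y. a \<le> y \<longrightarrow> y \<le> b \<longrightarrow> \<bar>y - x\<bar> < \<eta> \<longrightarrow> \<bar>\<psi> y - \<psi> x\<bar> \<le> \<epsilon> * \<bar>y - x\<bar>"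
    and ab: "a \<le> b"
  shows "\<bar>\<psi> b - \<psi> a\<bar> \<le> \<epsilon> * (b - a)"
proof (rule ccontr)
  assume "\<not> ?thesis"
  then have bT: "b \<notin> T" using T[of b] ab by simp
  have aT: "a \<in> T" using T[of a] ab by simp
  define W where "W = insert a (insert b {z \<in> Z. a \<le> z \<and> z \<le> b})"
  have W: "finite W" "a \<in> W" "b \<in> W" "\<And>x. x \<in> W \<Longrightarrow> a \<le> x \<and> x \<le> b"
    using Z ab by (auto simp: W_def)
  \<comment> \<open>The nodes by which the inequality has already failed. \<open>w\<close> is the
    first of them and \<open>v\<close> the node before it, so the inequality holds up to
    \<open>v\<close>, and membership in \<open>T\<close> is constant strictly between
    \<open>v\<close> and \<open>w\<close>.\<close>
  define V where "V = {w \<in> W. \<exists>y. a \<le> y \<and> y \<le> w \<and> y \<notin> T}"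
  have V: "finite V" "b \<in> V" using W bT ab by (auto simp: V_def)
  define w where "w = Min V"
  have wV: "w \<in> V" unfolding w_def using V by (intro Min_in) auto
  then have w: "w \<in> W" "a \<le> w" "w \<le> b" using W(4) by (auto simp: V_def)
  have "w \<noteq> a" using wV aT by (auto simp: V_def)
  define U where "U = {v \<in> W. v < w}"
  have "a < w" using w(2) \<open>w \<noteq> a\<close> by simp
  then have U: "finite U" "a \<in> U" using W(1,2) by (auto simp: U_def)
  define v where "v = Max U"
  have "v \<in> U" unfolding v_def using U by (intro Max_in) auto
  then have v: "v \<in> W" "v < w" "a \<le> v" "v \<le> b" using W(4) by (auto simp: U_def)
  have "v \<notin> V" using v(2) Min_le[OF V(1), of v] unfolding w_def by auto
  then have before: "y \<in> T" if "a \<le> y" "y \<le> v" for y using that v(1) by (auto simp: V_def)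
  have gap: "z \<notin> Z" if z: "v < z" "z < w" for z
  proof
    assume "z \<in> Z"
    then have "z \<in> U" using z v w by (auto simp: W_def U_def)
    then show False using z(1) Max_ge[OF U(1)] unfolding v_def by (simp add: leD)
  qed
  have same: "c \<in> T \<longleftrightarrow> d \<in> T" if cd: "v < c" "c \<le> d" "d < w" for c d
    using const[OF cd(2)] gap cd by (meson le_less_trans less_le_trans)
  have bound: "\<bar>\<psi> y - \<psi> a\<bar> \<le> \<epsilon> * (y - a)"
    if "x \<in> T" "a \<le> x" "x \<le> y" "y \<le> b" "\<bar>\<psi> y - \<psi> x\<bar> \<le> \<epsilon> * (y - x)" for x y
  proof -
    have "\<bar>\<psi> x - \<psi> a\<bar> \<le> \<epsilon> * (x - a)" using T[of x] that by simp
    then have "\<bar>\<psi> y - \<psi> a\<bar> \<le> \<epsilon> * (y - x) + \<epsilon> * (x - a)" using that(5) by linarith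
    then show ?thesis by (simp add: algebra_simps)
  qed
  obtain \<eta> where \<eta>: "\<eta> > 0" "\<And>y. a \<le> y \<Longrightarrow> y \<le> b \<Longrightarrow> \<bar>y - v\<bar> < \<eta> \<Longrightarrow> \<bar>\<psi> y - \<psi> v\<bar> \<le> \<epsilon> * \<bar>y - v\<bar>"
    using loc[OF v(3,4)] by blast
  \<comment> \<open>The local bound at \<open>v\<close> extends the inequality to one point
    \<open>c\<close> beyond \<open>v\<close>, hence to the whole open gap. The local bound at
    \<open>w\<close>, used from a point \<open>d\<close> on its left, extends it to
    \<open>w\<close>, contradicting the choice of \<open>w\<close>.\<close>
  obtain c where c: "v < c" "c < min w (v + \<eta>)" using dense[of v "min w (v + \<eta>)"] v(2) \<eta>(1) by auto
  have cT: "c \<in> T"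
    using T[of c] bound[of v c] \<eta>(2)[of c] before[of v] c v w by auto
  have inside: "y \<in> T" if "v < y" "y < w" for y
    using same[of c y] same[of y c] cT c that by (cases "c \<le> y") auto
  obtain \<theta> where \<theta>: "\<theta> > 0" "\<And>y. a \<le> y \<Longrightarrow> y \<le> b \<Longrightarrow> \<bar>y - w\<bar> < \<theta> \<Longrightarrow> \<bar>\<psi> y - \<psi> w\<bar> \<le> \<epsilon> * \<bar>y - w\<bar>"
    using loc[OF w(2,3)] by blast
  obtain d where d: "max v (w - \<theta>) < d" "d < w" using dense[of "max v (w - \<theta>)" w] v(2) \<theta>(1) by auto
  have "\<bar>\<psi> w - \<psi> d\<bar> \<le> \<epsilon> * (w - d)"
    using \<theta>(2)[of d] d v w by (auto simp: abs_minus_commute)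
  then have "w \<in> T" using T[of w] bound[of d w] inside[of d] d v w by auto
  then have "y \<in> T" if "a \<le> y" "y \<le> w" for y
    using that before[of y] inside[of y] by (cases "y \<le> v"; cases "y = w") auto
  then show False using wV by (auto simp: V_def)
qed

section \<open>Partial derivatives and the total differential\<close>

definition cube :: "nat \<Rightarrow> 'a::linordered_field \<Rightarrow> 'a list \<Rightarrow> 'a list set" where
  "cube n \<eta> u = {v. length v = n \<and> (\<forall>i<n. \<bar>v ! i - u ! i\<bar> < \<eta>)}"

definition partial_at :: "'a::linordered_field list set \<Rightarrow> ('a list \<Rightarrow> 'a) \<Rightarrow> nat \<Rightarrow> 'a list \<Rightarrow> 'a \<Rightarrow> bool" where
  "partial_at U f i v d \<longleftrightarrow> (\<forall>\<epsilon>>0. \<exists>\<eta>>0. \<forall>h. h \<noteq> 0 \<longrightarrow> \<bar>h\<bar> < \<eta> \<longrightarrow> v[i := v ! i + h] \<in> U \<longrightarrow>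
     \<bar>f (v[i := v ! i + h]) - f v - d * h\<bar> < \<epsilon> * \<bar>h\<bar>)"

lemma partial_at_unique:
  fixes f :: "'a::linordered_field list \<Rightarrow> 'a"
  assumes "partial_at U f i u d" "partial_at U f i u d'" "cube n \<eta> u \<subseteq> U" "\<eta> > 0" "length u = n" "i < n"
  shows "d = d'"
proof (rule ccontr)
  assume "d \<noteq> d'"
  then have \<epsilon>: "\<bar>d - d'\<bar> / 2 > 0" by simp
  obtain \<alpha> where \<alpha>: "\<alpha> > 0" "\<And>h. h \<noteq> 0 \<Longrightarrow> \<bar>h\<bar> < \<alpha> \<Longrightarrow> u[i := u ! i + h] \<in> U \<Longrightarrow>
      \<bar>f (u[i := u ! i + h]) - f u - d * h\<bar> < \<bar>d - d'\<bar> / 2 * \<bar>h\<bar>"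
    using assms(1)[unfolded partial_at_def, rule_format, OF \<epsilon>] by blast
  obtain \<beta> where \<beta>: "\<beta> > 0" "\<And>h. h \<noteq> 0 \<Longrightarrow> \<bar>h\<bar> < \<beta> \<Longrightarrow> u[i := u ! i + h] \<in> U \<Longrightarrow>
      \<bar>f (u[i := u ! i + h]) - f u - d' * h\<bar> < \<bar>d - d'\<bar> / 2 * \<bar>h\<bar>"
    using assms(2)[unfolded partial_at_def, rule_format, OF \<epsilon>] by blast
  obtain h where h: "0 < h" "h < min \<eta> (min \<alpha> \<beta>)"
    using dense[of 0 "min \<eta> (min \<alpha> \<beta>)"] assms(4) \<alpha>(1) \<beta>(1) by auto
  have "u[i := u ! i + h] \<in> cube n \<eta> u" using h assms(4-6) by (auto simp: cube_def nth_list_update)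
  then have U: "u[i := u ! i + h] \<in> U" using assms(3) by blast
  define w where "w = f (u[i := u ! i + h]) - f u"
  have "\<bar>w - d * h\<bar> < \<bar>d - d'\<bar> / 2 * h" "\<bar>w - d' * h\<bar> < \<bar>d - d'\<bar> / 2 * h"
    using \<alpha>(2)[OF _ _ U] \<beta>(2)[OF _ _ U] h unfolding w_def by auto
  then have "\<bar>d * h - d' * h\<bar> < \<bar>d - d'\<bar> / 2 * h + \<bar>d - d'\<bar> / 2 * h" by linarith
  moreover have "\<bar>d * h - d' * h\<bar> = \<bar>d - d'\<bar> * h" using h by (simp add: abs_mult flip: left_diff_distrib)
  ultimately show False by simp
qed

text \<open>The value of \<open>f\<close> is coordinate \<open>n\<close>. Since \<open>f\<close> is
  arbitrary off \<open>U\<close>, membership in \<open>U\<close> is part of the condition.\<close>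

definition graph_semialg ::
  "'a::linordered_field set \<Rightarrow> nat \<Rightarrow> 'a list set \<Rightarrow> ('a list \<Rightarrow> 'a) \<Rightarrow> bool" where
  "graph_semialg K n U f \<longleftrightarrow> (\<exists>G. semialg K G \<and>
     (\<forall>v y. length v = n \<longrightarrow> G (env_of (v @ [y])) \<longleftrightarrow> v \<in> U \<and> y = f v))"

text \<open>Subtracting \<open>c * x\<close> leaves a function \<open>\<psi>\<close> whose
  derivative is below \<open>\<epsilon>\<close> in absolute value. The inequality to be shown is a
  semialgebraic condition on the moving coordinate, with \<open>v\<close>, \<open>a\<close>,
  \<open>c\<close>, \<open>\<epsilon>\<close> and \<open>\<psi> a\<close> as parameters; it
  therefore changes only finitely often, as \<open>mean_value_inequality\<close> requires.\<close>

lemma coordinate_mean_value: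
  fixes f :: "'a::real_closed list \<Rightarrow> 'a"
  assumes G: "semialg UNIV G" "\<And>v y. length v = n \<Longrightarrow> G (env_of (v @ [y])) \<longleftrightarrow> v \<in> U \<and> y = f v"
    and v: "length v = n" "i < n" and ab: "a \<le> b"
    and inU: "\<And>x. a \<le> x \<Longrightarrow> x \<le> b \<Longrightarrow> v[i := x] \<in> U"
    and D: "\<And>x. a \<le> x \<Longrightarrow> x \<le> b \<Longrightarrow> partial_at U f i (v[i := x]) (D x) \<and> \<bar>D x - c\<bar> < \<epsilon>"
  shows "\<bar>f (v[i := b]) - f (v[i := a]) - c * (b - a)\<bar> \<le> \<epsilon> * (b - a)"
proof -
  define \<psi> where "\<psi> = (\<lambda>x. f (v[i := x]) - c * x)"
  \<comment> \<open>\<open>e 1\<close> is the moving coordinate, placed at position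
    \<open>i\<close>, and \<open>e 0\<close> the value of \<open>f\<close>, placed at position
    \<open>n\<close>. The value comes first because it is quantified away in
    \<open>F\<close>.\<close>
  define \<sigma> where "\<sigma> = (\<lambda>(e :: nat \<Rightarrow> 'a) j. if j = i then e 1 else if j = n then e 0 else env_of v j)"
  define F where "F = (\<lambda>e :: nat \<Rightarrow> 'a. \<exists>z. G (\<sigma> (case_nat z e)) \<and>
    \<not> \<epsilon> * (e 0 - a) < z - c * e 0 - \<psi> a \<and> \<not> z - c * e 0 - \<psi> a < - (\<epsilon> * (e 0 - a)))"
  have cst: "(\<lambda>e. d) \<in> polyfun UNIV" for d :: 'a by (rule polyfun_const) simp
  have "semialg UNIV (\<lambda>e. G (\<sigma> e) \<and> \<not> \<epsilon> * (e 1 - a) < e 0 - c * e 1 - \<psi> a \<and>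
      \<not> e 0 - c * e 1 - \<psi> a < - (\<epsilon> * (e 1 - a)))"
    by (intro semialg_conj semialg_not semialg_less semialg_subst[OF G(1)])
      (auto simp: \<sigma>_def intro!: polyfun_If polyfun_var cst polyfun_diff polyfun_mult polyfun_uminus)
  from semialg_ex[OF this] have "semialg UNIV F" by (simp add: F_def)
  from semialg_locally_constant[OF this, of "\<lambda>_. 0"] obtain Z where Z: "finite Z"
    "\<forall>c d. c \<le> d \<longrightarrow> (\<forall>z\<in>Z. \<not> (c \<le> z \<and> z \<le> d)) \<longrightarrow>
      F (case_nat c (\<lambda>_. 0)) = F (case_nat d (\<lambda>_. 0))"
    by (elim exE conjE)
  have \<sigma>: "\<sigma> (case_nat z (case_nat y e)) = env_of (v[i := y] @ [z])" for z y e
    using v by (auto simp: \<sigma>_def env_of_def fun_eq_iff nth_append)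
  have F: "F (case_nat y (\<lambda>_. 0)) \<longleftrightarrow> \<bar>\<psi> y - \<psi> a\<bar> \<le> \<epsilon> * (y - a)" if "a \<le> y" "y \<le> b" for y
    unfolding F_def \<sigma> using G(2)[of "v[i := y]"] inU[OF that] v(1)
    by (auto simp: \<psi>_def abs_le_iff not_less)
  have "\<bar>\<psi> b - \<psi> a\<bar> \<le> \<epsilon> * (b - a)"
  proof (rule mean_value_inequality[where T = "{y. F (case_nat y (\<lambda>_. 0))}", OF Z(1) _ _ _ ab])
    show "y \<in> {y. F (case_nat y (\<lambda>_. 0))} \<longleftrightarrow> \<bar>\<psi> y - \<psi> a\<bar> \<le> \<epsilon> * (y - a)" if "a \<le> y" "y \<le> b" for y
      using F[OF that] by simp
    show "p \<in> {y. F (case_nat y (\<lambda>_. 0))} \<longleftrightarrow> q \<in> {y. F (case_nat y (\<lambda>_. 0))}"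
      if "p \<le> q" "\<And>z. z \<in> Z \<Longrightarrow> \<not> (p \<le> z \<and> z \<le> q)" for p q
      using Z(2)[rule_format, OF that(1)] that(2) by simp
    fix x assume x: "a \<le> x" "x \<le> b"
    \<comment> \<open>The slack left by the strict bound on \<open>D x - c\<close>. Derivative error
      \<open>\<epsilon>'\<close> plus deviation of the slope add up to exactly
      \<open>\<epsilon>\<close>.\<close>
    define \<epsilon>' where "\<epsilon>' = \<epsilon> - \<bar>D x - c\<bar>"
    have "\<epsilon>' > 0" using D[OF x] by (simp add: \<epsilon>'_def)
    then obtain \<eta> where \<eta>: "\<eta> > 0" "\<And>h. h \<noteq> 0 \<Longrightarrow> \<bar>h\<bar> < \<eta> \<Longrightarrow> v[i := x + h] \<in> U \<Longrightarrow>
        \<bar>f (v[i := x + h]) - f (v[i := x]) - D x * h\<bar> < \<epsilon>' * \<bar>h\<bar>"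
      using D[OF x] v unfolding partial_at_def by auto
    have "\<bar>\<psi> y - \<psi> x\<bar> \<le> \<epsilon> * \<bar>y - x\<bar>" if y: "a \<le> y" "y \<le> b" "\<bar>y - x\<bar> < \<eta>" for y
    proof (cases "y = x")
      case False
      then have "\<bar>f (v[i := y]) - f (v[i := x]) - D x * (y - x)\<bar> < \<epsilon>' * \<bar>y - x\<bar>"
        using \<eta>(2)[of "y - x"] y inU by simp
      moreover have "\<bar>(D x - c) * (y - x)\<bar> = \<bar>D x - c\<bar> * \<bar>y - x\<bar>" by (rule abs_mult)
      moreover have "\<psi> y - \<psi> x = (f (v[i := y]) - f (v[i := x]) - D x * (y - x)) + (D x - c) * (y - x)"
        by (simp add: \<psi>_def algebra_simps)
      ultimately have "\<bar>\<psi> y - \<psi> x\<bar> \<le> \<epsilon>' * \<bar>y - x\<bar> + \<bar>D x - c\<bar> * \<bar>y - x\<bar>" by linarith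
      then show ?thesis by (simp add: \<epsilon>'_def algebra_simps)
    qed simp
    then show "\<exists>\<eta>>0. \<forall>y. a \<le> y \<longrightarrow> y \<le> b \<longrightarrow> \<bar>y - x\<bar> < \<eta> \<longrightarrow> \<bar>\<psi> y - \<psi> x\<bar> \<le> \<epsilon> * \<bar>y - x\<bar>"
      using \<eta>(1) by blast
  qed
  then show ?thesis by (simp add: \<psi>_def algebra_simps)
qed

text \<open>A walk from \<open>u\<close> to \<open>v\<close> that changes one coordinate at a time:
  the hybrid point \<open>w k\<close> has its first \<open>k\<close> coordinates from
  \<open>v\<close>. All intermediate points stay in the cube, and the one-coordinate estimates
  telescope.\<close>

lemma total_differential:
  fixes f :: "'a::real_closed list \<Rightarrow> 'a"
  assumes graph: "graph_semialg UNIV n U f" and u: "length u = n"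
    and \<eta>: "cube n \<eta> u \<subseteq> U"
    and D: "\<And>i v. i < n \<Longrightarrow> v \<in> cube n \<eta> u \<Longrightarrow> partial_at U f i v (D i v) \<and> \<bar>D i v - D i u\<bar> < \<epsilon>"
    and v: "v \<in> cube n \<eta> u"
  shows "\<bar>f v - f u - (\<Sum>i<n. D i u * (v ! i - u ! i))\<bar> \<le> \<epsilon> * (\<Sum>i<n. \<bar>v ! i - u ! i\<bar>)"
proof -
  obtain G where G: "semialg UNIV G" "\<And>v y. length v = n \<Longrightarrow> G (env_of (v @ [y])) \<longleftrightarrow> v \<in> U \<and> y = f v"
    using graph unfolding graph_semialg_def by blast
  have lv: "length v = n" using v by (simp add: cube_def)
  define w where "w = (\<lambda>k. take k v @ drop k u)"
  have lw: "length (w k) = n" if "k \<le> n" for k using that lv u by (simp add: w_def)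
  have nth_w: "w k ! i = (if i < k then v ! i else u ! i)" if "k \<le> n" "i < n" for k i
    using that lv u by (simp add: w_def nth_append)
  have near: "\<bar>v ! i - u ! i\<bar> < \<eta>" if "i < n" for i using v that by (simp add: cube_def)
  have step: "\<bar>f (w (Suc k)) - f (w k) - D k u * (v ! k - u ! k)\<bar> \<le> \<epsilon> * \<bar>v ! k - u ! k\<bar>" if k: "k < n" for k
  proof -
    define a where "a = min (u ! k) (v ! k)"
    define b where "b = max (u ! k) (v ! k)"
    have ab: "a \<le> b" by (simp add: a_def b_def)
    have eta: "\<eta> > 0" using near[OF k] by (meson abs_ge_zero le_less_trans)
    have inC: "(w k)[k := x] \<in> cube n \<eta> u" if x: "a \<le> x" "x \<le> b" for x
    proof -
      have "\<bar>x - u ! k\<bar> < \<eta>" using x near[OF k] by (auto simp: a_def b_def min_def max_def abs_less_iff split: if_splits)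
      then show ?thesis using k near eta lw[of k] nth_w[of k] by (auto simp: cube_def nth_list_update)
    qed
    have main: "\<bar>f ((w k)[k := b]) - f ((w k)[k := a]) - D k u * (b - a)\<bar> \<le> \<epsilon> * (b - a)"
      by (rule coordinate_mean_value[where D = "\<lambda>x. D k ((w k)[k := x])", OF G lw _ ab])
        (use k inC \<eta> D in auto)
    have upd: "(w k)[k := u ! k] = w k" "(w k)[k := v ! k] = w (Suc k)"
      using k lw[of k] lw[of "Suc k"] nth_w by (auto intro!: nth_equalityI simp: nth_list_update less_Suc_eq)
    show ?thesis
    proof (cases "u ! k \<le> v ! k")
      case True
      then show ?thesis using main by (simp add: a_def b_def upd)
    next
      case False
      then have "\<bar>f (w k) - f (w (Suc k)) - D k u * (u ! k - v ! k)\<bar> \<le> \<epsilon> * (u ! k - v ! k)"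
        using main by (simp add: a_def b_def upd)
      moreover have "f (w (Suc k)) - f (w k) - D k u * (v ! k - u ! k) =
        - (f (w k) - f (w (Suc k)) - D k u * (u ! k - v ! k))" by (simp add: algebra_simps)
      ultimately show ?thesis using False by (simp only: abs_minus_cancel) simp
    qed
  qed
  have "\<bar>f (w k) - f u - (\<Sum>i<k. D i u * (v ! i - u ! i))\<bar> \<le> \<epsilon> * (\<Sum>i<k. \<bar>v ! i - u ! i\<bar>)" if "k \<le> n" for k
    using that
  proof (induction k)
    case (Suc k)
    then show ?case using step[of k] by (simp add: distrib_left)
  qed (simp add: w_def)
  from this[of n] show ?thesis using lv u by (simp add: w_def)
qed

theorem derivation_chain_rule:
  fixes f :: "'a::real_closed list \<Rightarrow> 'a"
  assumes \<delta>: "is_derivation \<delta>" and graph: "graph_semialg {} n U f"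
    and u: "u \<in> U" "length u = n" and op: "\<exists>\<eta>>0. cube n \<eta> u \<subseteq> U"
    and D: "\<And>i v. i < n \<Longrightarrow> v \<in> U \<Longrightarrow> partial_at U f i v (D i v)"
    and cont: "\<And>i \<epsilon>. i < n \<Longrightarrow> \<epsilon> > 0 \<Longrightarrow> \<exists>\<eta>>0. \<forall>v\<in>U \<inter> cube n \<eta> u. \<bar>D i v - D i u\<bar> < \<epsilon>"
  shows "\<delta> (f u) = (\<Sum>i<n. D i u * \<delta> (u ! i))"
proof -
  obtain G where G: "semialg {} G" "\<And>v y. length v = n \<Longrightarrow> G (env_of (v @ [y])) \<longleftrightarrow> v \<in> U \<and> y = f v"
    using graph unfolding graph_semialg_def by blast
  have graph': "graph_semialg UNIV n U f"
    unfolding graph_semialg_def using semialg_mono[OF G(1), of UNIV] G(2) by blast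
  \<comment> \<open>The value \<open>f u\<close> is lifted together with \<open>u\<close>, so that
    the formula for the graph speaks about a single curve.\<close>
  obtain \<Gamma> where \<Gamma>: "\<And>t. length (\<Gamma> t) = Suc n" "lifts \<delta> (env_of (u @ [f u])) (\<lambda>t. env_of (\<Gamma> t))"
    using lifts_list[OF \<delta>, of "u @ [f u]"] u(2) by auto
  define v where "v = (\<lambda>t. take n (\<Gamma> t))"
  define y where "y = (\<lambda>t. \<Gamma> t ! n)"
  have split: "\<Gamma> t = v t @ [y t]" for t
    using \<Gamma>(1)[of t] by (simp add: v_def y_def flip: take_Suc_conv_app_nth)
  have lv: "length (v t) = n" for t using \<Gamma>(1) by (simp add: v_def)
  have tang: "tangent (\<lambda>t. env_of (\<Gamma> t) i) (env_of (u @ [f u]) i) (\<delta> (env_of (u @ [f u]) i))" for i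
    using \<Gamma>(2) by (simp add: lifts_def)
  have tv: "tangent (\<lambda>t. v t ! i) (u ! i) (\<delta> (u ! i))" if "i < n" for i
    using tang[of i] that u(2) \<Gamma>(1) by (simp add: env_of_def v_def nth_append)
  have ty: "tangent y (f u) (\<delta> (f u))"
    using tang[of n] u(2) \<Gamma>(1) by (simp add: env_of_def y_def nth_append)
  have "G (env_of (u @ [f u]))" using G(2) u by simp
  then have on_graph: "eventually (\<lambda>t. v t \<in> U \<and> y t = f (v t)) germ0"
    using semialg_lifts[OF \<delta> \<Gamma>(2) G(1)] by (simp add: split G(2) lv)
  define E where "E = (\<lambda>t. f (v t) - f u - (\<Sum>i<n. D i u * (v t ! i - u ! i)))"
  have "small E"
    unfolding small_def
  proof (intro allI impI)
    fix \<epsilon> :: 'a assume \<epsilon>: "\<epsilon> > 0"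
    \<comment> \<open>For small \<open>t\<close> the increments of the coordinates sum to at most
      \<open>t * (S - 1)\<close>. The final \<open>1\<close> keeps \<open>S\<close> positive even
      for \<open>n = 0\<close>.\<close>
    define S where "S = (\<Sum>i<n. \<bar>\<delta> (u ! i)\<bar> + 1) + 1"
    have S: "S > 0" unfolding S_def by (intro add_nonneg_pos sum_nonneg) auto
    define \<epsilon>' where "\<epsilon>' = \<epsilon> / S"
    have \<epsilon>': "\<epsilon>' > 0" using \<epsilon> S by (simp add: \<epsilon>'_def)
    have "\<exists>\<eta>. \<forall>i<n. \<eta> i > 0 \<and> (\<forall>v\<in>U \<inter> cube n (\<eta> i) u. \<bar>D i v - D i u\<bar> < \<epsilon>')"
      using cont[OF _ \<epsilon>'] by metis
    then obtain \<eta>1 where \<eta>1: "\<And>i. i < n \<Longrightarrow> \<eta>1 i > 0"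
      "\<And>i v. i < n \<Longrightarrow> v \<in> U \<Longrightarrow> v \<in> cube n (\<eta>1 i) u \<Longrightarrow> \<bar>D i v - D i u\<bar> < \<epsilon>'" by blast
    obtain \<eta>0 where \<eta>0: "\<eta>0 > 0" "cube n \<eta>0 u \<subseteq> U" using op by blast
    define \<eta> where "\<eta> = Min (insert \<eta>0 (\<eta>1 ` {..<n}))"
    have \<eta>: "\<eta> > 0" "\<eta> \<le> \<eta>0" "\<And>i. i < n \<Longrightarrow> \<eta> \<le> \<eta>1 i" using \<eta>0(1) \<eta>1(1) by (auto simp: \<eta>_def)
    have cube_mono: "w \<in> cube n \<beta> u" if "w \<in> cube n \<alpha> u" "\<alpha> \<le> \<beta>" for w \<alpha> \<beta>
      using that by (auto simp: cube_def intro: less_le_trans)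
    have sub: "cube n \<eta> u \<subseteq> U" using cube_mono[OF _ \<eta>(2)] \<eta>0(2) by blast
    have diff: "\<bar>f w - f u - (\<Sum>i<n. D i u * (w ! i - u ! i))\<bar> \<le> \<epsilon>' * (\<Sum>i<n. \<bar>w ! i - u ! i\<bar>)"
      if "w \<in> cube n \<eta> u" for w
      by (rule total_differential[OF graph' u(2) sub _ that])
        (use sub D \<eta>1(2) cube_mono[OF _ \<eta>(3)] in blast)
    have "eventually (\<lambda>t. \<forall>i\<in>{..<n}. \<bar>v t ! i - u ! i\<bar> < \<eta>) germ0"
      "eventually (\<lambda>t. \<forall>i\<in>{..<n}. \<bar>v t ! i - u ! i\<bar> \<le> t * (\<bar>\<delta> (u ! i)\<bar> + 1)) germ0"
      using tangent_continuous[OF tv \<eta>(1)] tangent_lipschitz[OF tv] by (auto intro!: eventually_ball_finite)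
    then show "eventually (\<lambda>t. \<bar>E t\<bar> \<le> \<epsilon> * t) germ0" using eventually_germ0_less[OF zero_less_one]
    proof eventually_elim
      case (elim t)
      have "v t \<in> cube n \<eta> u" using elim(1) lv by (simp add: cube_def)
      then have "\<bar>E t\<bar> \<le> \<epsilon>' * (\<Sum>i<n. \<bar>v t ! i - u ! i\<bar>)" unfolding E_def by (rule diff)
      also have "\<dots> \<le> \<epsilon>' * (\<Sum>i<n. t * (\<bar>\<delta> (u ! i)\<bar> + 1))"
        using elim(2) \<epsilon>' by (intro mult_left_mono sum_mono) auto
      also have "(\<Sum>i<n. t * (\<bar>\<delta> (u ! i)\<bar> + 1)) = t * (S - 1)"
        by (simp only: S_def sum_distrib_left add_diff_cancel)
      also have "\<epsilon>' * (t * (S - 1)) \<le> \<epsilon>' * (t * S)"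
        using elim(3) \<epsilon>' by (intro mult_left_mono) auto
      also have "\<dots> = \<epsilon> * t" using S by (simp add: \<epsilon>'_def)
      finally show ?case .
    qed
  qed
  \<comment> \<open>The expansions of \<open>f\<close> at \<open>u\<close>, of \<open>y\<close> and
    of the coordinates are combined so that, as soon as \<open>y t = f (v t)\<close>, every term
    depending on the curve cancels and only a multiple of \<open>t\<close> is left.\<close>
  have "small (\<lambda>t. (E t - (y t - f u - t * \<delta> (f u))) +
      (\<Sum>i<n. D i u * (v t ! i - u ! i - t * \<delta> (u ! i))))"
    using tv[unfolded tangent_def]
    by (intro small_add[OF small_diff[OF \<open>small E\<close> ty[unfolded tangent_def]]] small_sum small_cmult) simp
  then have "small (\<lambda>t. t * (\<delta> (f u) - (\<Sum>i<n. D i u * \<delta> (u ! i))))"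
    unfolding small_def
  proof (intro allI impI)
    fix \<epsilon> :: 'a assume *: "\<forall>\<epsilon>>0. eventually (\<lambda>t. \<bar>(E t - (y t - f u - t * \<delta> (f u))) +
      (\<Sum>i<n. D i u * (v t ! i - u ! i - t * \<delta> (u ! i)))\<bar> \<le> \<epsilon> * t) germ0" and "\<epsilon> > 0"
    from *[rule_format, OF \<open>\<epsilon> > 0\<close>] on_graph
    show "eventually (\<lambda>t. \<bar>t * (\<delta> (f u) - (\<Sum>i<n. D i u * \<delta> (u ! i)))\<bar> \<le> \<epsilon> * t) germ0"
    proof eventually_elim
      case (elim t)
      have "(E t - (y t - f u - t * \<delta> (f u))) + (\<Sum>i<n. D i u * (v t ! i - u ! i - t * \<delta> (u ! i)))
        = t * (\<delta> (f u) - (\<Sum>i<n. D i u * \<delta> (u ! i)))"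
        using elim(2) by (simp add: E_def right_diff_distrib sum_subtractf sum_distrib_left mult_ac)
      then show ?case using elim(1) by simp
    qed
  qed
  then show ?thesis unfolding small_linear_iff by simp
qed

section \<open>Isomorphisms of structures and o-minimality\<close>

lemma trm_val_cong:
  assumes "\<And>i. i \<in> trm_vars t \<Longrightarrow> e i = e' i"
  shows "trm_val M e t = trm_val M e' t"
  using assms
proof (induction t)
  case (App s ts)
  have "trm_val M e t = trm_val M e' t" if "t \<in> set ts" for t
    by (rule App.IH[OF that]) (use App.prems that in auto)
  then have "map (trm_val M e) ts = map (trm_val M e') ts" by simp
  then show ?case by (simp only: trm_val.simps)
qed simp

lemma sat_cong:
  assumes "\<And>i. i \<in> free_vars \<phi> \<Longrightarrow> e i = e' i"
  shows "sat M e \<phi> = sat M e' \<phi>"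
  using assms
proof (induction \<phi> arbitrary: e e')
  case (Equal s t)
  then show ?case using trm_val_cong[of s e e' M] trm_val_cong[of t e e' M] by simp
next
  case (Pred r ts)
  then have "map (trm_val M e) ts = map (trm_val M e') ts"
    by (auto intro!: trm_val_cong)
  then show ?case by (simp only: sat.simps)
next
  case (Exists \<phi>)
  have "sat M (case_nat x e) \<phi> = sat M (case_nat x e') \<phi>" for x
    by (rule Exists.IH) (use Exists.prems in \<open>auto split: nat.split\<close>)
  then show ?case by (simp only: sat.simps)
next
  case (Neg \<phi>)
  have "sat M e \<phi> = sat M e' \<phi>" by (rule Neg.IH) (rule Neg.prems, simp)
  then show ?case by (simp only: sat.simps)
next
  case (Conj \<phi> \<psi>)
  have "sat M e \<phi> = sat M e' \<phi>" by (rule Conj.IH(1)) (rule Conj.prems, simp)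
  moreover have "sat M e \<psi> = sat M e' \<psi>" by (rule Conj.IH(2)) (rule Conj.prems, simp)
  ultimately show ?case by (simp only: sat.simps)
qed

definition struct_iso ::
  "('f, 'r) language \<Rightarrow> ('a \<Rightarrow> 'b) \<Rightarrow> ('f, 'r, 'a) fo_struct \<Rightarrow> ('f, 'r, 'b) fo_struct \<Rightarrow> bool" where
  "struct_iso L h M N \<longleftrightarrow> structure_for L M \<and> bij_betw h (univ M) (univ N) \<and>
     (\<forall>s n. fun_arity L s = Some n \<longrightarrow>
        (\<forall>xs\<in>tuples M n. fun_int N s (map h xs) = h (fun_int M s xs))) \<and>
     (\<forall>r n. rel_arity L r = Some n \<longrightarrow>
        (\<forall>xs\<in>tuples M n. rel_int N r (map h xs) \<longleftrightarrow> rel_int M r xs))"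

lemma struct_isoD:
  assumes "struct_iso L h M N"
  shows "structure_for L M" "bij_betw h (univ M) (univ N)"
    and "fun_arity L s = Some n \<Longrightarrow> xs \<in> tuples M n \<Longrightarrow> fun_int N s (map h xs) = h (fun_int M s xs)"
    and "rel_arity L r = Some n \<Longrightarrow> xs \<in> tuples M n \<Longrightarrow> rel_int N r (map h xs) \<longleftrightarrow> rel_int M r xs"
  using assms unfolding struct_iso_def by blast+

lemma trm_val_closed:
  assumes "structure_for L M" "trm_of L t" "range e \<subseteq> univ M"
  shows "trm_val M e t \<in> univ M"
  using assms(2)
proof (induction t)
  case (App s ts)
  then have "map (trm_val M e) ts \<in> tuples M (length ts)" by (auto simp: tuples_def)
  then show ?case using App.prems assms(1) unfolding structure_for_def by (auto simp: Pi_iff)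
qed (use assms(3) in auto)

lemma trm_val_iso:
  assumes iso: "struct_iso L h M N" and "trm_of L t" and e: "range e \<subseteq> univ M"
  shows "trm_val N (\<lambda>i. h (e i)) t = h (trm_val M e t)"
  using assms(2)
proof (induction t)
  case (App s ts)
  have "structure_for L M" using iso by (simp add: struct_iso_def)
  then have "map (trm_val M e) ts \<in> tuples M (length ts)"
    using App.prems e by (auto simp: tuples_def intro: trm_val_closed)
  then have "fun_int N s (map h (map (trm_val M e) ts)) = h (fun_int M s (map (trm_val M e) ts))"
    by (rule struct_isoD(3)[OF iso, rotated]) (use App.prems in simp)
  moreover have "map (trm_val N (\<lambda>i. h (e i))) ts = map h (map (trm_val M e) ts)"
    using App by auto
  ultimately show ?case by (simp only: trm_val.simps)
qed simp

lemma sat_iso: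
  assumes iso: "struct_iso L h M N" and "form_of L \<phi>" and "range e \<subseteq> univ M"
  shows "sat N (\<lambda>i. h (e i)) \<phi> = sat M e \<phi>"
  using assms(2,3)
proof (induction \<phi> arbitrary: e)
  case (Equal s t)
  have "inj_on h (univ M)" "structure_for L M" using iso by (auto simp: struct_iso_def bij_betw_def)
  then show ?case
    using Equal trm_val_iso[OF iso] trm_val_closed[of L M] by (auto simp: inj_on_eq_iff)
next
  case (Pred r ts)
  have "structure_for L M" using iso by (simp add: struct_iso_def)
  then have "map (trm_val M e) ts \<in> tuples M (length ts)"
    using Pred.prems by (auto simp: tuples_def intro: trm_val_closed)
  then have "rel_int N r (map h (map (trm_val M e) ts)) = rel_int M r (map (trm_val M e) ts)"
    by (rule struct_isoD(4)[OF iso, rotated]) (use Pred.prems in simp)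
  moreover have "map (trm_val N (\<lambda>i. h (e i))) ts = map h (map (trm_val M e) ts)"
    using Pred.prems trm_val_iso[OF iso] by auto
  ultimately show ?case by (simp only: sat.simps)
next
  case (Exists \<phi>)
  have "sat N (case_nat (h x) (\<lambda>i. h (e i))) \<phi> = sat M (case_nat x e) \<phi>" if "x \<in> univ M" for x
  proof -
    have "case_nat x e i \<in> univ M" for i using Exists.prems(2) that by (cases i) auto
    then have "range (case_nat x e) \<subseteq> univ M" by blast
    moreover have "(\<lambda>i. h (case_nat x e i)) = case_nat (h x) (\<lambda>i. h (e i))" by (auto split: nat.split)
    ultimately show ?thesis using Exists.IH[of "case_nat x e"] Exists.prems(1) by simp
  qed
  moreover have "univ N = h ` univ M" using iso by (simp add: struct_iso_def bij_betw_def)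
  ultimately show ?case by auto
qed auto

lemma holds_iso:
  assumes iso: "struct_iso L h M N" and "form_of L \<phi>"
  shows "holds N \<phi> \<longleftrightarrow> holds M \<phi>"
proof
  assume N: "holds N \<phi>"
  show "holds M \<phi>" unfolding holds_def
  proof (intro allI impI)
    fix e :: "nat \<Rightarrow> _" assume e: "range e \<subseteq> univ M"
    then have "range (\<lambda>i. h (e i)) \<subseteq> univ N" using iso by (auto simp: struct_iso_def bij_betw_def)
    then show "sat M e \<phi>" using N sat_iso[OF iso assms(2) e] by (simp add: holds_def)
  qed
next
  assume M: "holds M \<phi>"
  show "holds N \<phi>" unfolding holds_def
  proof (intro allI impI)
    fix e :: "nat \<Rightarrow> _" assume e: "range e \<subseteq> univ N"
    define e' where "e' = (\<lambda>i. inv_into (univ M) h (e i))"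
    have im: "h ` univ M = univ N" using iso by (simp add: struct_iso_def bij_betw_def)
    have "range e' \<subseteq> univ M" using e im by (auto simp: e'_def intro!: inv_into_into)
    moreover have "h (e' i) = e i" for i unfolding e'_def using e im by (intro f_inv_into_f) auto
    then have "(\<lambda>i. h (e' i)) = e" by simp
    ultimately show "sat N e \<phi>" using sat_iso[OF iso assms(2), of e'] M by (simp add: holds_def)
  qed
qed

lemma struct_iso_sym:
  assumes iso: "struct_iso L h M N" and N: "structure_for L N"
  shows "struct_iso L (inv_into (univ M) h) N M"
proof -
  define g where "g = inv_into (univ M) h"
  have M: "structure_for L M" and h: "bij_betw h (univ M) (univ N)" using struct_isoD(1,2)[OF iso] .
  have g: "bij_betw g (univ N) (univ M)" using h by (simp add: g_def bij_betw_inv_into)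
  have gh: "g (h x) = x" if "x \<in> univ M" for x using h that by (simp add: g_def bij_betw_inv_into_left)
  have hg: "h (g y) = y" if "y \<in> univ N" for y using h that by (simp add: g_def bij_betw_inv_into_right)
  have tup: "map g ys \<in> tuples M n" "map h (map g ys) = ys" if "ys \<in> tuples N n" for ys n
  proof -
    have "set ys \<subseteq> univ N" "length ys = n" using that by (auto simp: tuples_def)
    then show "map g ys \<in> tuples M n" "map h (map g ys) = ys"
      using bij_betwE[OF g] hg by (auto simp: tuples_def intro!: map_idI)
  qed
  have "fun_int M s (map g ys) = g (fun_int N s ys)" if "fun_arity L s = Some n" "ys \<in> tuples N n" for s n ys
  proof -
    have "fun_int N s ys = h (fun_int M s (map g ys))"
      using struct_isoD(3)[OF iso that(1) tup(1)[OF that(2)]] tup(2)[OF that(2)] by simp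
    moreover have "fun_int M s \<in> tuples M n \<rightarrow> univ M" using M that(1) by (simp add: structure_for_def)
    then have "fun_int M s (map g ys) \<in> univ M" using tup(1)[OF that(2)] by (rule funcset_mem)
    ultimately show ?thesis by (simp add: gh)
  qed
  moreover have "rel_int M r (map g ys) \<longleftrightarrow> rel_int N r ys" if "rel_arity L r = Some n" "ys \<in> tuples N n" for r n ys
    using struct_isoD(4)[OF iso that(1) tup(1)[OF that(2)]] tup(2)[OF that(2)] by simp
  ultimately show ?thesis using N g unfolding struct_iso_def g_def by blast
qed

lemma struct_iso_trans:
  assumes h: "struct_iso L h M N" and k: "struct_iso L k N P"
  shows "struct_iso L (\<lambda>x. k (h x)) M P"
proof -
  have M: "structure_for L M" and bij: "bij_betw h (univ M) (univ N)" using struct_isoD(1,2)[OF h] .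
  have tup: "map h xs \<in> tuples N n" if "xs \<in> tuples M n" for xs n
    using that bij_betwE[OF bij] by (auto simp: tuples_def)
  have map: "map (\<lambda>x. k (h x)) xs = map k (map h xs)" for xs by simp
  have "bij_betw (\<lambda>x. k (h x)) (univ M) (univ P)"
    using bij_betw_trans[OF bij struct_isoD(2)[OF k]] by (simp add: comp_def)
  then show ?thesis
    unfolding struct_iso_def map
    using M struct_isoD(3)[OF h] struct_isoD(4)[OF h] struct_isoD(3)[OF k] struct_isoD(4)[OF k] tup by metis
qed

lemma structure_for_sublanguage:
  "extends_language L0 L \<Longrightarrow> structure_for L M \<Longrightarrow> structure_for L0 M"
  unfolding structure_for_def extends_language_def map_le_def by (metis domI)

lemma struct_iso_sublanguage:
  assumes "extends_language L0 L" "struct_iso L h M N"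
  shows "struct_iso L0 h M N"
  using assms structure_for_sublanguage[OF assms(1)]
  unfolding struct_iso_def extends_language_def map_le_def by (metis domI)

text \<open>Moves a structure into a larger type. The properties of theories are stated for
  structures on one fixed type, and the chosen structure also lives on a sum type.\<close>

definition copy_struct :: "('a \<Rightarrow> 'b) \<Rightarrow> ('f, 'r, 'a) fo_struct \<Rightarrow> ('f, 'r, 'b) fo_struct" where
  "copy_struct f M = \<lparr>univ = f ` univ M, fun_int = (\<lambda>s xs. f (fun_int M s (map (inv_into UNIV f) xs))),
     rel_int = (\<lambda>r xs. rel_int M r (map (inv_into UNIV f) xs))\<rparr>"

lemma struct_iso_copy:
  assumes "inj f" "structure_for L M"
  shows "struct_iso L f M (copy_struct f M)" "structure_for L (copy_struct f M)"
proof -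
  have inv: "map (inv_into UNIV f) (map f xs) = xs" for xs using assms(1) by (simp add: map_idI)
  show "struct_iso L f M (copy_struct f M)"
    using assms inv unfolding struct_iso_def copy_struct_def
    by (auto simp: bij_betw_def inj_on_def inj_def simp del: map_map)
  show "structure_for L (copy_struct f M)"
    using assms unfolding structure_for_def copy_struct_def
    by (auto simp: Pi_iff tuples_def inj_def image_subset_iff subset_image_iff)
qed

text \<open>The weak supremum of the axiom \<open>poly_cut\<close>, for a relation on a set.
  Approximation is demanded only of \<open>y\<close> that have some \<open>z\<close> between them
  and \<open>s\<close>, so the right end of an interval qualifies even without density.\<close>

definition cut_of :: "('a \<Rightarrow> 'a \<Rightarrow> bool) \<Rightarrow> 'a set \<Rightarrow> 'a set \<Rightarrow> 'a \<Rightarrow> bool" where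
  "cut_of R A S s \<longleftrightarrow> s \<in> A \<and> (\<forall>x\<in>S. \<not> R s x) \<and>
     (\<forall>y\<in>A. \<forall>z\<in>A. R y z \<longrightarrow> R z s \<longrightarrow> (\<exists>x\<in>S. R y x))"

text \<open>The larger of two cuts bounds both sets, and its own set already approximates
  it.\<close>

lemma cut_of_Un:
  assumes R: "transp_on A R" and s: "cut_of R A I s" "cut_of R A J t" and st: "R s t \<or> s = t"
    and sub: "I \<subseteq> A"
  shows "cut_of R A (I \<union> J) t"
proof -
  have mem: "s \<in> A" "t \<in> A" using s by (simp_all add: cut_of_def)
  have "\<not> R t x" if "x \<in> I" for x
  proof
    assume "R t x"
    then have "R s x" using st transp_onD[OF R mem, of x] that sub by blast
    then show False using s(1) that by (simp add: cut_of_def)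
  qed
  then show ?thesis using s(2) unfolding cut_of_def by blast
qed

lemma cut_of_Union:
  assumes R: "transp_on A R" "totalp_on A R"
    and F: "finite F" "\<And>I. I \<in> F \<Longrightarrow> I \<noteq> {} \<Longrightarrow> \<exists>s. cut_of R A I s" "\<And>I. I \<in> F \<Longrightarrow> I \<subseteq> A" "\<Union>F \<noteq> {}"
  shows "\<exists>s. cut_of R A (\<Union>F) s"
  using F
proof (induction F rule: finite_induct)
  case (insert I F)
  show ?case
  proof (cases "I = {} \<or> \<Union>F = {}")
    case True
    then show ?thesis
    proof
      assume "I = {}"
      then show ?thesis using insert by simp
    next
      assume F: "\<Union>F = {}"
      then have "I \<noteq> {}" using insert.prems(3) by auto
      then show ?thesis using F insert.prems(1)[of I] by (simp only: Union_insert Un_empty_right insertI1) blast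
    qed
  next
    case False
    then obtain s1 s2 where s: "cut_of R A I s1" "cut_of R A (\<Union>F) s2" using insert by (meson insertCI)
    have sub: "I \<subseteq> A" "\<Union>F \<subseteq> A" using insert.prems(2) by auto
    have mem: "s1 \<in> A" "s2 \<in> A" using s by (auto simp: cut_of_def)
    have "R s1 s2 \<or> s1 = s2 \<or> R s2 s1" using R(2) mem unfolding totalp_on_def by blast
    then consider "R s1 s2 \<or> s1 = s2" | "R s2 s1" by blast
    then show ?thesis
    proof cases
      case 1
      from cut_of_Un[OF R(1) s 1 sub(1)] show ?thesis by auto
    next
      case 2
      from cut_of_Un[OF R(1) s(2,1) disjI1[OF 2] sub(2)] show ?thesis by (auto simp: Un_commute)
    qed
  qed
qed simp

text \<open>The cut of a point is the point, that of a nonempty interval its right endpoint; the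
  finitely many pieces then combine.\<close>

lemma o_minimal_cut:
  assumes om: "o_minimal L M" and S: "definable_with_parameters L M S" "S \<noteq> {}"
    and b: "b \<in> univ M" "\<And>x. x \<in> S \<Longrightarrow> less_in M x b"
  shows "\<exists>s. cut_of (less_in M) (univ M) S s"
proof -
  have R: "irreflp_on (univ M) (less_in M)" "transp_on (univ M) (less_in M)" "totalp_on (univ M) (less_in M)"
    using om by (auto simp: o_minimal_def)
  obtain F where F: "finite F" "\<And>I. I \<in> F \<Longrightarrow> point_or_interval M I" "S = \<Union>F"
    using om S(1) unfolding o_minimal_def by blast
  have sub: "I \<subseteq> univ M" if "I \<in> F" for I
    using F(2)[OF that] by (auto simp: point_or_interval_def open_interval_def)
  have "\<exists>s. cut_of (less_in M) (univ M) I s" if I: "I \<in> F" "I \<noteq> {}" for I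
  proof -
    obtain x0 where x0: "x0 \<in> I" "x0 \<in> univ M" using I sub by blast
    from F(2)[OF I(1)] consider (point) a where "a \<in> univ M" "I = {a}"
      | (interval) l r where "set_option l \<subseteq> univ M" "set_option r \<subseteq> univ M" "I = open_interval M l r"
      unfolding point_or_interval_def by blast
    then show ?thesis
    proof cases
      case point
      then have "cut_of (less_in M) (univ M) I a"
        using R(1,2) unfolding cut_of_def by (auto dest: irreflp_onD transp_onD)
      then show ?thesis ..
    next
      case interval
      have l: "less_in M a x0" if "a \<in> set_option l" for a using x0 that interval(3) by (auto simp: open_interval_def)
      show ?thesis
      proof (cases r)
        \<comment> \<open>An interval unbounded to the right would contain the bound
          \<open>b\<close> itself, which is strictly above every element of
          \<open>S\<close>.\<close>
        case None
        have "less_in M x0 b" using x0 b(2) I F(3) by blast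
        then have "less_in M a b" if "a \<in> set_option l" for a
          using l[OF that] that interval(1) x0 b(1) R(2) by (meson subsetD transp_onD)
        then have "b \<in> I" using interval(3) None b(1) by (auto simp: open_interval_def)
        then have "b \<in> S" using I(1) F(3) by blast
        then show ?thesis using b R(1) by (meson irreflp_onD)
      next
        case (Some r0)
        have r0: "r0 \<in> univ M" using interval Some by auto
        have "cut_of (less_in M) (univ M) I r0"
          unfolding cut_of_def
        proof (intro conjI ballI impI)
          fix x assume "x \<in> I"
          then have "x \<in> univ M" "less_in M x r0" using interval Some by (auto simp: open_interval_def)
          then show "\<not> less_in M r0 x" using r0 R by (meson irreflp_onD transp_onD)
        next
          fix y z assume yz: "y \<in> univ M" "z \<in> univ M" "less_in M y z" "less_in M z r0"
          show "\<exists>x\<in>I. less_in M y x"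
          proof (cases "\<forall>a\<in>set_option l. less_in M a z")
            case True
            then have "z \<in> I" using interval(3) Some yz by (auto simp: open_interval_def)
            then show ?thesis using yz by blast
          next
            case False
            \<comment> \<open>Here \<open>z\<close> lies at or left of the left endpoint, so the
              known element \<open>x0\<close> of the interval is above \<open>z\<close> and hence
              above \<open>y\<close>.\<close>
            then obtain a where a: "a \<in> set_option l" "a \<in> univ M" "\<not> less_in M a z" using interval(1) by blast
            then have "z = a \<or> less_in M z a" using R(3) yz unfolding totalp_on_def by blast
            then have "less_in M z x0" using l[OF a(1)] a(2) yz x0 R(2) by (meson transp_onD)
            then show ?thesis using yz x0 R(2) by (meson transp_onD)
          qed
        qed (rule r0)
        then show ?thesis ..
      qed
    qed
  qed
  then show ?thesis using cut_of_Union[OF R(2,3) F(1)] sub S(2) F(3) by simp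
qed

section \<open>Real closed structures\<close>

lemma oring_arity [simp]:
  "fun_arity oring_language Zero_sym = Some 0" "fun_arity oring_language One_sym = Some 0"
  "fun_arity oring_language Plus_sym = Some 2" "fun_arity oring_language Minus_sym = Some 1"
  "fun_arity oring_language Times_sym = Some 2" "fun_arity oring_language (Extra_fun s) = None"
  "rel_arity oring_language Less_sym = Some 2" "rel_arity oring_language (Extra_rel r) = None"
  by (simp_all add: oring_language_def)

lemma extends_oring_arity:
  assumes "extends_language oring_language L"
  shows "fun_arity L Zero_sym = Some 0" "fun_arity L One_sym = Some 0"
    "fun_arity L Plus_sym = Some 2" "fun_arity L Minus_sym = Some 1"
    "fun_arity L Times_sym = Some 2" "rel_arity L Less_sym = Some 2"
  using assms unfolding extends_language_def map_le_def by (auto simp: dom_def dest!: bspec)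

abbreviation plus_in :: "('f ofun, 'r, 'a) fo_struct \<Rightarrow> 'a \<Rightarrow> 'a \<Rightarrow> 'a" where
  "plus_in M x y \<equiv> fun_int M Plus_sym [x, y]"

abbreviation times_in :: "('f ofun, 'r, 'a) fo_struct \<Rightarrow> 'a \<Rightarrow> 'a \<Rightarrow> 'a" where
  "times_in M x y \<equiv> fun_int M Times_sym [x, y]"

abbreviation minus_in :: "('f ofun, 'r, 'a) fo_struct \<Rightarrow> 'a \<Rightarrow> 'a" where
  "minus_in M x \<equiv> fun_int M Minus_sym [x]"

abbreviation zero_in :: "('f ofun, 'r, 'a) fo_struct \<Rightarrow> 'a" where
  "zero_in M \<equiv> fun_int M Zero_sym []"

abbreviation one_in :: "('f ofun, 'r, 'a) fo_struct \<Rightarrow> 'a" where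
  "one_in M \<equiv> fun_int M One_sym []"

definition horner :: "('f ofun, 'r, 'a) fo_struct \<Rightarrow> 'a list \<Rightarrow> 'a \<Rightarrow> 'a" where
  "horner M cs x = foldr (\<lambda>c y. plus_in M c (times_in M x y)) cs (zero_in M)"

definition negative_below :: "('f ofun, 'r orel, 'a) fo_struct \<Rightarrow> 'a list \<Rightarrow> 'a \<Rightarrow> 'a set" where
  "negative_below M cs b = {x \<in> univ M. less_in M x b \<and> less_in M (horner M cs x) (zero_in M)}"

text \<open>The class \<open>real_closed\<close> relativised to a universe. It mentions only the
  language of ordered rings, hence passes between isomorphic structures even where o-minimality is
  known for one of them only.\<close>

definition rc_struct :: "('f ofun, 'r orel, 'a) fo_struct \<Rightarrow> bool" where
  "rc_struct M \<longleftrightarrow> structure_for oring_language M \<and> (\<forall>\<sigma>\<in>ordered_field_axioms. holds M \<sigma>) \<and>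
     (\<forall>cs b. set cs \<subseteq> univ M \<longrightarrow> b \<in> univ M \<longrightarrow> negative_below M cs b \<noteq> {} \<longrightarrow>
        (\<exists>s. cut_of (less_in M) (univ M) (negative_below M cs b) s))"

lemma rc_structD:
  assumes "rc_struct M"
  shows "structure_for oring_language M" "\<forall>\<sigma>\<in>ordered_field_axioms. holds M \<sigma>"
    "set cs \<subseteq> univ M \<Longrightarrow> b \<in> univ M \<Longrightarrow> negative_below M cs b \<noteq> {} \<Longrightarrow>
      \<exists>s. cut_of (less_in M) (univ M) (negative_below M cs b) s"
  using assms unfolding rc_struct_def by blast+

lemma structure_oring_closed:
  fixes M :: "('f ofun, 'r orel, 'a) fo_struct"
  assumes "structure_for oring_language M"
  shows "zero_in M \<in> univ M" "one_in M \<in> univ M"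
    and "x \<in> univ M \<Longrightarrow> y \<in> univ M \<Longrightarrow> plus_in M x y \<in> univ M"
    and "x \<in> univ M \<Longrightarrow> y \<in> univ M \<Longrightarrow> times_in M x y \<in> univ M"
    and "x \<in> univ M \<Longrightarrow> minus_in M x \<in> univ M"
proof -
  have *: "fun_int M s xs \<in> univ M" if "fun_arity (oring_language :: ('f ofun, 'r orel) language) s = Some n" "xs \<in> tuples M n" for s n xs
  proof -
    have "fun_int M s \<in> tuples M n \<rightarrow> univ M" using assms that(1) by (simp add: structure_for_def)
    then show ?thesis using that(2) by (rule funcset_mem)
  qed
  show "zero_in M \<in> univ M" by (rule *[of _ 0]) (auto simp: tuples_def)
  show "one_in M \<in> univ M" by (rule *[of _ 0]) (auto simp: tuples_def)
  show "plus_in M x y \<in> univ M" if "x \<in> univ M" "y \<in> univ M"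
    by (rule *[of _ 2]) (use that in \<open>auto simp: tuples_def\<close>)
  show "times_in M x y \<in> univ M" if "x \<in> univ M" "y \<in> univ M"
    by (rule *[of _ 2]) (use that in \<open>auto simp: tuples_def\<close>)
  show "minus_in M x \<in> univ M" if "x \<in> univ M"
    by (rule *[of _ 1]) (use that in \<open>auto simp: tuples_def\<close>)
qed

lemma horner_closed:
  "structure_for oring_language M \<Longrightarrow> set cs \<subseteq> univ M \<Longrightarrow> x \<in> univ M \<Longrightarrow> horner M cs x \<in> univ M"
  by (induction cs) (auto simp: horner_def structure_oring_closed)

lemma holds_ordered_field_axioms:
  assumes M: "structure_for oring_language M" and ax: "\<forall>\<sigma>\<in>ordered_field_axioms. holds M \<sigma>"
  shows "\<forall>x\<in>univ M. \<forall>y\<in>univ M. \<forall>z\<in>univ M. plus_in M (plus_in M x y) z = plus_in M x (plus_in M y z)"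
    "\<forall>x\<in>univ M. \<forall>y\<in>univ M. plus_in M x y = plus_in M y x"
    "\<forall>x\<in>univ M. plus_in M x (zero_in M) = x"
    "\<forall>x\<in>univ M. plus_in M x (minus_in M x) = zero_in M"
    "\<forall>x\<in>univ M. \<forall>y\<in>univ M. \<forall>z\<in>univ M. times_in M (times_in M x y) z = times_in M x (times_in M y z)"
    "\<forall>x\<in>univ M. \<forall>y\<in>univ M. times_in M x y = times_in M y x"
    "\<forall>x\<in>univ M. times_in M x (one_in M) = x"
    "\<forall>x\<in>univ M. \<forall>y\<in>univ M. \<forall>z\<in>univ M.
      times_in M x (plus_in M y z) = plus_in M (times_in M x y) (times_in M x z)"
    "zero_in M \<noteq> one_in M"
    "\<forall>x\<in>univ M. x \<noteq> zero_in M \<longrightarrow> (\<exists>y\<in>univ M. times_in M x y = one_in M)"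
    "\<forall>x\<in>univ M. \<not> less_in M x x"
    "\<forall>x\<in>univ M. \<forall>y\<in>univ M. \<forall>z\<in>univ M. less_in M x y \<longrightarrow> less_in M y z \<longrightarrow> less_in M x z"
    "\<forall>x\<in>univ M. \<forall>y\<in>univ M. less_in M x y \<or> x = y \<or> less_in M y x"
    "\<forall>x\<in>univ M. \<forall>y\<in>univ M. \<forall>z\<in>univ M. less_in M x y \<longrightarrow> less_in M (plus_in M x z) (plus_in M y z)"
    "\<forall>x\<in>univ M. \<forall>y\<in>univ M. less_in M (zero_in M) x \<longrightarrow> less_in M (zero_in M) y \<longrightarrow>
      less_in M (zero_in M) (times_in M x y)"
proof -
  have *: "\<forall>\<sigma>\<in>ordered_field_axioms. sat M (\<lambda>_. zero_in M) \<sigma>"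
    using ax structure_oring_closed(1)[OF M] by (auto simp: holds_def)
  note * = *[unfolded ordered_field_axioms_def Let_def, simplified, unfolded numeral_2_eq_2, simplified]
  show "\<forall>x\<in>univ M. \<forall>y\<in>univ M. \<forall>z\<in>univ M. plus_in M (plus_in M x y) z = plus_in M x (plus_in M y z)"
    "\<forall>x\<in>univ M. \<forall>y\<in>univ M. plus_in M x y = plus_in M y x"
    "\<forall>x\<in>univ M. plus_in M x (zero_in M) = x"
    "\<forall>x\<in>univ M. plus_in M x (minus_in M x) = zero_in M"
    "\<forall>x\<in>univ M. \<forall>y\<in>univ M. \<forall>z\<in>univ M. times_in M (times_in M x y) z = times_in M x (times_in M y z)"
    "\<forall>x\<in>univ M. \<forall>y\<in>univ M. times_in M x y = times_in M y x"
    "\<forall>x\<in>univ M. times_in M x (one_in M) = x"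
    "\<forall>x\<in>univ M. \<forall>y\<in>univ M. \<forall>z\<in>univ M.
      times_in M x (plus_in M y z) = plus_in M (times_in M x y) (times_in M x z)"
    "zero_in M \<noteq> one_in M"
    "\<forall>x\<in>univ M. x \<noteq> zero_in M \<longrightarrow> (\<exists>y\<in>univ M. times_in M x y = one_in M)"
    "\<forall>x\<in>univ M. \<not> less_in M x x"
    "\<forall>x\<in>univ M. \<forall>y\<in>univ M. \<forall>z\<in>univ M. less_in M x y \<longrightarrow> less_in M y z \<longrightarrow> less_in M x z"
    "\<forall>x\<in>univ M. \<forall>y\<in>univ M. less_in M x y \<or> x = y \<or> less_in M y x"
    "\<forall>x\<in>univ M. \<forall>y\<in>univ M. \<forall>z\<in>univ M. less_in M x y \<longrightarrow> less_in M (plus_in M x z) (plus_in M y z)"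
    "\<forall>x\<in>univ M. \<forall>y\<in>univ M. less_in M (zero_in M) x \<longrightarrow> less_in M (zero_in M) y \<longrightarrow>
      less_in M (zero_in M) (times_in M x y)"
    using * by meson+
qed

lemma horner_iso:
  assumes iso: "struct_iso oring_language h M N" and "set cs \<subseteq> univ M" "x \<in> univ M"
  shows "horner N (map h cs) (h x) = h (horner M cs x)"
  using assms(2)
proof (induction cs)
  case Nil
  show ?case using struct_isoD(3)[OF iso, of Zero_sym 0 "[]"] by (simp add: horner_def tuples_def)
next
  case (Cons c cs)
  have M: "structure_for oring_language M" using struct_isoD(1)[OF iso] .
  have "horner M cs x \<in> univ M" using horner_closed[OF M] Cons.prems assms(3) by simp
  moreover from this have "times_in M x (horner M cs x) \<in> univ M" using structure_oring_closed(4)[OF M assms(3)] by simp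
  ultimately show ?case
    using Cons struct_isoD(3)[OF iso, of Plus_sym 2 "[c, times_in M x (horner M cs x)]"]
      struct_isoD(3)[OF iso, of Times_sym 2 "[x, horner M cs x]"] assms(3)
    by (simp add: horner_def tuples_def)
qed

lemma less_iso:
  assumes "struct_iso oring_language h M N" "x \<in> univ M" "y \<in> univ M"
  shows "less_in N (h x) (h y) \<longleftrightarrow> less_in M x y"
  using struct_isoD(4)[OF assms(1), of Less_sym 2 "[x, y]"] assms(2,3) by (simp add: tuples_def)

lemma ordered_field_axioms_form: "\<sigma> \<in> ordered_field_axioms \<Longrightarrow> form_of oring_language \<sigma>"
  unfolding ordered_field_axioms_def Let_def by auto

lemma rc_struct_iso:
  assumes iso: "struct_iso oring_language h M N" and N: "structure_for oring_language N" and M: "rc_struct M"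
  shows "rc_struct N"
  unfolding rc_struct_def
proof (intro conjI ballI allI impI)
  show "holds N \<sigma>" if "\<sigma> \<in> ordered_field_axioms" for \<sigma>
    using M that holds_iso[OF iso ordered_field_axioms_form[OF that]] by (simp add: rc_struct_def)
  have im: "univ N = h ` univ M" using struct_isoD(2)[OF iso] by (simp add: bij_betw_def)
  fix cs' b' assume cs': "set cs' \<subseteq> univ N" and b': "b' \<in> univ N" and ne: "negative_below N cs' b' \<noteq> {}"
  obtain b where b: "b \<in> univ M" "b' = h b" using b' im by auto
  have "cs' \<in> map h ` lists (univ M)" using cs' im by (simp add: lists_image[symmetric] in_lists_conv_set subset_iff)
  then obtain cs where cs: "set cs \<subseteq> univ M" "cs' = map h cs" by auto
  have zero: "zero_in N = h (zero_in M)" using struct_isoD(3)[OF iso, of Zero_sym 0 "[]"] by (simp add: tuples_def)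
  have closed: "zero_in M \<in> univ M" "\<And>x. x \<in> univ M \<Longrightarrow> horner M cs x \<in> univ M"
    using structure_oring_closed(1) horner_closed[OF _ cs(1)] struct_isoD(1)[OF iso] by auto
  have S: "negative_below N cs' b' = h ` negative_below M cs b"
    unfolding negative_below_def im b cs(2) zero
    using horner_iso[OF iso cs(1)] less_iso[OF iso] b(1) closed by auto
  obtain s where s: "cut_of (less_in M) (univ M) (negative_below M cs b) s"
    using M cs(1) b(1) ne S unfolding rc_struct_def by blast
  have sub: "negative_below M cs b \<subseteq> univ M" by (auto simp: negative_below_def)
  have "cut_of (less_in N) (univ N) (negative_below N cs' b') (h s)"
    using s sub less_iso[OF iso] unfolding cut_of_def S im by (auto simp: subset_iff)
  then show "\<exists>s. cut_of (less_in N) (univ N) (negative_below N cs' b') s" ..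
qed (rule N)

primrec horner_trm :: "nat \<Rightarrow> nat \<Rightarrow> 'f ofun trm" where
  "horner_trm k 0 = zero_trm"
| "horner_trm k (Suc n) = plus_trm (Var k) (times_trm (Var 0) (horner_trm (Suc k) n))"

lemma trm_val_horner_trm:
  assumes "\<And>i. i < length cs \<Longrightarrow> e (k + i) = cs ! i"
  shows "trm_val M e (horner_trm k (length cs)) = horner M cs (e 0)"
  using assms
proof (induction cs arbitrary: k)
  case (Cons c cs)
  have "e (Suc k + i) = cs ! i" if "i < length cs" for i using Cons.prems[of "Suc i"] that by simp
  from Cons.IH[OF this] Cons.prems[of 0] show ?case by (simp add: horner_def)
qed (simp add: horner_def)

lemma definable_negative_below:
  assumes ext: "extends_language oring_language L" and cs: "set cs \<subseteq> univ M" and b: "b \<in> univ M"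
  shows "definable_with_parameters L M (negative_below M cs b)"
proof -
  \<comment> \<open>Variable \<open>1\<close> evaluates to \<open>b\<close> and the coefficients
    start at variable \<open>2\<close>. Past the list \<open>b\<close> is repeated, since every
    parameter must lie in the universe.\<close>
  define p where "p = (\<lambda>i. if i < length (b # cs) then (b # cs) ! i else b)"
  have t: "trm_of L (horner_trm k n)" for k n
    by (induction n arbitrary: k) (simp_all add: extends_oring_arity[OF ext])
  have "range p \<subseteq> univ M" using cs b by (auto simp: p_def nth_Cons subset_iff split: nat.split)
  moreover have "trm_val M (case_nat x p) (horner_trm (Suc (Suc 0)) (length cs)) = horner M cs x" for x
    using trm_val_horner_trm[of cs "case_nat x p" "Suc (Suc 0)" M] by (simp add: p_def)
  then have "negative_below M cs b = {x \<in> univ M. sat M (case_nat x p)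
      (Conj (less_form (Var 0) (Var (Suc 0))) (less_form (horner_trm (Suc (Suc 0)) (length cs)) zero_trm))}"
    by (simp add: negative_below_def p_def)
  moreover have "form_of L (Conj (less_form (Var 0) (Var (Suc 0)))
      (less_form (horner_trm (Suc (Suc 0)) (length cs)) zero_trm))"
    using t by (simp add: extends_oring_arity[OF ext])
  ultimately show ?thesis unfolding definable_with_parameters_def by blast
qed

lemma rc_struct_of_o_minimal:
  assumes ext: "extends_language oring_language L" and M: "structure_for L M"
    and ax: "\<And>\<sigma>. \<sigma> \<in> ordered_field_axioms \<Longrightarrow> holds M \<sigma>" and om: "o_minimal L M"
  shows "rc_struct M"
  unfolding rc_struct_def
proof (intro conjI allI impI ballI)
  show "structure_for oring_language M" using structure_for_sublanguage[OF ext M] .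
  show "holds M \<sigma>" if "\<sigma> \<in> ordered_field_axioms" for \<sigma> using ax that .
  show "\<exists>s. cut_of (less_in M) (univ M) (negative_below M cs b) s"
    if "set cs \<subseteq> univ M" "b \<in> univ M" "negative_below M cs b \<noteq> {}" for cs b
    by (rule o_minimal_cut[OF om definable_negative_below[OF ext that(1,2)] that(3,2)])
      (simp add: negative_below_def)
qed

text \<open>Values at symbols outside the language of ordered rings are arbitrary defaults.\<close>

definition field_struct :: "('f ofun, 'r orel, 'a::linordered_field) fo_struct" where
  "field_struct = \<lparr>univ = UNIV,
     fun_int = (\<lambda>s xs. case s of Zero_sym \<Rightarrow> 0 | One_sym \<Rightarrow> 1 | Plus_sym \<Rightarrow> xs ! 0 + xs ! 1
       | Minus_sym \<Rightarrow> - xs ! 0 | Times_sym \<Rightarrow> xs ! 0 * xs ! 1 | Extra_fun _ \<Rightarrow> 0),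
     rel_int = (\<lambda>r xs. xs ! 0 < xs ! 1)\<rparr>"

text \<open>Supplies the default structure that makes the later type definition and its class
  instance unconditional. Cuts are ordinary suprema.\<close>

lemma rc_struct_field_struct_real: "rc_struct (field_struct :: ('f ofun, 'r orel, real) fo_struct)"
  (is "rc_struct ?R")
  unfolding rc_struct_def
proof (intro conjI ballI allI impI)
  show "structure_for oring_language ?R" by (auto simp: structure_for_def field_struct_def)
  have unit: "x = 0" if "\<forall>y. x * y \<noteq> 1" for x :: real
    using that[rule_format, of "inverse x"] by (cases "x = 0") simp_all
  show "holds ?R \<sigma>" if "\<sigma> \<in> ordered_field_axioms" for \<sigma>
    using that unfolding ordered_field_axioms_def Let_def
    by (auto simp: holds_def field_struct_def numeral_2_eq_2 distrib_left) (rule unit, blast)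
  fix cs and b :: real
  define S where "S = negative_below ?R cs b"
  assume "negative_below ?R cs b \<noteq> {}"
  have "bdd_above S" by (auto simp: S_def negative_below_def field_struct_def intro!: bdd_aboveI[of _ b])
  moreover have "S \<noteq> {}" using \<open>negative_below ?R cs b \<noteq> {}\<close> by (simp add: S_def)
  ultimately have "cut_of (less_in ?R) (univ ?R) S (Sup S)"
    unfolding cut_of_def field_struct_def
    by (auto simp: not_less less_cSup_iff[symmetric] intro: cSup_upper less_trans)
  then show "\<exists>s. cut_of (less_in ?R) (univ ?R) (negative_below ?R cs b) s"
    unfolding S_def by blast
qed

section \<open>Structures isomorphic to a type\<close>

lemma polyfun_trm_val:
  assumes "trm_of (oring_language :: ('f ofun, 'r orel) language) t"
  shows "(\<lambda>e. trm_val (field_struct :: ('f ofun, 'r orel, 'a::linordered_field) fo_struct) e t) \<in> polyfun {}"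
  using assms
proof (induction t)
  case (Var i)
  show ?case by (simp add: polyfun_var)
next
  case (App s ts)
  consider "s = Zero_sym" | "s = One_sym" | a b where "s = Plus_sym" "ts = [a, b]"
    | a where "s = Minus_sym" "ts = [a]" | a b where "s = Times_sym" "ts = [a, b]"
    using App.prems by (cases s) (auto simp: numeral_2_eq_2 Suc_length_conv length_Suc_conv)
  then show ?case
    by cases (use App in \<open>auto simp: field_struct_def intro!: polyfun.intros\<close>)
qed

text \<open>Atomic formulas compare integer polynomials, and \<open>semialg_ex\<close> removes the
  quantifier. No parameters occur, so the result holds with \<open>K = {}\<close>, as lifting to
  curves requires.\<close>

lemma semialg_sat:
  assumes "form_of (oring_language :: ('f ofun, 'r orel) language) \<phi>"
  shows "semialg {} (\<lambda>e. sat (field_struct :: ('f ofun, 'r orel, 'a::real_closed) fo_struct) e \<phi>)"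
  using assms
proof (induction \<phi>)
  case (Equal s t)
  then show ?case by (auto intro!: semialg_eq polyfun_trm_val)
next
  case (Pred r ts)
  then obtain a b where "r = Less_sym" "ts = [a, b]"
    by (cases r) (auto simp: numeral_2_eq_2 Suc_length_conv length_Suc_conv)
  moreover from this have "semialg {} (\<lambda>e. trm_val (field_struct :: ('f ofun, 'r orel, 'a) fo_struct) e a <
      trm_val (field_struct :: ('f ofun, 'r orel, 'a) fo_struct) e b)"
    using Pred.prems by (intro semialg_less polyfun_trm_val) auto
  ultimately show ?case by (simp add: field_struct_def)
next
  case (Neg \<phi>)
  then show ?case using semialg_not by simp
next
  case (Conj \<phi> \<psi>)
  then show ?case using semialg_conj by simp
next
  case (Exists \<phi>)
  then show ?case using semialg_ex by (simp add: field_struct_def)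
qed

text \<open>The bridge between the analysis on a type and a structure on a set: every notion about
  \<open>M\<close> is pulled back along \<open>h\<close> to the type \<open>'b\<close>.\<close>

locale field_iso =
  fixes h :: "'b::real_closed \<Rightarrow> 'a" and M :: "('f ofun, 'r orel, 'a) fo_struct"
  assumes iso: "struct_iso (oring_language :: ('f ofun, 'r orel) language) h field_struct M"
begin

abbreviation "R \<equiv> ring_of M"

lemma univ_range: "univ M = range h"
  using struct_isoD(2)[OF iso] by (simp add: bij_betw_def field_struct_def)

lemma h_univ [simp]: "h x \<in> univ M"
  by (simp add: univ_range)

lemma h_eq [simp]: "h x = h y \<longleftrightarrow> x = y"
  using struct_isoD(2)[OF iso] by (simp add: bij_betw_def field_struct_def inj_eq)

lemma fun_rel [simp]:
  "zero_in M = h 0" "one_in M = h 1" "plus_in M (h x) (h y) = h (x + y)" "times_in M (h x) (h y) = h (x * y)"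
  "less_in M (h x) (h y) \<longleftrightarrow> x < y"
  using struct_isoD(3)[OF iso, of Zero_sym 0 "[]"] struct_isoD(3)[OF iso, of One_sym 0 "[]"]
    struct_isoD(3)[OF iso, of Plus_sym 2 "[x, y]"] struct_isoD(3)[OF iso, of Times_sym 2 "[x, y]"]
    struct_isoD(4)[OF iso, of Less_sym 2 "[x, y]"]
  by (simp_all add: tuples_def field_struct_def)

lemma ring_of_simps [simp]:
  "carrier R = range h" "\<zero>\<^bsub>R\<^esub> = h 0" "h x \<oplus>\<^bsub>R\<^esub> h y = h (x + y)" "h x \<otimes>\<^bsub>R\<^esub> h y = h (x * y)"
  by (simp_all add: ring_of_def univ_range)

lemma abelian_group_R: "abelian_group R"
proof (rule abelian_groupI)
  show "\<exists>y\<in>carrier R. y \<oplus>\<^bsub>R\<^esub> x = \<zero>\<^bsub>R\<^esub>" if x: "x \<in> carrier R" for x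
  proof -
    obtain a where "x = h a" using x by auto
    then show ?thesis by (intro bexI[of _ "h (- a)"]) auto
  qed
qed (auto simp: algebra_simps)

lemma a_minus_R [simp]: "\<ominus>\<^bsub>R\<^esub> h x = h (- x)" "h x \<ominus>\<^bsub>R\<^esub> h y = h (x - y)"
proof -
  show *: "\<ominus>\<^bsub>R\<^esub> h x = h (- x)" for x
    by (rule abelian_group.minus_equality[OF abelian_group_R]) auto
  show "h x \<ominus>\<^bsub>R\<^esub> h y = h (x - y)" by (simp add: a_minus_def *)
qed

lemma abs_in_R [simp]: "abs_in M (h x) = h \<bar>x\<bar>"
  by (simp add: abs_in_def abs_if)

lemma positives_R: "positives M = h ` {0<..}"
  by (auto simp: positives_def univ_range)

lemma near_R: "length v = length u \<Longrightarrow> near M (h \<epsilon>) (map h u) (map h v) \<longleftrightarrow> (\<forall>i<length u. \<bar>v ! i - u ! i\<bar> < \<epsilon>)"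
  by (auto simp: near_def)

lemma finsum_R: "(\<Oplus>\<^bsub>R\<^esub>i\<in>{..<n::nat}. h (a i)) = h (\<Sum>i<n. a i)"
proof -
  interpret abelian_group R by (rule abelian_group_R)
  show ?thesis
  proof (induction n)
    case (Suc n)
    then show ?case by (simp add: lessThan_Suc Pi_def add.commute)
  qed simp
qed

lemma tuples_R: "tuples M n = map h ` {v. length v = n}"
proof -
  have "set xs \<subseteq> range h \<longleftrightarrow> (\<exists>ys. xs = map h ys)" for xs
    unfolding ex_map_conv by auto
  then show ?thesis unfolding tuples_def univ_range by auto
qed

lemma has_partial_deriv_R:
  assumes f: "\<And>w. map h w \<in> U \<Longrightarrow> f (map h w) = h (f' w)" and v: "map h v \<in> U" "i < length v"
  shows "has_partial_deriv M U f i (map h v) (h d) \<longleftrightarrow> partial_at {w. map h w \<in> U} f' i v d"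
proof -
  have upd: "(map h v)[i := map h v ! i \<oplus>\<^bsub>R\<^esub> h k] = map h (v[i := v ! i + k])" for k
    using v(2) by (simp add: map_update)
  have quot: "less_in M (abs_in M ((f (map h (v[i := v ! i + k])) \<ominus>\<^bsub>R\<^esub> f (map h v)) \<ominus>\<^bsub>R\<^esub> (h d \<otimes>\<^bsub>R\<^esub> h k)))
      (h \<epsilon> \<otimes>\<^bsub>R\<^esub> abs_in M (h k)) \<longleftrightarrow> \<bar>f' (v[i := v ! i + k]) - f' v - d * k\<bar> < \<epsilon> * \<bar>k\<bar>"
    if "map h (v[i := v ! i + k]) \<in> U" for k \<epsilon>
    unfolding f[OF that] f[OF v(1)] by simp
  show ?thesis
    unfolding has_partial_deriv_def partial_at_def Let_def positives_R univ_range ball_simps bex_simps upd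
    using quot by (auto simp: Ball_def Bex_def)
qed

theorem RCF_derivation_R:
  assumes der: "derivation M \<delta>"
  shows "RCF_derivation M \<delta>"
proof -
  define g where "g = inv_into UNIV h"
  have gh [simp]: "g (h x) = x" for x by (simp add: g_def inv_into_f_f inj_on_def)
  have hg: "h (g y) = y" if "y \<in> univ M" for y
    using that by (simp add: g_def univ_range f_inv_into_f)
  have \<delta>: "\<delta> x \<in> univ M" if "x \<in> univ M" for x using der that by (auto simp: derivation_def Let_def)
  define \<delta>' where "\<delta>' = (\<lambda>x. g (\<delta> (h x)))"
  have h\<delta>': "h (\<delta>' x) = \<delta> (h x)" for x by (simp add: \<delta>'_def hg \<delta>)
  have \<delta>': "is_derivation \<delta>'"
  proof -
    have "h (\<delta>' (x + y)) = h (\<delta>' x + \<delta>' y)" "h (\<delta>' (x * y)) = h (x * \<delta>' y + y * \<delta>' x)" for x y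
    proof -
      have "\<delta> (h x \<oplus>\<^bsub>R\<^esub> h y) = \<delta> (h x) \<oplus>\<^bsub>R\<^esub> \<delta> (h y)"
        "\<delta> (h x \<otimes>\<^bsub>R\<^esub> h y) = (h x \<otimes>\<^bsub>R\<^esub> \<delta> (h y)) \<oplus>\<^bsub>R\<^esub> (h y \<otimes>\<^bsub>R\<^esub> \<delta> (h x))"
        using der h_univ unfolding derivation_def Let_def by blast+
      then show "h (\<delta>' (x + y)) = h (\<delta>' x + \<delta>' y)" "h (\<delta>' (x * y)) = h (x * \<delta>' y + y * \<delta>' x)"
        unfolding ring_of_simps h\<delta>'[symmetric] by simp_all
    qed
    then show ?thesis unfolding is_derivation_def h_eq by blast
  qed
  have "\<delta> (f u) = (\<Oplus>\<^bsub>R\<^esub>i\<in>{..<n}. partial_deriv M U f i u \<otimes>\<^bsub>R\<^esub> \<delta> (u ! i))"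
    if op: "open_tuples M n U" and fU: "f \<in> U \<rightarrow> univ M"
      and df: "definable_fun oring_language M n U f" and C1: "C1_on M n U f" and uU: "u \<in> U" for n U f u
  proof -
    define U' where "U' = {v. map h v \<in> U}"
    define f' where "f' = (\<lambda>v. g (f (map h v)))"
    define D where "D = (\<lambda>i v. g (partial_deriv M U f i (map h v)))"
    have tup: "U \<subseteq> tuples M n" using op by (simp add: open_tuples_def)
    then have len: "length v = n" if "map h v \<in> U" for v using that by (auto simp: tuples_def)
    have hf': "f (map h v) = h (f' v)" if "map h v \<in> U" for v
      unfolding f'_def by (rule hg[symmetric]) (use that fU in auto)
    have open': "\<exists>\<eta>>0. cube n \<eta> v \<subseteq> U'" if v: "map h v \<in> U" for v
    proof -
      obtain \<eta> where \<eta>: "\<eta> > 0" "\<forall>w\<in>tuples M n. near M (h \<eta>) (map h v) w \<longrightarrow> w \<in> U"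
        using op v unfolding open_tuples_def positives_R by blast
      have "cube n \<eta> v \<subseteq> U'"
        using \<eta>(2) len[OF v] by (auto simp: cube_def U'_def tuples_R near_R)
      then show ?thesis using \<eta>(1) by blast
    qed
    have partial: "partial_deriv M U f i (map h v) = h (D i v)" "partial_at U' f' i v (D i v)"
      if i: "i < n" and v: "map h v \<in> U" for i v
    proof -
      have iff: "has_partial_deriv M U f i (map h v) (h d) \<longleftrightarrow> partial_at U' f' i v d" for d
        unfolding U'_def by (rule has_partial_deriv_R) (use hf' v i len[OF v] in auto)
      obtain d' where "d' \<in> univ M" "has_partial_deriv M U f i (map h v) d'"
        using C1 i v unfolding C1_on_def by blast
      then obtain d where d: "has_partial_deriv M U f i (map h v) (h d)" by (auto simp: univ_range)
      obtain \<eta> where \<eta>: "\<eta> > 0" "cube n \<eta> v \<subseteq> U'" using open'[OF v] by blast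
      \<comment> \<open>Uniqueness evaluates the definite description in
        \<open>partial_deriv\<close>. It uses the cube around the point, which provides enough
        increments.\<close>
      have uniq: "e = d" if "partial_at U' f' i v e" for e
        using partial_at_unique[OF that iff[THEN iffD1, OF d] \<eta>(2,1) len[OF v] i] .
      have pd: "partial_deriv M U f i (map h v) = h d"
        unfolding partial_deriv_def
      proof (rule the_equality)
        show "h d \<in> univ M \<and> has_partial_deriv M U f i (map h v) (h d)" using d by simp
        fix d2 assume d2: "d2 \<in> univ M \<and> has_partial_deriv M U f i (map h v) d2"
        then obtain e where e: "d2 = h e" by (auto simp: univ_range)
        then have "partial_at U' f' i v e" using d2 iff[of e] by blast
        then show "d2 = h d" using uniq e by simp
      qed
      then have "D i v = d" by (simp add: D_def)
      then show "partial_deriv M U f i (map h v) = h (D i v)" "partial_at U' f' i v (D i v)"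
        using pd d iff by simp_all
    qed
    have "u \<in> tuples M n" using tup uU by blast
    then obtain u' where u': "u = map h u'" "length u' = n" by (auto simp: tuples_R)
    have uU': "map h u' \<in> U" using uU u' by simp
    obtain \<phi> where \<phi>: "form_of (oring_language :: ('f ofun, 'r orel) language) \<phi>" "free_vars \<phi> \<subseteq> {..<Suc n}"
      "(\<lambda>u. u @ [f u]) ` U = {xs \<in> tuples M (Suc n). sat M (nth xs) \<phi>}"
      using df unfolding definable_fun_def definable_def by blast
    have "sat field_struct (env_of (v @ [y])) \<phi> \<longleftrightarrow> v \<in> U' \<and> y = f' v" if v: "length v = n" for v y
    proof -
      have "range (env_of (v @ [y])) \<subseteq> univ (field_struct :: ('f ofun, 'r orel, 'b) fo_struct)"
        by (simp add: field_struct_def)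
      from sat_iso[OF iso \<phi>(1) this]
      have "sat field_struct (env_of (v @ [y])) \<phi> \<longleftrightarrow> sat M (\<lambda>i. h (env_of (v @ [y]) i)) \<phi>" by simp
      \<comment> \<open>The padded environment and \<open>nth\<close> may differ beyond the list,
        but free variables of the formula are below \<open>Suc n\<close>.\<close>
      also have "\<dots> \<longleftrightarrow> sat M (nth (map h v @ [h y])) \<phi>"
      proof (rule sat_cong)
        fix i assume "i \<in> free_vars \<phi>"
        then have "i < Suc n" using \<phi>(2) by auto
        then show "h (env_of (v @ [y]) i) = (map h v @ [h y]) ! i"
          using v by (auto simp: env_of_def nth_append)
      qed
      also have "\<dots> \<longleftrightarrow> map h v @ [h y] \<in> (\<lambda>u. u @ [f u]) ` U"
        unfolding \<phi>(3) using v by (auto simp: tuples_def)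
      also have "\<dots> \<longleftrightarrow> map h v \<in> U \<and> h y = f (map h v)" by auto
      also have "\<dots> \<longleftrightarrow> v \<in> U' \<and> y = f' v" using hf' by (auto simp: U'_def)
      finally show ?thesis .
    qed
    then have graph: "graph_semialg {} n U' f'"
      unfolding graph_semialg_def using semialg_sat[OF \<phi>(1)] by blast
    have "\<delta>' (f' u') = (\<Sum>i<n. D i u' * \<delta>' (u' ! i))"
    proof (rule derivation_chain_rule[OF \<delta>' graph _ u'(2) open'[OF uU']])
      show "u' \<in> U'" using uU' by (simp add: U'_def)
      show "partial_at U' f' i v (D i v)" if "i < n" "v \<in> U'" for i v
        using partial(2) that by (simp add: U'_def)
      show "\<exists>\<eta>>0. \<forall>v\<in>U' \<inter> cube n \<eta> u'. \<bar>D i v - D i u'\<bar> < \<epsilon>" if i: "i < n" and "\<epsilon> > 0" for i \<epsilon>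
      proof -
        have "h \<epsilon> \<in> positives M" using \<open>\<epsilon> > 0\<close> by (auto simp: positives_R)
        then obtain \<eta> where \<eta>: "\<eta> > 0" "\<And>v. v \<in> U \<Longrightarrow> near M (h \<eta>) u v \<Longrightarrow>
            less_in M (abs_in M (partial_deriv M U f i v \<ominus>\<^bsub>R\<^esub> partial_deriv M U f i u)) (h \<epsilon>)"
          using C1 i uU unfolding C1_on_def continuous_on_tuples_def positives_R by blast
        have "\<bar>D i v - D i u'\<bar> < \<epsilon>" if "v \<in> U' \<inter> cube n \<eta> u'" for v
          using \<eta>(2)[of "map h v"] that partial(1)[OF i] uU' u' len[of v]
          by (auto simp: U'_def cube_def near_R)
        then show ?thesis using \<eta>(1) by blast
      qed
    qed
    then have "h (\<delta>' (f' u')) = (\<Oplus>\<^bsub>R\<^esub>i\<in>{..<n}. h (D i u' * \<delta>' (u' ! i)))"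
      by (simp only: finsum_R)
    also have "\<dots> = (\<Oplus>\<^bsub>R\<^esub>i\<in>{..<n}. partial_deriv M U f i u \<otimes>\<^bsub>R\<^esub> \<delta> (u ! i))"
    proof -
      interpret abelian_group R by (rule abelian_group_R)
      have eq: "h (D i u' * \<delta>' (u' ! i)) = partial_deriv M U f i u \<otimes>\<^bsub>R\<^esub> \<delta> (u ! i)" if "i \<in> {..<n}" for i
      proof -
        have "partial_deriv M U f i u \<otimes>\<^bsub>R\<^esub> \<delta> (u ! i) = h (D i u') \<otimes>\<^bsub>R\<^esub> h (\<delta>' (u' ! i))"
          using that partial(1)[OF _ uU'] u' h\<delta>' by simp
        then show ?thesis by simp
      qed
      have "partial_deriv M U f i u \<otimes>\<^bsub>R\<^esub> \<delta> (u ! i) \<in> carrier R" if "i \<in> {..<n}" for i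
        unfolding eq[OF that, symmetric] by simp
      then show ?thesis by (intro finsum_cong' eq) auto
    qed
    finally show ?thesis using h\<delta>' hf'[OF uU'] u'(1) by simp
  qed
  then show ?thesis using \<delta> unfolding RCF_derivation_def Let_def by blast
qed

end

section \<open>From structures to types\<close>

text \<open>HOL has no types depending on terms, so a structure cannot be turned into an instance of
  \<^class>\<open>real_closed\<close> inside a proof.  A single type suffices, however: its carrier is
  a counterexample if there is one, and the copy of the reals only serves as a default.\<close>

definition counterexample :: "('f ofun, 'r orel, 'a) fo_struct \<Rightarrow> bool" where
  "counterexample M \<longleftrightarrow> rc_struct M \<and> (\<exists>\<delta>. derivation M \<delta> \<and> \<not> RCF_derivation M \<delta>)"

definition chosen_struct :: "('f ofun, 'r orel, 'a + real) fo_struct" where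
  "chosen_struct = (if \<exists>M :: ('f ofun, 'r orel, 'a) fo_struct. counterexample M
     then copy_struct Inl (SOME M :: ('f ofun, 'r orel, 'a) fo_struct. counterexample M)
     else copy_struct Inr field_struct)"

lemma rc_struct_copy:
  assumes "inj f" "rc_struct M"
  shows "rc_struct (copy_struct f M)"
proof -
  note copy = struct_iso_copy[OF assms(1) rc_structD(1)[OF assms(2)]]
  show ?thesis by (rule rc_struct_iso[OF copy assms(2)])
qed

lemma rc_struct_chosen: "rc_struct (chosen_struct :: ('f ofun, 'r orel, 'a + real) fo_struct)"
proof (cases "\<exists>M :: ('f ofun, 'r orel, 'a) fo_struct. counterexample M")
  case True
  then have "counterexample (SOME M :: ('f ofun, 'r orel, 'a) fo_struct. counterexample M)" by (rule someI_ex)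
  then have "rc_struct (SOME M :: ('f ofun, 'r orel, 'a) fo_struct. counterexample M)"
    by (simp only: counterexample_def)
  then show ?thesis using True by (simp add: chosen_struct_def rc_struct_copy)
next
  case False
  then show ?thesis by (simp add: chosen_struct_def rc_struct_copy rc_struct_field_struct_real)
qed

typedef ('f, 'r, 'a) rc_carrier = "univ (chosen_struct :: ('f ofun, 'r orel, 'a + real) fo_struct)"
  using rc_struct_chosen unfolding rc_struct_def structure_for_def by blast

section \<open>The ordered field on the chosen carrier\<close>

instantiation rc_carrier :: (type, type, type) linordered_field
begin

definition zero_rc_carrier :: "('a, 'b, 'c) rc_carrier" where
  "0 = Abs_rc_carrier (zero_in (chosen_struct :: ('a ofun, 'b orel, 'c + real) fo_struct))"

definition one_rc_carrier :: "('a, 'b, 'c) rc_carrier" where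
  "1 = Abs_rc_carrier (one_in (chosen_struct :: ('a ofun, 'b orel, 'c + real) fo_struct))"

definition plus_rc_carrier :: "('a, 'b, 'c) rc_carrier \<Rightarrow> ('a, 'b, 'c) rc_carrier \<Rightarrow> ('a, 'b, 'c) rc_carrier" where
  "x + y = Abs_rc_carrier (plus_in (chosen_struct :: ('a ofun, 'b orel, 'c + real) fo_struct)
     (Rep_rc_carrier x) (Rep_rc_carrier y))"

definition times_rc_carrier :: "('a, 'b, 'c) rc_carrier \<Rightarrow> ('a, 'b, 'c) rc_carrier \<Rightarrow> ('a, 'b, 'c) rc_carrier" where
  "x * y = Abs_rc_carrier (times_in (chosen_struct :: ('a ofun, 'b orel, 'c + real) fo_struct)
     (Rep_rc_carrier x) (Rep_rc_carrier y))"

definition uminus_rc_carrier :: "('a, 'b, 'c) rc_carrier \<Rightarrow> ('a, 'b, 'c) rc_carrier" where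
  "- x = Abs_rc_carrier (minus_in (chosen_struct :: ('a ofun, 'b orel, 'c + real) fo_struct) (Rep_rc_carrier x))"

definition less_rc_carrier :: "('a, 'b, 'c) rc_carrier \<Rightarrow> ('a, 'b, 'c) rc_carrier \<Rightarrow> bool" where
  "x < y \<longleftrightarrow> less_in (chosen_struct :: ('a ofun, 'b orel, 'c + real) fo_struct)
     (Rep_rc_carrier x) (Rep_rc_carrier y)"

definition minus_rc_carrier :: "('a, 'b, 'c) rc_carrier \<Rightarrow> ('a, 'b, 'c) rc_carrier \<Rightarrow> ('a, 'b, 'c) rc_carrier" where
  "x - y = x + - y" for x y :: "('a, 'b, 'c) rc_carrier"

definition inverse_rc_carrier :: "('a, 'b, 'c) rc_carrier \<Rightarrow> ('a, 'b, 'c) rc_carrier" where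
  "inverse x = (if x = 0 then 0 else SOME y. x * y = 1)" for x :: "('a, 'b, 'c) rc_carrier"

definition divide_rc_carrier :: "('a, 'b, 'c) rc_carrier \<Rightarrow> ('a, 'b, 'c) rc_carrier \<Rightarrow> ('a, 'b, 'c) rc_carrier" where
  "x div y = x * inverse y" for x y :: "('a, 'b, 'c) rc_carrier"

definition less_eq_rc_carrier :: "('a, 'b, 'c) rc_carrier \<Rightarrow> ('a, 'b, 'c) rc_carrier \<Rightarrow> bool" where
  "x \<le> y \<longleftrightarrow> x < y \<or> x = y" for x y :: "('a, 'b, 'c) rc_carrier"

definition abs_rc_carrier :: "('a, 'b, 'c) rc_carrier \<Rightarrow> ('a, 'b, 'c) rc_carrier" where
  "\<bar>x\<bar> = (if x < 0 then - x else x)" for x :: "('a, 'b, 'c) rc_carrier"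

definition sgn_rc_carrier :: "('a, 'b, 'c) rc_carrier \<Rightarrow> ('a, 'b, 'c) rc_carrier" where
  "sgn x = (if x = 0 then 0 else if 0 < x then 1 else - 1)" for x :: "('a, 'b, 'c) rc_carrier"

lemma rep_rc_carrier:
  fixes x y :: "('a, 'b, 'c) rc_carrier"
  defines "C \<equiv> (chosen_struct :: ('a ofun, 'b orel, 'c + real) fo_struct)"
  shows "Rep_rc_carrier (0 :: ('a, 'b, 'c) rc_carrier) = zero_in C"
    "Rep_rc_carrier (1 :: ('a, 'b, 'c) rc_carrier) = one_in C"
    "Rep_rc_carrier (x + y) = plus_in C (Rep_rc_carrier x) (Rep_rc_carrier y)"
    "Rep_rc_carrier (x * y) = times_in C (Rep_rc_carrier x) (Rep_rc_carrier y)"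
    "Rep_rc_carrier (- x) = minus_in C (Rep_rc_carrier x)"
proof -
  have "structure_for oring_language C" unfolding C_def by (rule rc_structD(1)[OF rc_struct_chosen])
  note closed = structure_oring_closed[OF this]
  note rep = Rep_rc_carrier[of x, folded C_def] Rep_rc_carrier[of y, folded C_def]
  show "Rep_rc_carrier (0 :: ('a, 'b, 'c) rc_carrier) = zero_in C"
    using closed by (simp add: zero_rc_carrier_def C_def Abs_rc_carrier_inverse)
  show "Rep_rc_carrier (1 :: ('a, 'b, 'c) rc_carrier) = one_in C"
    using closed by (simp add: one_rc_carrier_def C_def Abs_rc_carrier_inverse)
  show "Rep_rc_carrier (x + y) = plus_in C (Rep_rc_carrier x) (Rep_rc_carrier y)"
    using closed rep by (simp add: plus_rc_carrier_def C_def Abs_rc_carrier_inverse)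
  show "Rep_rc_carrier (x * y) = times_in C (Rep_rc_carrier x) (Rep_rc_carrier y)"
    using closed rep by (simp add: times_rc_carrier_def C_def Abs_rc_carrier_inverse)
  show "Rep_rc_carrier (- x) = minus_in C (Rep_rc_carrier x)"
    using closed rep by (simp add: uminus_rc_carrier_def C_def Abs_rc_carrier_inverse)
qed

lemma rc_carrier_axioms:
  fixes x y z :: "('a, 'b, 'c) rc_carrier"
  shows "x + y + z = x + (y + z)" "x + y = y + x" "x + 0 = x" "x + - x = 0"
    "x * y * z = x * (y * z)" "x * y = y * x" "x * 1 = x" "x * (y + z) = x * y + x * z"
    "(0 :: ('a, 'b, 'c) rc_carrier) \<noteq> 1" "x \<noteq> 0 \<Longrightarrow> \<exists>y. x * y = 1"
    "\<not> x < x" "x < y \<Longrightarrow> y < z \<Longrightarrow> x < z" "x < y \<or> x = y \<or> y < x"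
    "x < y \<Longrightarrow> x + z < y + z" "0 < x \<Longrightarrow> 0 < y \<Longrightarrow> 0 < x * y"
proof -
  define C where "C = (chosen_struct :: ('a ofun, 'b orel, 'c + real) fo_struct)"
  have "structure_for oring_language C" "\<forall>\<sigma>\<in>ordered_field_axioms. holds C \<sigma>"
    unfolding C_def by (rule rc_structD[OF rc_struct_chosen])+
  note ax = holds_ordered_field_axioms[OF this]
  have rep: "Rep_rc_carrier u \<in> univ C" for u :: "('a, 'b, 'c) rc_carrier"
    using Rep_rc_carrier[of u] by (simp add: C_def)
  note defs = Rep_rc_carrier_inject[symmetric] rep_rc_carrier[folded C_def] less_rc_carrier_def[folded C_def]
  show "x + y + z = x + (y + z)" using ax(1) rep unfolding defs by blast
  show "x + y = y + x" using ax(2) rep unfolding defs by blast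
  show "x + 0 = x" using ax(3) rep unfolding defs by blast
  show "x + - x = 0" using ax(4) rep unfolding defs by blast
  show "x * y * z = x * (y * z)" using ax(5) rep unfolding defs by blast
  show "x * y = y * x" using ax(6) rep unfolding defs by blast
  show "x * 1 = x" using ax(7) rep unfolding defs by blast
  show "x * (y + z) = x * y + x * z" using ax(8) rep unfolding defs by blast
  show "(0 :: ('a, 'b, 'c) rc_carrier) \<noteq> 1" using ax(9) rep unfolding defs by blast
  show "\<exists>y. x * y = 1" if "x \<noteq> 0"
  proof -
    have "Rep_rc_carrier x \<noteq> zero_in C" using that unfolding defs .
    then obtain v where v: "v \<in> univ C" "times_in C (Rep_rc_carrier x) v = one_in C"
      using ax(10) rep by blast
    then have "Rep_rc_carrier (Abs_rc_carrier v :: ('a, 'b, 'c) rc_carrier) = v"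
      by (simp add: C_def Abs_rc_carrier_inverse)
    then show ?thesis using v(2) unfolding defs by metis
  qed
  show "\<not> x < x" using ax(11) rep unfolding defs by blast
  show "x < y \<Longrightarrow> y < z \<Longrightarrow> x < z" using ax(12) rep unfolding defs by blast
  show "x < y \<or> x = y \<or> y < x" using ax(13) rep unfolding defs by blast
  show "x < y \<Longrightarrow> x + z < y + z" using ax(14) rep unfolding defs by blast
  show "0 < x \<Longrightarrow> 0 < y \<Longrightarrow> 0 < x * y" using ax(15) rep unfolding defs by blast
qed

instance
proof
  fix x y z :: "('a, 'b, 'c) rc_carrier"
  note ax = rc_carrier_axioms
  show add_assoc: "x + y + z = x + (y + z)" for x y z :: "('a, 'b, 'c) rc_carrier" by (rule ax)
  show add_comm: "x + y = y + x" for x y :: "('a, 'b, 'c) rc_carrier" by (rule ax)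
  show zero: "0 + x = x" for x :: "('a, 'b, 'c) rc_carrier" using ax(2,3) by metis
  show "- x + x = 0" using ax(2,4) by metis
  show "x - y = x + - y" by (rule minus_rc_carrier_def)
  have neg: "b = - a" if "a + b = 0" for a b :: "('a, 'b, 'c) rc_carrier"
    using that by (metis add_assoc add_comm zero ax(4))
  have "x + y + (- x + - y) = 0" by (metis add_assoc add_comm zero ax(4))
  from neg[OF this] show "z - x - y = z - (x + y)"
    by (simp only: minus_rc_carrier_def add_assoc)
  show "x + y - x = y" unfolding minus_rc_carrier_def by (metis add_assoc add_comm ax(3,4))
  have idem: "a = 0" if "a + a = a" for a :: "('a, 'b, 'c) rc_carrier"
    using that by (metis add_assoc ax(3,4))
  show annihilate: "x * 0 = 0" for x :: "('a, 'b, 'c) rc_carrier" using idem[of "x * 0"] ax(3,8) by metis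
  show "0 * x = 0" using annihilate ax(6) by metis
  show "x * y * z = x * (y * z)" by (rule ax)
  show comm: "x * y = y * x" for x y :: "('a, 'b, 'c) rc_carrier" by (rule ax)
  show "1 * x = x" using ax(6,7) by metis
  show "(x + y) * z = x * z + y * z" using ax(6,8) by metis
  show "(0 :: ('a, 'b, 'c) rc_carrier) \<noteq> 1" by (rule ax)
  show "inverse x * x = 1" if "x \<noteq> 0"
    using someI_ex[OF ax(10)[OF that]] that by (simp add: inverse_rc_carrier_def comm)
  show "x div y = x * inverse y" by (rule divide_rc_carrier_def)
  show "inverse (0 :: ('a, 'b, 'c) rc_carrier) = 0" by (simp add: inverse_rc_carrier_def)
  show "x < y \<longleftrightarrow> x \<le> y \<and> \<not> y \<le> x" unfolding less_eq_rc_carrier_def using ax(11,12) by metis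
  show "x \<le> x" by (simp add: less_eq_rc_carrier_def)
  show "x \<le> z" if "x \<le> y" "y \<le> z" using that ax(12) unfolding less_eq_rc_carrier_def by metis
  show "x = y" if "x \<le> y" "y \<le> x" using that ax(11,12) unfolding less_eq_rc_carrier_def by metis
  show "x \<le> y \<or> y \<le> x" using ax(13) unfolding less_eq_rc_carrier_def by metis
  show "z + x \<le> z + y" if "x \<le> y" using that ax(14)[of x y z] add_comm unfolding less_eq_rc_carrier_def by metis
  show "\<bar>x\<bar> = (if x < 0 then - x else x)" by (rule abs_rc_carrier_def)
  show "sgn x = (if x = 0 then 0 else if 0 < x then 1 else - 1)" by (rule sgn_rc_carrier_def)
  show "z * x < z * y" if "x < y" "0 < z"
  proof -
    have "0 < y + - x" using ax(14)[OF that(1), of "- x"] ax(4) by metis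
    then have "0 < z * (y + - x)" using ax(15) that(2) by blast
    then have "0 + z * x < z * (y + - x) + z * x" by (rule ax)
    moreover have "z * (y + - x) + z * x = z * y" by (metis ax(2,3,4,8) add_assoc)
    ultimately show ?thesis using zero by simp
  qed
qed

end

lemma field_iso_rc_carrier:
  "struct_iso (oring_language :: ('f ofun, 'r orel) language)
     (Rep_rc_carrier :: ('f, 'r, 'a) rc_carrier \<Rightarrow> _) field_struct chosen_struct"
proof -
  let ?C = "chosen_struct :: ('f ofun, 'r orel, 'a + real) fo_struct"
  let ?W = "field_struct :: ('f ofun, 'r orel, ('f, 'r, 'a) rc_carrier) fo_struct"
  have "structure_for oring_language ?W" by (simp add: structure_for_def field_struct_def)
  moreover have "bij_betw Rep_rc_carrier (univ ?W) (univ ?C)"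
    using type_definition.Rep_range[OF type_definition_rc_carrier] Rep_rc_carrier_inject
    by (auto simp: bij_betw_def field_struct_def inj_on_def)
  moreover have "fun_int ?C s (map Rep_rc_carrier xs) = Rep_rc_carrier (fun_int ?W s xs)"
    if "fun_arity (oring_language :: ('f ofun, 'r orel) language) s = Some n" "xs \<in> tuples ?W n" for s n xs
    using that by (cases s)
      (auto simp: tuples_def field_struct_def numeral_2_eq_2 length_Suc_conv rep_rc_carrier)
  moreover have "rel_int ?C r (map Rep_rc_carrier xs) \<longleftrightarrow> rel_int ?W r xs"
    if "rel_arity (oring_language :: ('f ofun, 'r orel) language) r = Some n" "xs \<in> tuples ?W n" for r n xs
    using that by (cases r)
      (auto simp: tuples_def field_struct_def numeral_2_eq_2 length_Suc_conv less_rc_carrier_def)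
  ultimately show ?thesis unfolding struct_iso_def by blast
qed

instance rc_carrier :: (type, type, type) real_closed
proof
  fix x0 b :: "('a, 'b, 'c) rc_carrier" and cs :: "('a, 'b, 'c) rc_carrier list"
  let ?C = "chosen_struct :: ('a ofun, 'b orel, 'c + real) fo_struct"
  let ?W = "field_struct :: ('a ofun, 'b orel, ('a, 'b, 'c) rc_carrier) fo_struct"
  let ?p = "\<lambda>x :: ('a, 'b, 'c) rc_carrier. foldr (\<lambda>c y. c + x * y) cs 0"
  assume x0: "?p x0 < 0" "x0 < b"
  let ?R = "Rep_rc_carrier :: ('a, 'b, 'c) rc_carrier \<Rightarrow> _"
  note iso = field_iso_rc_carrier[where ?'f = 'a and ?'r = 'b and ?'a = 'c]
  have univ: "univ ?C = range ?R"
    by (rule type_definition.Rep_range[OF type_definition_rc_carrier, symmetric])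
  have hor: "horner ?C (map ?R cs) (?R x) = ?R (?p x)" for x
    using horner_iso[OF iso, of cs x] by (simp add: horner_def field_struct_def)
  have neg: "negative_below ?C (map ?R cs) (?R b) = ?R ` {x. x < b \<and> ?p x < 0}"
    unfolding negative_below_def univ
    by (auto simp: hor less_rc_carrier_def rep_rc_carrier)
  have "\<exists>s. cut_of (less_in ?C) (univ ?C) (negative_below ?C (map ?R cs) (?R b)) s"
  proof -
    have "set (map ?R cs) \<subseteq> univ ?C" "?R b \<in> univ ?C" by (auto simp: univ)
    moreover have "negative_below ?C (map ?R cs) (?R b) \<noteq> {}"
      unfolding neg using x0 by auto
    ultimately show ?thesis by (rule rc_structD(3)[OF rc_struct_chosen])
  qed
  then obtain s where "cut_of (less_in ?C) (range ?R) (?R ` {x. x < b \<and> ?p x < 0}) (?R s)"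
    unfolding neg univ by (auto simp: cut_of_def)
  then show "\<exists>s. (\<forall>x<b. ?p x < 0 \<longrightarrow> x \<le> s) \<and> (\<forall>y z. y < z \<longrightarrow> z < s \<longrightarrow> (\<exists>x<b. ?p x < 0 \<and> y < x))"
    unfolding cut_of_def by (intro exI[of _ s]) (auto simp: not_less[symmetric] less_rc_carrier_def)
qed

text \<open>If the claim failed for some structure, the type \<open>rc_carrier\<close> would be
  isomorphic to a counterexample \<open>N\<close>, not necessarily the given \<open>M\<close>. The
  transfer along this isomorphism then shows that \<open>N\<close> is none.\<close>

lemma RCF_derivation_of_rc_struct:
  fixes M :: "('f ofun, 'r orel, 'a) fo_struct"
  assumes "rc_struct M" "derivation M \<delta>"
  shows "RCF_derivation M \<delta>"
proof (rule ccontr)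
  assume "\<not> RCF_derivation M \<delta>"
  then have ex: "\<exists>M :: ('f ofun, 'r orel, 'a) fo_struct. counterexample M"
    using assms unfolding counterexample_def by blast
  define N where "N = (SOME M :: ('f ofun, 'r orel, 'a) fo_struct. counterexample M)"
  have N: "counterexample N" unfolding N_def using ex by (rule someI_ex)
  have rc: "rc_struct N" using N by (simp add: counterexample_def)
  have chosen: "(chosen_struct :: ('f ofun, 'r orel, 'a + real) fo_struct) = copy_struct Inl N" using ex by (simp add: chosen_struct_def N_def)
  have iso: "struct_iso (oring_language :: ('f ofun, 'r orel) language) Inl N
      (chosen_struct :: ('f ofun, 'r orel, 'a + real) fo_struct)"
    unfolding chosen by (rule struct_iso_copy(1)[OF inj_Inl rc_structD(1)[OF rc]])
  from struct_iso_trans[OF field_iso_rc_carrier struct_iso_sym[OF iso rc_structD(1)[OF rc_struct_chosen]]]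
  have "field_iso (\<lambda>x :: ('f, 'r, 'a) rc_carrier. inv_into (univ N) Inl (Rep_rc_carrier x)) N"
    by (rule field_iso.intro)
  then show False using N field_iso.RCF_derivation_R unfolding counterexample_def by blast
qed

theorem proposition2p8:
  fixes L :: "('f ofun, 'r orel) language"
    and T :: "('f ofun, 'r orel) form set"
    and M :: "('f ofun, 'r orel, 'a) fo_struct"
    and \<delta> :: "'a \<Rightarrow> 'a"
  assumes "extends_language oring_language L"
    and "is_theory L T"
    and "extends_theory TYPE('a + ('f ofun, 'r orel) form) L RCF T"
    and "complete_theory TYPE('a + ('f ofun, 'r orel) form) L T"
    and "model_complete TYPE('a + ('f ofun, 'r orel) form) L T"
    and "o_minimal_theory TYPE('a + ('f ofun, 'r orel) form) L T"
    and "is_model L T M"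
    and "derivation M \<delta>"
  shows "RCF_derivation M \<delta>"
proof (rule RCF_derivation_of_rc_struct[OF _ assms(8)])
  \<comment> \<open>The hypotheses on the theory speak about structures on the sum type only.
    Therefore \<open>M\<close> is copied there, o-minimality is applied to the copy, and
    \<open>rc_struct\<close> is brought back along the inverse isomorphism.\<close>
  define N :: "('f ofun, 'r orel, 'a + ('f ofun, 'r orel) form) fo_struct"
    where "N = copy_struct Inl M"
  have M: "structure_for L M" "\<And>\<sigma>. \<sigma> \<in> T \<Longrightarrow> holds M \<sigma>" using assms(7) by (auto simp: is_model_def)
  have iso: "struct_iso L Inl M N" and N: "structure_for L N"
    using struct_iso_copy[OF inj_Inl M(1)] by (simp_all add: N_def)
  have "holds N \<sigma>" if "\<sigma> \<in> T" for \<sigma>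
    using holds_iso[OF iso, of \<sigma>] M(2)[OF that] that assms(2) by (auto simp: is_theory_def sentences_def)
  then have model: "is_model L T N" using N by (simp add: is_model_def)
  have ax: "holds N \<sigma>" if "\<sigma> \<in> ordered_field_axioms" for \<sigma>
    using assms(3) model that unfolding extends_theory_def entails_def RCF_def by blast
  have "o_minimal L N" using assms(6) model by (simp add: o_minimal_theory_def)
  from rc_struct_of_o_minimal[OF assms(1) N ax this] have "rc_struct N" .
  then show "rc_struct M"
    by (rule rc_struct_iso[OF struct_iso_sym[OF struct_iso_sublanguage[OF assms(1) iso]], rotated 2])
      (use structure_for_sublanguage[OF assms(1)] M(1) N in auto)
qed

end
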